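(* Let $n$ agents communicate over the graph $\mathcal G$ and let $f_i(x)=\mathbb{E}_{\xi_i}[F_i(x,\xi_i)]$ and $f=\frac1n\sum_{i=1}^n f_i:\mathbb{R}^p\to\mathbb{R}$. Suppose that: (1) the undirected graph $\mathcal G$ is connected; (2) the set $\mathbb{X}^*$ of minimizers of $f$ is nonempty and the optimal value $f^*=\min_x f(x)>-\infty$; (3) for almost all $\xi_i$, $F_i(\cdot,\xi_i)$ is smooth with constant $L_f>0$, i.e. it is differentiable and $\|\nabla_x F_i(x,\xi_i)-\nabla_x F_i(y,\xi_i)\|\le L_f\|x-y\|$ for all $x,y\in\mathbb{R}^p$, for every $i\in[n]$; (4) there is $\zeta\in\mathbb{R}$ such that for all $i\in[n]$, $j\in[p]$, $x\in\mathbb{R}^p$, $\mathbb{E}_{\xi_i}[((\nabla_xF_i(x,\xi_i)-\nabla f_i(x))_j)^2]\le\zeta^2$ (so $\mathbb{E}_{\xi_i}[\|\nabla_xF_i(x,\xi_i)-\nabla f_i(x)\|^2]\le\sigma_1^2:=p\zeta^2$); (5) there is $\sigma_2\in\mathbb{R}$ such that $\|\nabla f_i(x)-\nabla f(x)\|^2\le\sigma_2^2$ for all $i\in[n]$, $x\in\mathbb{R}^p$. For any given $T\ge n^3/p$, let $\{\boldsymbol{x}_k,\ k=0,\dots,T\}$, $\boldsymbol{x}_k=(x_{1,k},\dots,x_{n,k})$, be generated by Algorithm ZOOM (with either gradient-estimator option) with $$\alpha\in\Big(0,\frac{\rho_2(L)}{2\rho(L^2)}\Big),\qquad \eta=\frac{\sqrt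 n}{\sqrt{pT}},\qquad \delta_{i,k}\le\frac{\kappa_\delta}{p^{1/4}n^{1/4}(k+1)^{1/4}}\quad\forall k\le T,\ \forall i\in[n],$$ where $\kappa_\delta>0$. Then, with $\bar x_k=\frac1n\sum_{i=1}^n x_{i,k}$, $$\frac1T\sum_{k=0}^{T-1}\mathbb{E}[\|\nabla f(\bar x_k)\|^2]=\mathcal{O}\Big(\frac{\sqrt p}{\sqrt{nT}}\Big)+\mathcal{O}\Big(\frac nT\Big),$$ $$\mathbb{E}[f(\bar x_T)]-f^*=\mathcal{O}(1),$$ $$\frac1T\sum_{k=0}^{T-1}\mathbb{E}\Big[\frac1n\sum_{i=1}^n\|x_{i,k}-\bar x_k\|^2\Big]=\mathcal{O}\Big(\frac nT\Big).$$
   Context: Problem: $\min_{x\in\mathbb{R}^p} f(x)=\frac1n\sum_{i=1}^n\mathbb{E}_{\xi_i}[F_i(x,\xi_i)]$, where $\xi_i$ is a random variable in $\mathbb{R}^p$, and agent $i$ can only query values $F_i(\cdot,\xi_i)$. $[n]=\{1,\dots,n\}$; $\|\cdot\|$ is the Euclidean norm. Graph: $\mathcal G=(\mathcal V,\mathcal E)$ is undirected with $\mathcal V=\{1,\dots,n\}$ and symmetric weighted adjacency matrix $\mathcal A=(a_{ij})$, $a_{ij}>0$ if $(i,j)\in\mathcal E$ and $a_{ij}=0$ otherwise, $a_{ii}=0$. The Laplacian is $L=(L_{ij})=\mathrm{diag}(\deg_1,\dots,\deg_n)-\mathcal A$ with $\deg_i=\sum_j a_{ij}$. $\rho(\cdot)$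 is the spectral radius and $\rho_2(\cdot)$ the smallest positive eigenvalue. Gradient estimators: let $e_1,\dots,e_p$ be the standard basis of $\mathbb{R}^p$ and $n_c\in\{1,\dots,p\}$. At iteration $k$ agent $i$ draws a uniformly random subset $\mathcal S_{i,k}\subseteq\{1,\dots,p\}$ with $|\mathcal S_{i,k}|=n_c$ and a fresh sample $\xi_{i,k}$ of $\xi_i$ (both independent of the past), and with smoothing parameter $\delta_{i,k}>0$ forms either Option 1: $g^e_{i,k}=\frac{p}{n_c}\sum_{j\in\mathcal S_{i,k}}\frac{F_i(x_{i,k}+\delta_{i,k}e_j,\xi_{i,k})-F_i(x_{i,k},\xi_{i,k})}{\delta_{i,k}}e_j$, or Option 2: $g^e_{i,k}=\frac{p}{n_c}\sum_{j\in\mathcal S_{i,k}}\frac{F_i(x_{i,k}+\delta_{i,k}e_j,\xi_{i,k})-F_i(x_{i,k}-\delta_{i,k}e_j,\xi_{i,k})}{2\delta_{i,k}}e_j$. Algorithm ZOOM: from initial points $x_{i,0}\in\mathbb{R}^p$, with constants $\alpha,\eta>0$, for $k=0,1,\dots$ and all $i\in[n]$, $$x_{i,k+1}=x_{i,k}-\alpha\sum_{j=1}^nL_{ij}x_{j,k}-\eta\, g^e_{i,k}.$$ Convention: the constants hidden in $\mathcal{O}(\cdot)$ do not depend on $T$, $n$, $p$; they may depend on $L_f,\sigma_1,\zeta,\sigma_2,\kappa_\delta,\alpha,n_c,\rho(L),\rho_2(L),\rho(L^2)$ and on the initial quantities $\frac1n\sum_i\|x_{i,0}-\bar x_0\|^2$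 and $f(\bar x_0)-f^*$. $\mathbb{E}$ is expectation over all randomness of the algorithm.
   Formalization: The O-constants are independent of T, n, p only when also T ≥ c·p/n, with c depending only on the listed quantities; for n³/p ≤ T < c·p/n they may depend on p, since a p-free constant is impossible there (n=2, T=1, F_i=|x|²/2, p→∞). *)

theory Defs
  imports "HOL-Probability.Probability" "Jordan_Normal_Form.Spectral_Radius"
begin

text \<open>
  The number of agents n and the dimension p are quantified inside the main statement (the
  constants there are uniform in both), so they are terms rather than types.  Agents are
  \<open>0, ..., n - 1\<close>, coordinates are \<open>0, ..., p - 1\<close>, and Euclidean p-space is the set of
  functions \<^typ>\<open>nat \<Rightarrow> real\<close> that are \<^const>\<open>undefined\<close> outside \<open>{..<p}\<close>, with the product
  Borel sigma-algebra.
\<close>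

abbreviation eucl :: "nat \<Rightarrow> (nat \<Rightarrow> real) measure" where
  "eucl p \<equiv> (\<Pi>\<^sub>M l\<in>{..<p}. borel)"

definition Rp :: "nat \<Rightarrow> (nat \<Rightarrow> real) set" where
  "Rp p = space (eucl p)"

definition vnorm :: "nat \<Rightarrow> (nat \<Rightarrow> real) \<Rightarrow> real" where
  "vnorm p x = L2_set x {..<p}"

definition vdiff :: "nat \<Rightarrow> (nat \<Rightarrow> real) \<Rightarrow> (nat \<Rightarrow> real) \<Rightarrow> (nat \<Rightarrow> real)" where
  "vdiff p x y = (\<lambda>l\<in>{..<p}. x l - y l)"

text \<open>For \<open>j < p\<close> and x in p-space, \<open>x(j := x j + t)\<close> is the vector \<open>x + t e\<^sub>j\<close>.\<close>

definition grad :: "nat \<Rightarrow> ((nat \<Rightarrow> real) \<Rightarrow> real) \<Rightarrow> (nat \<Rightarrow> real) \<Rightarrow> (nat \<Rightarrow> real)" where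
  "grad p f x = (\<lambda>j\<in>{..<p}. deriv (\<lambda>t. f (x(j := t))) (x j))"

text \<open>
  Frechet differentiability, written out because \<^const>\<open>has_derivative\<close> needs a normed type.
  The derivative, if it exists, is necessarily given by the partial derivatives.
\<close>

definition differentiable_Rp :: "nat \<Rightarrow> ((nat \<Rightarrow> real) \<Rightarrow> real) \<Rightarrow> (nat \<Rightarrow> real) \<Rightarrow> bool" where
  "differentiable_Rp p f x \<longleftrightarrow>
     (\<exists>g\<in>Rp p. \<forall>e>0. \<exists>d>0. \<forall>y\<in>Rp p. vnorm p (vdiff p y x) < d \<longrightarrow>
        \<bar>f y - f x - (\<Sum>j<p. g j * (y j - x j))\<bar> \<le> e * vnorm p (vdiff p y x))"

definition smooth_Rp :: "nat \<Rightarrow> real \<Rightarrow> ((nat \<Rightarrow> real) \<Rightarrow> real) \<Rightarrow> bool" where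
  "smooth_Rp p Lf f \<longleftrightarrow>
     (\<forall>x\<in>Rp p. differentiable_Rp p f x) \<and>
     (\<forall>x\<in>Rp p. \<forall>y\<in>Rp p.
        vnorm p (vdiff p (grad p f x) (grad p f y)) \<le> Lf * vnorm p (vdiff p x y))"

definition minimizers :: "nat \<Rightarrow> ((nat \<Rightarrow> real) \<Rightarrow> real) \<Rightarrow> (nat \<Rightarrow> real) set" where
  "minimizers p f = {x \<in> Rp p. \<forall>y\<in>Rp p. f x \<le> f y}"

definition opt_value :: "nat \<Rightarrow> ((nat \<Rightarrow> real) \<Rightarrow> real) \<Rightarrow> real" where
  "opt_value p f = Inf (f ` Rp p)"


definition weighted_graph :: "nat \<Rightarrow> (nat \<times> nat) set \<Rightarrow> (nat \<Rightarrow> nat \<Rightarrow> real) \<Rightarrow> bool" where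
  "weighted_graph n E a \<longleftrightarrow>
     E \<subseteq> {..<n} \<times> {..<n} \<and> sym E \<and>
     (\<forall>i<n. \<forall>j<n. a i j = a j i) \<and>
     (\<forall>i<n. \<forall>j<n. if (i, j) \<in> E then a i j > 0 else a i j = 0) \<and>
     (\<forall>i<n. a i i = 0)"

definition graph_connected :: "nat \<Rightarrow> (nat \<times> nat) set \<Rightarrow> bool" where
  "graph_connected n E \<longleftrightarrow> (\<forall>i<n. \<forall>j<n. (i, j) \<in> E\<^sup>*)"

definition laplacian :: "nat \<Rightarrow> (nat \<Rightarrow> nat \<Rightarrow> real) \<Rightarrow> real mat" where
  "laplacian n a =
     Matrix.mat n n (\<lambda>(i, j). (if i = j then (\<Sum>l<n. a i l) else 0) - a i j)"

definition rho :: "real mat \<Rightarrow> real" where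
  "rho A = spectral_radius (map_mat complex_of_real A)"

text \<open>
  For n = 1 the Laplacian is zero and \<open>rho2\<close> is an unspecified value; the step size interval
  \<open>(0, rho2 L / (2 * rho (L * L)))\<close> is then \<open>(0, rho2 L / 0)\<close>, that is, empty.
\<close>

definition rho2 :: "real mat \<Rightarrow> real" where
  "rho2 A = Min {l. 0 < l \<and> eigenvalue A l}"


text \<open>\<open>D i\<close> is the distribution of the i-th data variable, \<open>F i\<close> the i-th stochastic loss.\<close>

definition local_obj ::
  "(nat \<Rightarrow> (nat \<Rightarrow> real) measure) \<Rightarrow> (nat \<Rightarrow> (nat \<Rightarrow> real) \<Rightarrow> (nat \<Rightarrow> real) \<Rightarrow> real) \<Rightarrow>
   nat \<Rightarrow> (nat \<Rightarrow> real) \<Rightarrow> real" where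
  "local_obj D F i x = (\<integral>\<xi>. F i x \<xi> \<partial>D i)"

definition global_obj ::
  "nat \<Rightarrow> (nat \<Rightarrow> (nat \<Rightarrow> real) measure) \<Rightarrow>
   (nat \<Rightarrow> (nat \<Rightarrow> real) \<Rightarrow> (nat \<Rightarrow> real) \<Rightarrow> real) \<Rightarrow> (nat \<Rightarrow> real) \<Rightarrow> real" where
  "global_obj n D F x = (\<Sum>i<n. local_obj D F i x) / real n"

text \<open>
  The joint measurability and the integrability are implicit in writing
  \<open>f\<^sub>i(x) = E[F\<^sub>i(x, \<xi>\<^sub>i)]\<close> and in evaluating \<open>F\<^sub>i\<close> at random points.
\<close>

definition stochastic_losses ::
  "nat \<Rightarrow> nat \<Rightarrow> (nat \<Rightarrow> (nat \<Rightarrow> real) measure) \<Rightarrow>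
   (nat \<Rightarrow> (nat \<Rightarrow> real) \<Rightarrow> (nat \<Rightarrow> real) \<Rightarrow> real) \<Rightarrow> bool" where
  "stochastic_losses n p D F \<longleftrightarrow>
     (\<forall>i<n. prob_space (D i) \<and> sets (D i) = sets (eucl p) \<and>
        (\<lambda>(x, \<xi>). F i x \<xi>) \<in> borel_measurable (eucl p \<Otimes>\<^sub>M D i) \<and>
        (\<forall>x\<in>Rp p. integrable (D i) (F i x)))"


datatype estimator = Forward_Difference | Central_Difference

fun grad_est ::
  "estimator \<Rightarrow> nat \<Rightarrow> nat \<Rightarrow> ((nat \<Rightarrow> real) \<Rightarrow> real) \<Rightarrow> real \<Rightarrow> nat set \<Rightarrow>
   (nat \<Rightarrow> real) \<Rightarrow> (nat \<Rightarrow> real)" where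
  "grad_est Forward_Difference p nc h d S x =
     (\<lambda>l\<in>{..<p}. real p / real nc *
        (\<Sum>j\<in>S. (h (x(j := x j + d)) - h x) / d * of_bool (l = j)))"
| "grad_est Central_Difference p nc h d S x =
     (\<lambda>l\<in>{..<p}. real p / real nc *
        (\<Sum>j\<in>S. (h (x(j := x j + d)) - h (x(j := x j - d))) / (2 * d) * of_bool (l = j)))"

definition subset_measure :: "nat \<Rightarrow> nat \<Rightarrow> nat set measure" where
  "subset_measure p nc = uniform_count_measure {A. A \<subseteq> {..<p} \<and> card A = nc}"

text \<open>
  The pairs \<open>(\<xi> i k, S i k)\<close> are independent over all agents and iterations.  That each pair is
  distributed as a product measure says that \<open>\<xi> i k\<close> has the distribution \<open>D i\<close>, that \<open>S i k\<close>
  is a uniformly random nc-subset, and that the two are independent.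
\<close>

definition zoom_samples ::
  "'w measure \<Rightarrow> nat \<Rightarrow> nat \<Rightarrow> nat \<Rightarrow> (nat \<Rightarrow> (nat \<Rightarrow> real) measure) \<Rightarrow>
   (nat \<Rightarrow> nat \<Rightarrow> 'w \<Rightarrow> (nat \<Rightarrow> real)) \<Rightarrow> (nat \<Rightarrow> nat \<Rightarrow> 'w \<Rightarrow> nat set) \<Rightarrow> bool" where
  "zoom_samples M n p nc D \<xi> S \<longleftrightarrow>
     prob_space.indep_vars M (\<lambda>(i, k). D i \<Otimes>\<^sub>M subset_measure p nc)
       (\<lambda>(i, k) \<omega>. (\<xi> i k \<omega>, S i k \<omega>)) ({..<n} \<times> UNIV) \<and>
     (\<forall>i<n. \<forall>k.
        distr M (D i \<Otimes>\<^sub>M subset_measure p nc) (\<lambda>\<omega>. (\<xi> i k \<omega>, S i k \<omega>)) =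
          D i \<Otimes>\<^sub>M subset_measure p nc)"

text \<open>\<open>zoom ... k i\<close> is the iterate of agent i at time k for one realisation of the samples.\<close>

primrec zoom ::
  "estimator \<Rightarrow> nat \<Rightarrow> nat \<Rightarrow> nat \<Rightarrow> real mat \<Rightarrow>
   (nat \<Rightarrow> (nat \<Rightarrow> real) \<Rightarrow> (nat \<Rightarrow> real) \<Rightarrow> real) \<Rightarrow> real \<Rightarrow> real \<Rightarrow> (nat \<Rightarrow> nat \<Rightarrow> real) \<Rightarrow>
   (nat \<Rightarrow> nat \<Rightarrow> real) \<Rightarrow> (nat \<Rightarrow> nat \<Rightarrow> (nat \<Rightarrow> real)) \<Rightarrow> (nat \<Rightarrow> nat \<Rightarrow> nat set) \<Rightarrow>
   nat \<Rightarrow> nat \<Rightarrow> (nat \<Rightarrow> real)" where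
  "zoom opt n p nc L F \<alpha> \<eta> \<delta> x0 \<xi> S 0 = x0"
| "zoom opt n p nc L F \<alpha> \<eta> \<delta> x0 \<xi> S (Suc k) =
     (let x = zoom opt n p nc L F \<alpha> \<eta> \<delta> x0 \<xi> S k in
      (\<lambda>i. \<lambda>l\<in>{..<p}. x i l - \<alpha> * (\<Sum>j<n. L $$ (i, j) * x j l)
         - \<eta> * grad_est opt p nc (\<lambda>y. F i y (\<xi> i k)) (\<delta> i k) (S i k) (x i) l))"

definition avg :: "nat \<Rightarrow> nat \<Rightarrow> (nat \<Rightarrow> nat \<Rightarrow> real) \<Rightarrow> (nat \<Rightarrow> real)" where
  "avg n p x = (\<lambda>l\<in>{..<p}. (\<Sum>i<n. x i l) / real n)"

definition consensus_err :: "nat \<Rightarrow> nat \<Rightarrow> (nat \<Rightarrow> nat \<Rightarrow> real) \<Rightarrow> real" where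
  "consensus_err n p x = (\<Sum>i<n. (vnorm p (vdiff p (x i) (avg n p x)))\<^sup>2) / real n"

end

(*
  ZOOM is treated as stochastic gradient descent with a biased oracle. A coordinate difference
  quotient differs from the partial derivative by at most L_f delta / 2, and the uniformly random
  coordinate subset makes the rescaled estimator unbiased for the difference quotients at the price
  of a factor p / n_c in the second moment.

  For every fixed state one step of the iteration satisfies two inequalities in conditional
  expectation. The consensus error contracts by 1 - alpha rho_2(L) up to a term of order
  eta^2 * (second moment of the estimators): on vectors of sum zero the Rayleigh quotients of L and
  L^2 are at least rho_2(L) and at most rho(L^2), which makes I - alpha L a contraction there. The
  objective gap at the average decreases by eta / 2 * |grad f|^2 up to the bias, the consensus error,
  and a variance term which is divided by n because the samples of different agents are independent.

  Summing both inequalities over k < T and substituting one into the other gives the three rates as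
  soon as T >= s^2 p / n for a constant s: together with T >= n^3 / p this forces n / T <= 1 / s,
  eta T >= s and eta n <= 1, so all cross terms are absorbed. For smaller T, both n and T are bounded
  in terms of p, and any bound that grows with T at a rate depending on p only suffices.
*)

theory Submission
  imports Defs
begin

section \<open>Smooth functions on p-space\<close>

text \<open>Consensus error and gradient sum feed each other: the second moment of the estimators
  contains the squared gradient, and the objective recursion contains the consensus error. The way
  out is the order of the constants. \<open>K1\<close> bounds the total consensus error through the
  total squared gradient, \<open>K2\<close> collects what then remains in the objective recursion,
  and neither mentions \<open>s\<close>; only afterwards is \<open>s\<close> chosen large enough.
  Descent with the factor \<eta> / 2 is obtained under \<open>\<eta> * Lf \<le> 1\<close>, which the
  lower bound n^3 / p on T does not guarantee. The objective therefore gets a second one-step bound,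
  valid for every \<eta>, that merely controls growth. Smoothness is known only for almost every
  sample, and no domination of the sample gradients is assumed. Differentiation under the
  expectation rests on the quadratic Taylor remainder, whose constant is the same for all good
  samples and survives integration. Conditioning is done without conditional expectation operators:
  the state is a function of earlier samples, independent of the fresh ones, so bounds at a frozen
  state are averaged by Tonelli's theorem.\<close>

lemma vnorm_sq: "(vnorm p x)\<^sup>2 = (\<Sum>l<p. (x l)\<^sup>2)"
  by (simp add: vnorm_def L2_set_def sum_nonneg)

lemma vnorm_nonneg [simp]: "0 \<le> vnorm p x"
  by (simp add: vnorm_def)

lemma vnorm_vdiff_sq: "(vnorm p (vdiff p x y))\<^sup>2 = (\<Sum>l<p. (x l - y l)\<^sup>2)"
  by (simp add: vnorm_sq vdiff_def)

lemma Rp_iff: "x \<in> Rp p \<longleftrightarrow> x \<in> extensional {..<p}"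
  by (auto simp: Rp_def space_PiM PiE_def)

lemma restrict_in_Rp [simp]: "restrict g {..<p} \<in> Rp p"
  by (simp add: Rp_iff)

lemma upd_in_Rp [simp]: "x \<in> Rp p \<Longrightarrow> j < p \<Longrightarrow> x(j := s) \<in> Rp p"
  by (auto simp: Rp_iff extensional_def)

text \<open>Restricting to \<open>{..<p}\<close> keeps the whole line inside \<open>Rp p\<close> for
  any direction \<open>v\<close>, so that one-variable calculus can be applied along it.\<close>

definition along :: "nat \<Rightarrow> (nat \<Rightarrow> real) \<Rightarrow> (nat \<Rightarrow> real) \<Rightarrow> real \<Rightarrow> (nat \<Rightarrow> real)" where
  "along p x v t = (\<lambda>l\<in>{..<p}. x l + t * v l)"

lemma along_in_Rp [simp]: "along p x v t \<in> Rp p"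
  by (simp add: along_def)

lemma vnorm_along_sq: "(vnorm p (vdiff p (along p x v s) (along p x v t)))\<^sup>2 = (s - t)\<^sup>2 * (vnorm p v)\<^sup>2"
  unfolding vnorm_vdiff_sq vnorm_sq[of p v] sum_distrib_left
  by (rule sum.cong) (auto simp: along_def power2_eq_square algebra_simps)

lemma vnorm_along: "vnorm p (vdiff p (along p x v s) (along p x v t)) = \<bar>s - t\<bar> * vnorm p v"
  by (rule power2_eq_imp_eq) (simp_all add: vnorm_along_sq power_mult_distrib)

lemma inner_le_vnorm: "(\<Sum>l<p. x l * y l) \<le> vnorm p x * vnorm p y"
proof -
  have "(\<Sum>l<p. x l * y l) \<le> (\<Sum>l<p. \<bar>x l\<bar> * \<bar>y l\<bar>)"
    by (rule sum_mono) (metis abs_ge_self abs_mult)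
  also have "\<dots> \<le> vnorm p x * vnorm p y"
    unfolding vnorm_def by (rule L2_set_mult_ineq)
  finally show ?thesis .
qed

text \<open>The matrix of \<open>differentiable_Rp\<close> with its witness exposed, so that the
  witness can be identified with \<open>grad\<close>.\<close>

definition frechet_grad :: "nat \<Rightarrow> ((nat \<Rightarrow> real) \<Rightarrow> real) \<Rightarrow> (nat \<Rightarrow> real) \<Rightarrow> (nat \<Rightarrow> real) \<Rightarrow> bool" where
  "frechet_grad p f x g \<longleftrightarrow> (\<forall>e>0. \<exists>d>0. \<forall>y\<in>Rp p. vnorm p (vdiff p y x) < d \<longrightarrow>
        \<bar>f y - f x - (\<Sum>j<p. g j * (y j - x j))\<bar> \<le> e * vnorm p (vdiff p y x))"

lemma frechet_grad_along:
  assumes "frechet_grad p f (along p x v t) g"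
  shows "((\<lambda>s. f (along p x v s)) has_real_derivative (\<Sum>j<p. g j * v j)) (at t)"
  unfolding has_field_derivative_iff LIM_def dist_norm
proof safe
  fix e :: real assume "e > 0"
  \<comment> \<open>The added 1 keeps the divisor positive when \<open>v\<close> vanishes; the 2 in
    \<open>e / (2 * N)\<close> makes the final inequality strict.\<close>
  define N where "N = vnorm p v + 1"
  have N: "N > 0" "vnorm p v \<le> N" unfolding N_def using vnorm_nonneg[of p v] by linarith+
  obtain d where d: "d > 0" and D: "\<And>y. y \<in> Rp p \<Longrightarrow> vnorm p (vdiff p y (along p x v t)) < d \<Longrightarrow>
        \<bar>f y - f (along p x v t) - (\<Sum>j<p. g j * (y j - along p x v t j))\<bar>
          \<le> e / (2 * N) * vnorm p (vdiff p y (along p x v t))"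
    using assms[unfolded frechet_grad_def, rule_format, of "e / (2 * N)"] \<open>e > 0\<close> N by auto
  show "\<exists>s>0. \<forall>xa. xa \<noteq> t \<and> norm (xa - t) < s \<longrightarrow>
        norm ((f (along p x v xa) - f (along p x v t)) / (xa - t) - (\<Sum>j<p. g j * v j)) < e"
  proof (intro exI conjI allI impI)
    show "d / N > 0" using d N by simp
    fix s assume s: "s \<noteq> t \<and> norm (s - t) < d / N"
    have "\<bar>s - t\<bar> * vnorm p v \<le> \<bar>s - t\<bar> * N" using N by (intro mult_left_mono) auto
    also have "\<dots> < d" using s N by (simp add: field_simps)
    finally have "\<bar>f (along p x v s) - f (along p x v t) - (\<Sum>j<p. g j * (along p x v s j - along p x v t j))\<bar>
          \<le> e / (2 * N) * (\<bar>s - t\<bar> * vnorm p v)"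
      using D[of "along p x v s"] by (simp add: vnorm_along)
    also have "(\<Sum>j<p. g j * (along p x v s j - along p x v t j)) = (s - t) * (\<Sum>j<p. g j * v j)"
      unfolding sum_distrib_left by (rule sum.cong) (auto simp: along_def algebra_simps)
    also have "e / (2 * N) * (\<bar>s - t\<bar> * vnorm p v) \<le> e / (2 * N) * (\<bar>s - t\<bar> * N)"
      using N \<open>e > 0\<close> by (intro mult_left_mono) auto
    also have "\<dots> = e / 2 * \<bar>s - t\<bar>" using N by simp
    finally have *: "\<bar>f (along p x v s) - f (along p x v t) - (s - t) * (\<Sum>j<p. g j * v j)\<bar> \<le> e / 2 * \<bar>s - t\<bar>" .
    have "norm ((f (along p x v s) - f (along p x v t)) / (s - t) - (\<Sum>j<p. g j * v j))
       = \<bar>f (along p x v s) - f (along p x v t) - (s - t) * (\<Sum>j<p. g j * v j)\<bar> / \<bar>s - t\<bar>"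
      using s by (simp add: field_simps flip: abs_divide)
    also have "\<dots> \<le> e / 2" using * s by (simp add: field_simps)
    also have "\<dots> < e" using \<open>e > 0\<close> by simp
    finally show "norm ((f (along p x v s) - f (along p x v t)) / (s - t) - (\<Sum>j<p. g j * v j)) < e" .
  qed
qed

text \<open>The base point has coordinate \<open>j\<close> erased, so the line parameter is the
  coordinate itself and the derivative at \<open>x j\<close> is the partial derivative.\<close>

lemma upd_eq_along:
  assumes "x \<in> Rp p" "j < p"
  shows "x(j := s) = along p (x(j := 0)) (\<lambda>l. of_bool (l = j)) s"
  using assms by (auto simp: along_def Rp_iff extensional_def fun_eq_iff)

lemma frechet_grad_partial:
  assumes "frechet_grad p f x g" "x \<in> Rp p" "j < p"
  shows "((\<lambda>s. f (x(j := s))) has_real_derivative g j) (at (x j))"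
proof -
  have "frechet_grad p f (x(j := x j)) g" using assms(1) by simp
  then have "frechet_grad p f (along p (x(j := 0)) (\<lambda>l. of_bool (l = j)) (x j)) g"
    unfolding upd_eq_along[OF assms(2,3), of "x j"] .
  moreover have "(\<lambda>s. f (x(j := s))) = (\<lambda>s. f (along p (x(j := 0)) (\<lambda>l. of_bool (l = j)) s))"
    by (rule ext, rule arg_cong[of _ _ f], rule upd_eq_along[OF assms(2,3)])
  ultimately have "((\<lambda>s. f (x(j := s))) has_real_derivative (\<Sum>l<p. g l * of_bool (l = j))) (at (x j))"
    using frechet_grad_along[of p f "x(j := 0)" "\<lambda>l. of_bool (l = j)" "x j" g] by (simp only:)
  moreover have "(\<Sum>l<p. g l * of_bool (l = j)) = (\<Sum>l<p. if l = j then g j else 0)"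
    by (rule sum.cong) auto
  ultimately show ?thesis using assms(3) by simp
qed

lemma frechet_grad_eq:
  assumes "frechet_grad p f x g" "x \<in> Rp p" "j < p"
  shows "grad p f x j = g j"
  using DERIV_imp_deriv[OF frechet_grad_partial[OF assms]] assms(3) by (simp add: grad_def)

text \<open>The entries of any Frechet derivative are the partial derivatives, so the anonymous
  witness of \<open>differentiable_Rp\<close> may be replaced by \<open>grad\<close>.\<close>

lemma smooth_Rp_frechet_grad:
  assumes "smooth_Rp p Lf f" "x \<in> Rp p"
  shows "frechet_grad p f x (grad p f x)"
proof -
  obtain g where g: "frechet_grad p f x g"
    using assms unfolding smooth_Rp_def differentiable_Rp_def frechet_grad_def by blast
  have "(\<Sum>j<p. grad p f x j * (y j - x j)) = (\<Sum>j<p. g j * (y j - x j))" for y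
    by (rule sum.cong) (auto simp: frechet_grad_eq[OF g assms(2)])
  then show ?thesis using g unfolding frechet_grad_def by simp
qed

lemma smooth_Rp_along:
  assumes "smooth_Rp p Lf f"
  shows "((\<lambda>s. f (along p x v s)) has_real_derivative (\<Sum>j<p. grad p f (along p x v t) j * v j)) (at t)"
  by (rule frechet_grad_along[OF smooth_Rp_frechet_grad[OF assms]]) simp

lemma smooth_Rp_lipschitz:
  assumes "smooth_Rp p Lf f" "x \<in> Rp p" "y \<in> Rp p"
  shows "vnorm p (vdiff p (grad p f x) (grad p f y)) \<le> Lf * vnorm p (vdiff p x y)"
  using assms unfolding smooth_Rp_def by blast

text \<open>Subtracting the linear part and \<open>K / 2 * t\<^sup>2\<close> leaves a function with
  nonpositive derivative. This gives the sharp factor 1/2 without integrating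
  \<open>\<phi>'\<close>.\<close>

lemma derivative_lipschitz_upper:
  fixes \<phi> :: "real \<Rightarrow> real"
  assumes "\<And>t. 0 \<le> t \<Longrightarrow> t \<le> 1 \<Longrightarrow> (\<phi> has_real_derivative \<phi>' t) (at t)"
    and "\<And>t. 0 \<le> t \<Longrightarrow> t \<le> 1 \<Longrightarrow> \<phi>' t - \<phi>' 0 \<le> K * t"
  shows "\<phi> 1 - \<phi> 0 - \<phi>' 0 \<le> K / 2"
proof -
  have "\<phi> 1 - \<phi>' 0 * 1 - K / 2 * 1\<^sup>2 \<le> \<phi> 0 - \<phi>' 0 * 0 - K / 2 * 0\<^sup>2"
  proof (rule DERIV_nonpos_imp_nonincreasing[of 0 1 "\<lambda>t. \<phi> t - \<phi>' 0 * t - K / 2 * t\<^sup>2"])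
    fix t :: real assume t: "0 \<le> t" "t \<le> 1"
    have "((\<lambda>t. \<phi> t - \<phi>' 0 * t - K / 2 * t\<^sup>2) has_real_derivative \<phi>' t - \<phi>' 0 - K * t) (at t)"
      by (auto intro!: derivative_eq_intros assms(1) t)
    then show "\<exists>y. ((\<lambda>t. \<phi> t - \<phi>' 0 * t - K / 2 * t\<^sup>2) has_real_derivative y) (at t) \<and> y \<le> 0"
      using assms(2)[OF t] by (intro exI[of _ "\<phi>' t - \<phi>' 0 - K * t"]) simp
  qed simp
  then show ?thesis by simp
qed

lemma smooth_Rp_taylor:
  assumes S: "smooth_Rp p Lf f" and x: "x \<in> Rp p" and y: "y \<in> Rp p"
  shows "\<bar>f y - f x - (\<Sum>l<p. grad p f x l * (y l - x l))\<bar> \<le> Lf / 2 * (\<Sum>l<p. (y l - x l)\<^sup>2)"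
proof -
  define v where "v = vdiff p y x"
  define g where "g t = grad p f (along p x v t)" for t
  define \<phi>' where "\<phi>' t = (\<Sum>l<p. g t l * v l)" for t
  have along01: "along p x v 0 = x" "along p x v 1 = y"
    using x y by (auto simp: along_def v_def vdiff_def Rp_iff extensional_def fun_eq_iff)
  have der: "((\<lambda>s. f (along p x v s)) has_real_derivative \<phi>' t) (at t)" for t
    unfolding \<phi>'_def g_def by (rule smooth_Rp_along[OF S])
  \<comment> \<open>\<open>s\<close> is a sign: 1 serves the upper bound, -1 the lower bound, which
    is the upper bound for \<open>- f\<close>.\<close>
  have lip: "s * (\<phi>' t - \<phi>' 0) \<le> Lf * (vnorm p v)\<^sup>2 * t" if t: "0 \<le> t" "\<bar>s\<bar> = 1" for t s
  proof -
    have "s * (\<phi>' t - \<phi>' 0) = (\<Sum>l<p. vdiff p (g t) (g 0) l * (s * v l))"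
      unfolding \<phi>'_def sum_subtractf[symmetric] sum_distrib_left
      by (rule sum.cong) (auto simp: vdiff_def algebra_simps)
    also have "\<dots> \<le> vnorm p (vdiff p (g t) (g 0)) * vnorm p (\<lambda>l. s * v l)"
      by (rule inner_le_vnorm)
    also have "vnorm p (\<lambda>l. s * v l) = vnorm p v"
    proof -
      have "s\<^sup>2 = 1" using t(2) by (metis power2_abs power_one)
      then show ?thesis by (simp add: vnorm_def L2_set_def power_mult_distrib)
    qed
    also have "vnorm p (vdiff p (g t) (g 0)) * vnorm p v \<le> (Lf * (\<bar>t - 0\<bar> * vnorm p v)) * vnorm p v"
      unfolding g_def using smooth_Rp_lipschitz[OF S, of "along p x v t" "along p x v 0"]
      by (intro mult_right_mono) (simp_all add: vnorm_along)
    finally show ?thesis using t by (simp add: power2_eq_square mult_ac)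
  qed
  have "\<phi>' 0 = (\<Sum>l<p. grad p f x l * (y l - x l))"
    unfolding \<phi>'_def g_def along01(1) by (rule sum.cong) (auto simp: v_def vdiff_def)
  moreover have "f y - f x - \<phi>' 0 \<le> Lf * (vnorm p v)\<^sup>2 / 2"
    using derivative_lipschitz_upper[of "\<lambda>s. f (along p x v s)", OF der] lip[of _ 1]
    by (simp add: along01)
  moreover have "- f y + f x + \<phi>' 0 \<le> Lf * (vnorm p v)\<^sup>2 / 2"
    using derivative_lipschitz_upper[of "\<lambda>s. - f (along p x v s)", OF DERIV_minus[OF der]] lip[of _ "-1"]
    by (simp add: along01)
  moreover have "Lf * (vnorm p v)\<^sup>2 / 2 = Lf / 2 * (\<Sum>l<p. (y l - x l)\<^sup>2)"
    by (simp add: vnorm_vdiff_sq v_def)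
  ultimately show ?thesis by linarith
qed

lemma smooth_Rp_partial:
  assumes "smooth_Rp p Lf f" "x \<in> Rp p" "j < p"
  shows "\<bar>f (x(j := x j + d)) - f x - grad p f x j * d\<bar> \<le> Lf / 2 * d\<^sup>2"
proof -
  have 1: "(\<Sum>l<p. grad p f x l * ((x(j := x j + d)) l - x l)) = (\<Sum>l<p. if l = j then grad p f x j * d else 0)"
    by (rule sum.cong) auto
  have 2: "(\<Sum>l<p. ((x(j := x j + d)) l - x l)\<^sup>2) = (\<Sum>l<p. if l = j then d\<^sup>2 else 0)"
    by (rule sum.cong) auto
  show ?thesis
    using smooth_Rp_taylor[OF assms(1,2), of "x(j := x j + d)"] assms unfolding 1 2 by simp
qed

lemma smooth_Rp_descent:
  assumes "smooth_Rp p Lf f" "x \<in> Rp p" "y \<in> Rp p"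
  shows "f y \<le> f x + (\<Sum>l<p. grad p f x l * (y l - x l)) + Lf / 2 * (\<Sum>l<p. (y l - x l)\<^sup>2)"
  using smooth_Rp_taylor[OF assms] by linarith

text \<open>A gradient step of length \<open>1 / Lf\<close> lowers \<open>f\<close> by at least the
  squared gradient over \<open>2 * Lf\<close>, and it cannot pass below \<open>m\<close>.\<close>

lemma smooth_Rp_grad_bound:
  assumes "smooth_Rp p Lf f" "x \<in> Rp p" "Lf > 0" "\<And>y. y \<in> Rp p \<Longrightarrow> m \<le> f y"
  shows "(vnorm p (grad p f x))\<^sup>2 \<le> 2 * Lf * (f x - m)"
proof -
  define y where "y = along p x (grad p f x) (- 1 / Lf)"
  have "m \<le> f y" using assms(4) by (simp add: y_def)
  also have "\<dots> \<le> f x + (\<Sum>l<p. grad p f x l * (y l - x l)) + Lf / 2 * (\<Sum>l<p. (y l - x l)\<^sup>2)"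
    by (rule smooth_Rp_descent[OF assms(1,2)]) (simp add: y_def)
  also have "(\<Sum>l<p. grad p f x l * (y l - x l)) = (- 1 / Lf) * (vnorm p (grad p f x))\<^sup>2"
    unfolding vnorm_sq sum_distrib_left by (rule sum.cong) (auto simp: y_def along_def power2_eq_square)
  also have "(\<Sum>l<p. (y l - x l)\<^sup>2) = (1 / Lf)\<^sup>2 * (vnorm p (grad p f x))\<^sup>2"
    unfolding vnorm_sq sum_distrib_left
    by (rule sum.cong) (auto simp: y_def along_def power2_eq_square)
  finally have "m \<le> f x - (vnorm p (grad p f x))\<^sup>2 / (2 * Lf)"
    using assms(3) by (simp add: power2_eq_square field_simps)
  then show ?thesis using assms(3) by (simp add: field_simps)
qed

text \<open>Recognises a candidate gradient \<open>g\<close>: the quadratic remainder makes it the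
  Frechet derivative. The Lipschitz condition is tested against vectors \<open>v\<close> because
  that form is linear in the gradient and so passes through sums and expectations; taking
  \<open>v\<close> to be the gradient difference recovers the norm bound.\<close>

lemma smooth_RpI:
  assumes taylor: "\<And>x y. x \<in> Rp p \<Longrightarrow> y \<in> Rp p \<Longrightarrow>
      \<bar>f y - f x - (\<Sum>l<p. g x l * (y l - x l))\<bar> \<le> K * (\<Sum>l<p. (y l - x l)\<^sup>2)"
    and lip: "\<And>x y v. x \<in> Rp p \<Longrightarrow> y \<in> Rp p \<Longrightarrow>
      (\<Sum>l<p. (g x l - g y l) * v l) \<le> Lf * vnorm p (vdiff p x y) * vnorm p v"
    and "0 \<le> Lf"
  shows "smooth_Rp p Lf f" and "x \<in> Rp p \<Longrightarrow> grad p f x = restrict (g x) {..<p}"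
proof -
  have fg: "frechet_grad p f x (restrict (g x) {..<p})" if x: "x \<in> Rp p" for x
    unfolding frechet_grad_def
  proof (intro allI impI)
    fix e :: real assume e: "e > 0"
    show "\<exists>d>0. \<forall>y\<in>Rp p. vnorm p (vdiff p y x) < d \<longrightarrow>
        \<bar>f y - f x - (\<Sum>j<p. restrict (g x) {..<p} j * (y j - x j))\<bar> \<le> e * vnorm p (vdiff p y x)"
    \<comment> \<open>\<open>K\<close> may be zero or negative, hence the radius with
      \<open>\<bar>K\<bar> + 1\<close>.\<close>
    proof (intro exI[of _ "e / (\<bar>K\<bar> + 1)"] conjI ballI impI)
      show "0 < e / (\<bar>K\<bar> + 1)" using e by (intro divide_pos_pos) auto
      fix y assume y: "y \<in> Rp p" and d: "vnorm p (vdiff p y x) < e / (\<bar>K\<bar> + 1)"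
      let ?N = "vnorm p (vdiff p y x)"
      have "(\<bar>K\<bar> + 1) * ?N \<le> e"
        using d by (simp add: pos_less_divide_eq mult.commute)
      then have "\<bar>K\<bar> * ?N + ?N \<le> e" by (simp add: algebra_simps)
      then have KN: "\<bar>K\<bar> * ?N \<le> e" using vnorm_nonneg[of p "vdiff p y x"] by linarith
      have "\<bar>f y - f x - (\<Sum>j<p. restrict (g x) {..<p} j * (y j - x j))\<bar> \<le> K * ?N\<^sup>2"
        using taylor[OF x y] by (simp add: vnorm_vdiff_sq)
      also have "\<dots> \<le> \<bar>K\<bar> * ?N\<^sup>2" by (intro mult_right_mono) auto
      also have "\<dots> = \<bar>K\<bar> * ?N * ?N" by (simp add: power2_eq_square)
      also have "\<dots> \<le> e * ?N" by (intro mult_right_mono KN) simp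
      finally show "\<bar>f y - f x - (\<Sum>j<p. restrict (g x) {..<p} j * (y j - x j))\<bar> \<le> e * ?N" .
    qed
  qed
  have gr: "grad p f x = restrict (g x) {..<p}" if "x \<in> Rp p" for x
    using frechet_grad_eq[OF fg[OF that] that] by (auto simp: grad_def fun_eq_iff)
  then show "x \<in> Rp p \<Longrightarrow> grad p f x = restrict (g x) {..<p}" by blast
  show "smooth_Rp p Lf f"
    unfolding smooth_Rp_def
  proof (intro conjI ballI)
    fix x assume "x \<in> Rp p"
    from fg[OF this] show "differentiable_Rp p f x"
      unfolding differentiable_Rp_def frechet_grad_def by (intro bexI[of _ "restrict (g x) {..<p}"]) auto
  next
    fix x y assume x: "x \<in> Rp p" and y: "y \<in> Rp p"
    let ?v = "vdiff p (grad p f x) (grad p f y)"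
    have "(vnorm p ?v)\<^sup>2 = (\<Sum>l<p. (g x l - g y l) * ?v l)"
      unfolding vnorm_sq by (rule sum.cong) (auto simp: vdiff_def gr x y power2_eq_square)
    also have "\<dots> \<le> Lf * vnorm p (vdiff p x y) * vnorm p ?v" by (rule lip[OF x y])
    finally have "vnorm p ?v * vnorm p ?v \<le> Lf * vnorm p (vdiff p x y) * vnorm p ?v"
      by (simp add: power2_eq_square)
    then show "vnorm p ?v \<le> Lf * vnorm p (vdiff p x y)"
    proof (cases "vnorm p ?v = 0")
      case True then show ?thesis using \<open>0 \<le> Lf\<close> by (simp add: mult_nonneg_nonneg)
    next
      case False
      then have "vnorm p ?v > 0" using vnorm_nonneg[of p ?v] by linarith
      then show ?thesis using \<open>vnorm p ?v * vnorm p ?v \<le> _\<close> by simp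
    qed
  qed
qed

lemma smooth_Rp_lipschitz_inner:
  assumes "smooth_Rp p Lf f" "x \<in> Rp p" "y \<in> Rp p"
  shows "(\<Sum>l<p. (grad p f x l - grad p f y l) * v l) \<le> Lf * vnorm p (vdiff p x y) * vnorm p v"
proof -
  have "(\<Sum>l<p. (grad p f x l - grad p f y l) * v l) = (\<Sum>l<p. vdiff p (grad p f x) (grad p f y) l * v l)"
    by (rule sum.cong) (auto simp: vdiff_def)
  also have "\<dots> \<le> vnorm p (vdiff p (grad p f x) (grad p f y)) * vnorm p v" by (rule inner_le_vnorm)
  also have "\<dots> \<le> Lf * vnorm p (vdiff p x y) * vnorm p v"
    by (intro mult_right_mono smooth_Rp_lipschitz[OF assms]) simp
  finally show ?thesis .
qed

lemma smooth_Rp_lipschitz_sq: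
  assumes "smooth_Rp p Lf f" "0 \<le> Lf" "x \<in> Rp p" "y \<in> Rp p"
  shows "(\<Sum>l<p. (grad p f x l - grad p f y l)\<^sup>2) \<le> Lf\<^sup>2 * (\<Sum>l<p. (x l - y l)\<^sup>2)"
  using power_mono[OF smooth_Rp_lipschitz[OF assms(1,3,4)], of 2]
  by (simp add: power_mult_distrib vnorm_vdiff_sq)

text \<open>Both hypotheses of \<open>smooth_RpI\<close> are averages of the corresponding
  statements for the summands.\<close>

lemma
  assumes n: "0 < n" and S: "\<And>i. i < n \<Longrightarrow> smooth_Rp p Lf (f i)" and "0 \<le> Lf"
  shows smooth_Rp_average: "smooth_Rp p Lf (\<lambda>x. (\<Sum>i<n. f i x) / real n)"
    and grad_average: "x \<in> Rp p \<Longrightarrow> l < p \<Longrightarrow>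
      grad p (\<lambda>x. (\<Sum>i<n. f i x) / real n) x l = (\<Sum>i<n. grad p (f i) x l) / real n"
proof -
  define g where "g x l = (\<Sum>i<n. grad p (f i) x l) / real n" for x l
  have lin: "(\<Sum>l<p. g x l * v l) = (\<Sum>i<n. \<Sum>l<p. grad p (f i) x l * v l) / real n" for x v
    unfolding g_def sum_divide_distrib[symmetric] times_divide_eq_left sum_distrib_right
    by (subst sum.swap) simp
  have 1: "\<bar>(\<Sum>i<n. f i y) / real n - (\<Sum>i<n. f i x) / real n - (\<Sum>l<p. g x l * (y l - x l))\<bar>
      \<le> Lf / 2 * (\<Sum>l<p. (y l - x l)\<^sup>2)" if "x \<in> Rp p" "y \<in> Rp p" for x y
  proof -
    have "\<bar>(\<Sum>i<n. f i y) / real n - (\<Sum>i<n. f i x) / real n - (\<Sum>l<p. g x l * (y l - x l))\<bar>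
      = \<bar>\<Sum>i<n. f i y - f i x - (\<Sum>l<p. grad p (f i) x l * (y l - x l))\<bar> / real n"
      unfolding lin sum_subtractf by (simp flip: diff_divide_distrib)
    also have "\<dots> \<le> (\<Sum>i<n. Lf / 2 * (\<Sum>l<p. (y l - x l)\<^sup>2)) / real n"
      by (intro divide_right_mono order.trans[OF sum_abs] sum_mono smooth_Rp_taylor S that) auto
    also have "\<dots> = Lf / 2 * (\<Sum>l<p. (y l - x l)\<^sup>2)" using n by simp
    finally show ?thesis .
  qed
  have 2: "(\<Sum>l<p. (g x l - g y l) * v l) \<le> Lf * vnorm p (vdiff p x y) * vnorm p v"
    if "x \<in> Rp p" "y \<in> Rp p" for x y v
  proof -
    have "(\<Sum>l<p. (g x l - g y l) * v l) = (\<Sum>i<n. \<Sum>l<p. (grad p (f i) x l - grad p (f i) y l) * v l) / real n"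
      unfolding left_diff_distrib sum_subtractf lin by (simp add: diff_divide_distrib)
    also have "\<dots> \<le> (\<Sum>i<n. Lf * vnorm p (vdiff p x y) * vnorm p v) / real n"
      by (intro divide_right_mono sum_mono smooth_Rp_lipschitz_inner S that) auto
    also have "\<dots> = Lf * vnorm p (vdiff p x y) * vnorm p v" using n by simp
    finally show ?thesis .
  qed
  show "smooth_Rp p Lf (\<lambda>x. (\<Sum>i<n. f i x) / real n)"
    by (rule smooth_RpI(1)[OF 1 2 assms(3)])
  show "x \<in> Rp p \<Longrightarrow> l < p \<Longrightarrow>
      grad p (\<lambda>x. (\<Sum>i<n. f i x) / real n) x l = (\<Sum>i<n. grad p (f i) x l) / real n"
    using smooth_RpI(2)[OF 1 2 assms(3)] by (simp add: g_def)
qed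

text \<open>A countable sequence of steps suffices to recover a partial derivative; this makes
  gradients measurable as pointwise limits.\<close>

lemma smooth_Rp_diff_quotient_LIMSEQ:
  assumes "smooth_Rp p Lf f" "x \<in> Rp p" "j < p"
  shows "(\<lambda>m. (f (x(j := x j + 1 / real (Suc m))) - f x) * real (Suc m)) \<longlonglongrightarrow> grad p f x j"
proof (rule LIM_zero_cancel, rule Lim_null_comparison)
  show "\<forall>\<^sub>F m in sequentially. norm ((f (x(j := x j + 1 / real (Suc m))) - f x) * real (Suc m) - grad p f x j)
      \<le> Lf / 2 * (1 / real (Suc m))"
  proof (intro always_eventually allI)
    fix m
    let ?d = "1 / real (Suc m)"
    have "norm ((f (x(j := x j + ?d)) - f x) * real (Suc m) - grad p f x j)
       = \<bar>f (x(j := x j + ?d)) - f x - grad p f x j * ?d\<bar> * real (Suc m)"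
      by (simp add: field_simps abs_mult[symmetric] del: of_nat_Suc)
    also have "\<dots> \<le> Lf / 2 * ?d\<^sup>2 * real (Suc m)"
      by (intro mult_right_mono smooth_Rp_partial[OF assms]) auto
    also have "\<dots> = Lf / 2 * ?d" by (simp add: power2_eq_square del: of_nat_Suc)
    finally show "norm ((f (x(j := x j + ?d)) - f x) * real (Suc m) - grad p f x j) \<le> Lf / 2 * ?d" .
  qed
  have "(\<lambda>m. Lf / 2 * (1 / real (Suc m))) \<longlonglongrightarrow> Lf / 2 * 0"
    by (intro tendsto_intros LIMSEQ_Suc[OF lim_1_over_n])
  then show "(\<lambda>m. Lf / 2 * (1 / real (Suc m))) \<longlonglongrightarrow> 0" by simp
qed

section \<open>Measurability of gradients and the random choice of coordinates\<close>

lemma measurable_coord_shift: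
  "j < p \<Longrightarrow> (\<lambda>x. x(j := x j + c)) \<in> eucl p \<rightarrow>\<^sub>M eucl p"
  by (rule measurable_fun_upd[where J = "{..<p}"]) (auto intro!: measurable_component_singleton borel_measurable_add)

lemma smooth_Rp_grad_measurable:
  assumes S: "smooth_Rp p Lf f" and f: "f \<in> borel_measurable (eucl p)" and j: "j < p"
  shows "(\<lambda>x. grad p f x j) \<in> borel_measurable (eucl p)"
proof (rule borel_measurable_LIMSEQ_real)
  show "(\<lambda>m. (f (x(j := x j + 1 / real (Suc m))) - f x) * real (Suc m)) \<longlonglongrightarrow> grad p f x j"
    if "x \<in> space (eucl p)" for x
    using smooth_Rp_diff_quotient_LIMSEQ[OF S _ j] that by (simp add: Rp_def)
  show "(\<lambda>x. (f (x(j := x j + 1 / real (Suc m))) - f x) * real (Suc m)) \<in> borel_measurable (eucl p)" for m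
    by (intro borel_measurable_times borel_measurable_diff f borel_measurable_const
        measurable_compose[OF measurable_coord_shift[OF j] f])
qed

text \<open>Deleting \<open>l\<close> matches the subsets of size \<open>nc\<close> that contain
  \<open>l\<close> with the subsets of size \<open>nc - 1\<close> of the other coordinates, and
  absorption of binomial coefficients gives the ratio. This probability is what the factor
  \<open>p / nc\<close> of the estimator cancels.\<close>

lemma subset_measure_member:
  assumes "1 \<le> nc" "nc \<le> p" "l < p"
  shows "prob_space (subset_measure p nc)"
    and "integrable (subset_measure p nc) (\<lambda>s. of_bool (l \<in> s) :: real)"
    and "(\<integral>s. of_bool (l \<in> s) \<partial>subset_measure p nc) = real nc / real p"
proof -
  define A where "A = {A. A \<subseteq> {..<p} \<and> card A = nc}"
  have fin: "finite A" by (rule finite_subset[of _ "Pow {..<p}"]) (auto simp: A_def)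
  have cA: "card A = p choose nc" unfolding A_def using n_subsets[of "{..<p}" nc] by simp
  then have ne: "A \<noteq> {}" using assms by (metis card.empty binomial_eq_0_iff not_less)
  have U: "subset_measure p nc = uniform_count_measure A" by (simp add: subset_measure_def A_def)
  show P: "prob_space (subset_measure p nc)" unfolding U by (rule prob_space_uniform_count_measure[OF fin ne])
  then interpret prob_space "subset_measure p nc" .
  have sets: "{s \<in> A. l \<in> s} \<in> sets (subset_measure p nc)" by (auto simp: U sets_uniform_count_measure)
  have eq: "(of_bool (l \<in> s) :: real) = indicator {s \<in> A. l \<in> s} s" if "s \<in> space (subset_measure p nc)" for s
    using that by (auto simp: U space_uniform_count_measure)
  show "integrable (subset_measure p nc) (\<lambda>s. of_bool (l \<in> s) :: real)"
    by (subst Bochner_Integration.integrable_cong[OF refl eq])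
       (auto intro!: integrable_real_indicator sets simp: less_top[symmetric])
  have "bij_betw (insert l) {B. B \<subseteq> {..<p} - {l} \<and> card B = nc - 1} {s \<in> A. l \<in> s}"
  proof (rule bij_betwI[where g = "\<lambda>s. s - {l}"])
    show "insert l \<in> {B. B \<subseteq> {..<p} - {l} \<and> card B = nc - 1} \<rightarrow> {s \<in> A. l \<in> s}"
    proof (rule Pi_I)
      fix B assume "B \<in> {B. B \<subseteq> {..<p} - {l} \<and> card B = nc - 1}"
      then have B: "B \<subseteq> {..<p} - {l}" "card B = nc - 1" by auto
      then have "finite B" "l \<notin> B" by (auto intro: finite_subset)
      then show "insert l B \<in> {s \<in> A. l \<in> s}" using B assms by (auto simp: A_def)
    qed
    show "(\<lambda>s. s - {l}) \<in> {s \<in> A. l \<in> s} \<rightarrow> {B. B \<subseteq> {..<p} - {l} \<and> card B = nc - 1}"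
      by (auto simp: A_def)
  qed (use assms in auto)
  then have "card {s \<in> A. l \<in> s} = card {B. B \<subseteq> {..<p} - {l} \<and> card B = nc - 1}"
    by (rule bij_betw_same_card[symmetric])
  also have "\<dots> = card ({..<p} - {l}) choose (nc - 1)" by (rule n_subsets) simp
  finally have c: "card {s \<in> A. l \<in> s} = (p - 1) choose (nc - 1)" using assms by simp
  have "nc * card A = p * card {s \<in> A. l \<in> s}"
    unfolding c cA using times_binomial_minus1_eq[of nc p] assms by simp
  then have ratio: "real (card {s \<in> A. l \<in> s}) / real (card A) = real nc / real p"
    using assms ne fin by (simp add: field_simps flip: of_nat_mult)
  have "(\<integral>s. (of_bool (l \<in> s) :: real) \<partial>subset_measure p nc) = (\<integral>s. indicator {s \<in> A. l \<in> s} s \<partial>subset_measure p nc)"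
    by (rule Bochner_Integration.integral_cong[OF refl eq])
  also have "\<dots> = measure (subset_measure p nc) {s \<in> A. l \<in> s}"
    using sets sets.sets_into_space[OF sets] by (simp add: Int_absorb2)
  also have "\<dots> = real nc / real p"
    unfolding U by (subst measure_uniform_count_measure[OF fin]) (auto simp: ratio)
  finally show "(\<integral>s. of_bool (l \<in> s) \<partial>subset_measure p nc) = real nc / real p" .
qed

text \<open>The sample and the coordinate subset are independent, so the difference quotient and the
  membership indicator can be integrated separately.\<close>

lemma
  fixes f :: "'a \<Rightarrow> real" and g :: "'b \<Rightarrow> real"
  assumes "prob_space M" "prob_space N" and f: "integrable M f" and g: "integrable N g"
  shows integrable_pair_times: "integrable (M \<Otimes>\<^sub>M N) (\<lambda>w. f (fst w) * g (snd w))"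
    and integral_pair_times: "(\<integral>w. f (fst w) * g (snd w) \<partial>(M \<Otimes>\<^sub>M N)) = (\<integral>x. f x \<partial>M) * (\<integral>y. g y \<partial>N)"
proof -
  interpret M: prob_space M by fact
  interpret N: prob_space N by fact
  interpret pair_sigma_finite M N ..
  have [measurable]: "f \<in> borel_measurable M" "g \<in> borel_measurable N" using f g by auto
  show I: "integrable (M \<Otimes>\<^sub>M N) (\<lambda>w. f (fst w) * g (snd w))"
  proof (rule Fubini_integrable)
    show "integrable M (\<lambda>x. \<integral>y. norm (f (fst (x, y)) * g (snd (x, y))) \<partial>N)"
      using f by (simp add: abs_mult)
    show "AE x in M. integrable N (\<lambda>y. f (fst (x, y)) * g (snd (x, y)))"
      using g by simp
  qed measurable
  show "(\<integral>w. f (fst w) * g (snd w) \<partial>(M \<Otimes>\<^sub>M N)) = (\<integral>x. f x \<partial>M) * (\<integral>y. g y \<partial>N)"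
    using integral_fst'[OF I] by simp
qed

section \<open>Moments of the gradient estimators\<close>

text \<open>The part of the estimator that depends on the loss, detached from scaling and coordinate
  choice, so that both options share all later estimates.\<close>

fun diff_quotient :: "estimator \<Rightarrow> ((nat \<Rightarrow> real) \<Rightarrow> real) \<Rightarrow> real \<Rightarrow> (nat \<Rightarrow> real) \<Rightarrow> nat \<Rightarrow> real" where
  "diff_quotient Forward_Difference h d x j = (h (x(j := x j + d)) - h x) / d"
| "diff_quotient Central_Difference h d x j = (h (x(j := x j + d)) - h (x(j := x j - d))) / (2 * d)"

lemma grad_est_eq:
  assumes "finite S" "l < p"
  shows "grad_est opt p nc h d S x l = real p / real nc * (diff_quotient opt h d x l * of_bool (l \<in> S))"
proof -
  have *: "(\<Sum>j\<in>S. c j * of_bool (l = j)) = c l * of_bool (l \<in> S)" for c :: "nat \<Rightarrow> real"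
  proof -
    have "(\<Sum>j\<in>S. c j * of_bool (l = j)) = (\<Sum>j\<in>S. if l = j then c j else 0)"
      by (rule sum.cong) auto
    also have "\<dots> = c l * of_bool (l \<in> S)" using assms(1) by simp
    finally show ?thesis .
  qed
  show ?thesis
    by (cases opt) (simp_all only: grad_est.simps diff_quotient.simps * restrict_apply lessThan_iff assms(2) if_True)
qed

text \<open>The central quotient is the mean of a forward and a backward quotient, so under a mere
  Lipschitz gradient both options have the same error bound.\<close>

lemma diff_quotient_error:
  assumes S: "smooth_Rp p Lf f" and x: "x \<in> Rp p" and j: "j < p" and d: "0 < d"
  shows "\<bar>diff_quotient opt f d x j - grad p f x j\<bar> \<le> Lf / 2 * d"
proof -
  let ?g = "grad p f x j"
  have 1: "\<bar>f (x(j := x j + d)) - f x - ?g * d\<bar> \<le> Lf / 2 * d\<^sup>2"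
    by (rule smooth_Rp_partial[OF S x j])
  have 2: "\<bar>f (x(j := x j - d)) - f x + ?g * d\<bar> \<le> Lf / 2 * d\<^sup>2"
    using smooth_Rp_partial[OF S x j, of "- d"] by simp
  show ?thesis
  proof (cases opt)
    case Forward_Difference
    have "diff_quotient opt f d x j - ?g = (f (x(j := x j + d)) - f x - ?g * d) / d"
      using d unfolding Forward_Difference by (simp add: field_simps)
    then have "\<bar>diff_quotient opt f d x j - ?g\<bar> = \<bar>f (x(j := x j + d)) - f x - ?g * d\<bar> / d"
      using d by simp
    also have "\<dots> \<le> Lf / 2 * d\<^sup>2 / d" using 1 d by (intro divide_right_mono) auto
    finally show ?thesis using d by (simp add: power2_eq_square)
  next
    case Central_Difference
    let ?u = "f (x(j := x j + d)) - f (x(j := x j - d)) - 2 * (?g * d)"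
    have "diff_quotient opt f d x j - ?g = ?u / (2 * d)"
      using d unfolding Central_Difference by (simp add: field_simps)
    then have "\<bar>diff_quotient opt f d x j - ?g\<bar> = \<bar>?u\<bar> / (2 * d)"
      using d by simp
    also have "\<dots> \<le> (2 * (Lf / 2 * d\<^sup>2)) / (2 * d)" using 1 2 d by (intro divide_right_mono) linarith+
    finally show ?thesis using d by (simp add: power2_eq_square)
  qed
qed

section \<open>Expectation of a random smooth loss\<close>

locale stochastic_loss = prob_space D for D :: "'z measure" +
  fixes p :: nat and Lf :: real and h :: "(nat \<Rightarrow> real) \<Rightarrow> 'z \<Rightarrow> real"
  assumes joint_measurable: "(\<lambda>(x, z). h x z) \<in> borel_measurable (eucl p \<Otimes>\<^sub>M D)"
    and h_integrable: "x \<in> Rp p \<Longrightarrow> integrable D (h x)"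
    and h_smooth: "AE z in D. smooth_Rp p Lf (\<lambda>x. h x z)"
    and Lf_nonneg: "0 \<le> Lf"
begin

definition mean_loss :: "(nat \<Rightarrow> real) \<Rightarrow> real" where
  "mean_loss x = (\<integral>z. h x z \<partial>D)"

text \<open>Outside the null set where \<open>h\<close> is not smooth the gradient need not be measurable in the
  sample, so we integrate this almost surely equal version instead.\<close>

definition sample_grad :: "(nat \<Rightarrow> real) \<Rightarrow> nat \<Rightarrow> 'z \<Rightarrow> real" where
  "sample_grad x j z = lim (\<lambda>m. (h (x(j := x j + 1 / real (Suc m))) z - h x z) * real (Suc m))"

lemma sample_grad_measurable [measurable]:
  "x \<in> Rp p \<Longrightarrow> j < p \<Longrightarrow> sample_grad x j \<in> borel_measurable D"
  unfolding sample_grad_def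
  by (intro borel_measurable_lim_metric borel_measurable_times borel_measurable_diff
      borel_measurable_integrable h_integrable borel_measurable_const) auto

text \<open>The exceptional null set depends on neither \<open>x\<close> nor \<open>j\<close>.
  Gradients at two points can therefore be compared inside one expectation.\<close>

lemma AE_sample_grad:
  "AE z in D. smooth_Rp p Lf (\<lambda>x. h x z) \<and> (\<forall>x\<in>Rp p. \<forall>j<p. sample_grad x j z = grad p (\<lambda>x. h x z) x j)"
  using h_smooth
proof eventually_elim
  case (elim z)
  then show ?case unfolding sample_grad_def
    by (auto simp del: of_nat_Suc intro!: limI smooth_Rp_diff_quotient_LIMSEQ[where f = "\<lambda>x. h x z"])
qed

text \<open>Smoothness with step 1 bounds the partial derivative by a difference of two integrable
  losses plus \<open>Lf / 2\<close>.\<close>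

lemma sample_grad_integrable:
  assumes x: "x \<in> Rp p" and j: "j < p"
  shows "integrable D (sample_grad x j)"
proof (rule Bochner_Integration.integrable_bound)
  show "integrable D (\<lambda>z. \<bar>h (x(j := x j + 1)) z - h x z\<bar> + Lf / 2)"
    using x j by (simp add: h_integrable)
  show "sample_grad x j \<in> borel_measurable D" using x j by measurable
  show "AE z in D. norm (sample_grad x j z) \<le> norm (\<bar>h (x(j := x j + 1)) z - h x z\<bar> + Lf / 2)"
    using AE_sample_grad
  proof eventually_elim
    case (elim z)
    then have "\<bar>h (x(j := x j + 1)) z - h x z - sample_grad x j z\<bar> \<le> Lf / 2"
      using smooth_Rp_partial[of p Lf "\<lambda>x. h x z" x j 1] x j by simp
    then show ?case unfolding real_norm_def by linarith
  qed
qed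

text \<open>The expected sample gradient is the candidate offered to \<open>smooth_RpI\<close>; its
  remainder is the mean of the sample remainders.\<close>

lemma mean_loss_taylor:
  assumes x: "x \<in> Rp p" and y: "y \<in> Rp p"
  shows "\<bar>mean_loss y - mean_loss x - (\<Sum>l<p. expectation (sample_grad x l) * (y l - x l))\<bar>
    \<le> Lf / 2 * (\<Sum>l<p. (y l - x l)\<^sup>2)"
proof -
  let ?r = "\<lambda>z. h y z - h x z - (\<Sum>l<p. sample_grad x l z * (y l - x l))"
  have int: "integrable D ?r"
    by (intro Bochner_Integration.integrable_diff Bochner_Integration.integrable_sum integrable_mult_left
        h_integrable sample_grad_integrable x y) auto
  have "integrable D (\<lambda>z. \<Sum>l<p. sample_grad x l z * (y l - x l))"
    by (intro Bochner_Integration.integrable_sum integrable_mult_left sample_grad_integrable x) auto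
  then have "mean_loss y - mean_loss x - (\<Sum>l<p. expectation (sample_grad x l) * (y l - x l)) = expectation ?r"
    using x y by (simp add: mean_loss_def h_integrable sample_grad_integrable)
  also have "\<bar>\<dots>\<bar> \<le> expectation (\<lambda>z. \<bar>?r z\<bar>)" by (rule integral_abs_bound)
  also have "\<dots> \<le> expectation (\<lambda>z. Lf / 2 * (\<Sum>l<p. (y l - x l)\<^sup>2))"
  proof (rule integral_mono_AE)
    show "AE z in D. \<bar>?r z\<bar> \<le> Lf / 2 * (\<Sum>l<p. (y l - x l)\<^sup>2)"
      using AE_sample_grad
    proof eventually_elim
      case (elim z)
      then show ?case using smooth_Rp_taylor[of p Lf "\<lambda>x. h x z" x y] x y by simp
    qed
  qed (use int in auto)
  finally show ?thesis by (simp add: prob_space)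
qed

lemma mean_grad_lipschitz_inner:
  assumes x: "x \<in> Rp p" and y: "y \<in> Rp p"
  shows "(\<Sum>l<p. (expectation (sample_grad x l) - expectation (sample_grad y l)) * v l)
    \<le> Lf * vnorm p (vdiff p x y) * vnorm p v"
proof -
  have "(\<Sum>l<p. (expectation (sample_grad x l) - expectation (sample_grad y l)) * v l)
      = expectation (\<lambda>z. \<Sum>l<p. (sample_grad x l z - sample_grad y l z) * v l)"
    using x y by (simp add: sample_grad_integrable)
  also have "\<dots> \<le> expectation (\<lambda>z. Lf * vnorm p (vdiff p x y) * vnorm p v)"
  proof (rule integral_mono_AE)
    show "integrable D (\<lambda>z. \<Sum>l<p. (sample_grad x l z - sample_grad y l z) * v l)"
      by (intro Bochner_Integration.integrable_diff Bochner_Integration.integrable_sum integrable_mult_left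
          sample_grad_integrable x y) auto
    show "AE z in D. (\<Sum>l<p. (sample_grad x l z - sample_grad y l z) * v l) \<le> Lf * vnorm p (vdiff p x y) * vnorm p v"
      using AE_sample_grad
    proof eventually_elim
      case (elim z)
      then show ?case using smooth_Rp_lipschitz_inner[of p Lf "\<lambda>x. h x z" x y v] x y by simp
    qed
  qed simp
  finally show ?thesis by (simp add: prob_space)
qed

lemma mean_loss_smooth: "smooth_Rp p Lf mean_loss"
  by (rule smooth_RpI(1)[OF mean_loss_taylor mean_grad_lipschitz_inner Lf_nonneg])

lemma grad_mean_loss: "x \<in> Rp p \<Longrightarrow> j < p \<Longrightarrow> grad p mean_loss x j = expectation (sample_grad x j)"
  using smooth_RpI(2)[OF mean_loss_taylor mean_grad_lipschitz_inner Lf_nonneg] by simp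

lemma mean_loss_measurable: "mean_loss \<in> borel_measurable (eucl p)"
  unfolding mean_loss_def using joint_measurable by (rule borel_measurable_lebesgue_integral)

context
  fixes \<zeta> d :: real and x :: "nat \<Rightarrow> real" and j :: nat and opt :: estimator
  assumes x: "x \<in> Rp p" and j: "j < p" and d: "0 < d"
    and noise_integrable: "integrable D (\<lambda>z. (grad p (\<lambda>y. h y z) x j - grad p mean_loss x j)\<^sup>2)"
    and noise_bound: "(\<integral>z. (grad p (\<lambda>y. h y z) x j - grad p mean_loss x j)\<^sup>2 \<partial>D) \<le> \<zeta>\<^sup>2"
begin

abbreviation (input) "dq z \<equiv> diff_quotient opt (\<lambda>y. h y z) d x j"

lemma diff_quotient_integrable: "integrable D (\<lambda>z. dq z)"
  using x j by (cases opt) (simp_all add: h_integrable)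

lemma diff_quotient_bias: "\<bar>expectation (\<lambda>z. dq z) - grad p mean_loss x j\<bar> \<le> Lf / 2 * d"
proof -
  have "expectation (\<lambda>z. dq z) - grad p mean_loss x j = expectation (\<lambda>z. dq z - sample_grad x j z)"
    using x j by (simp add: grad_mean_loss sample_grad_integrable diff_quotient_integrable)
  also have "\<bar>\<dots>\<bar> \<le> expectation (\<lambda>z. \<bar>dq z - sample_grad x j z\<bar>)" by (rule integral_abs_bound)
  also have "\<dots> \<le> expectation (\<lambda>z. Lf / 2 * d)"
  proof (rule integral_mono_AE)
    show "AE z in D. \<bar>dq z - sample_grad x j z\<bar> \<le> Lf / 2 * d"
      using AE_sample_grad
    proof eventually_elim
      case (elim z)
      then show ?case using diff_quotient_error[of p Lf "\<lambda>x. h x z" x j d opt] x j d by simp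
    qed
  qed (use x j in \<open>simp_all add: sample_grad_integrable diff_quotient_integrable\<close>)
  finally show ?thesis by (simp add: prob_space)
qed

text \<open>The quotient is mean gradient plus sampling noise plus finite-difference bias; squaring
  three summands costs a factor 3.\<close>

lemma AE_diff_quotient_sq:
  "AE z in D. (dq z)\<^sup>2 \<le> 3 * (grad p mean_loss x j)\<^sup>2
     + 3 * (grad p (\<lambda>y. h y z) x j - grad p mean_loss x j)\<^sup>2 + Lf\<^sup>2 * d\<^sup>2"
  using h_smooth
proof eventually_elim
  case (elim z)
  define a b where "a = grad p mean_loss x j" and "b = grad p (\<lambda>y. h y z) x j - a"
  define c where "c = dq z - grad p (\<lambda>y. h y z) x j"
  have "\<bar>c\<bar> \<le> Lf / 2 * d"
    unfolding c_def by (rule diff_quotient_error[OF elim x j d])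
  then have "\<bar>c\<bar>\<^sup>2 \<le> (Lf / 2 * d)\<^sup>2" by (intro power_mono) auto
  \<comment> \<open>Three quarters of \<open>Lf\<^sup>2 * d\<^sup>2\<close> would bound
    \<open>3 * c\<^sup>2\<close>; the final estimate is rounded up.\<close>
  then have c: "4 * c\<^sup>2 \<le> Lf\<^sup>2 * d\<^sup>2" by (simp add: power_mult_distrib power_divide)
  have "(a + b + c)\<^sup>2 \<le> 3 * a\<^sup>2 + 3 * b\<^sup>2 + 3 * c\<^sup>2"
    using sum_squares_ge_zero[of "a - b" "b - c"] zero_le_square[of "a - c"]
    by (simp add: power2_eq_square algebra_simps)
  moreover have "0 \<le> c\<^sup>2" by simp
  moreover have "dq z = a + b + c" by (simp add: b_def c_def)
  then have "(dq z)\<^sup>2 = (a + b + c)\<^sup>2" by simp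
  ultimately show ?case unfolding a_def[symmetric] b_def[symmetric] using c by linarith
qed

lemma diff_quotient_sq_integrable: "integrable D (\<lambda>z. (dq z)\<^sup>2)"
proof (rule Bochner_Integration.integrable_bound)
  show "integrable D (\<lambda>z. 3 * (grad p mean_loss x j)\<^sup>2
     + 3 * (grad p (\<lambda>y. h y z) x j - grad p mean_loss x j)\<^sup>2 + Lf\<^sup>2 * d\<^sup>2)"
    using noise_integrable by auto
  show "(\<lambda>z. (dq z)\<^sup>2) \<in> borel_measurable D"
    by (intro borel_measurable_power borel_measurable_integrable diff_quotient_integrable)
  show "AE z in D. norm ((dq z)\<^sup>2) \<le> norm (3 * (grad p mean_loss x j)\<^sup>2
     + 3 * (grad p (\<lambda>y. h y z) x j - grad p mean_loss x j)\<^sup>2 + Lf\<^sup>2 * d\<^sup>2)"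
    using AE_diff_quotient_sq by eventually_elim simp
qed

lemma diff_quotient_sq_bound:
  "expectation (\<lambda>z. (dq z)\<^sup>2) \<le> 3 * (grad p mean_loss x j)\<^sup>2 + 3 * \<zeta>\<^sup>2 + Lf\<^sup>2 * d\<^sup>2"
proof -
  have "expectation (\<lambda>z. (dq z)\<^sup>2) \<le> expectation (\<lambda>z. 3 * (grad p mean_loss x j)\<^sup>2
     + 3 * (grad p (\<lambda>y. h y z) x j - grad p mean_loss x j)\<^sup>2 + Lf\<^sup>2 * d\<^sup>2)"
    by (rule integral_mono_AE[OF diff_quotient_sq_integrable _ AE_diff_quotient_sq])
       (use noise_integrable in auto)
  also have "\<dots> = 3 * (grad p mean_loss x j)\<^sup>2
     + 3 * expectation (\<lambda>z. (grad p (\<lambda>y. h y z) x j - grad p mean_loss x j)\<^sup>2) + Lf\<^sup>2 * d\<^sup>2"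
    using noise_integrable by (simp add: prob_space)
  finally show ?thesis using noise_bound by simp
qed

text \<open>An indicator equals its square. The mean therefore gains \<open>p / nc\<close> times
  \<open>nc / p\<close>, that is 1, while the second moment gains \<open>(p / nc)\<^sup>2\<close>
  times \<open>nc / p\<close>, that is \<open>p / nc\<close>.\<close>

lemma grad_est_moments:
  assumes nc: "1 \<le> nc" "nc \<le> p"
  defines "P \<equiv> D \<Otimes>\<^sub>M subset_measure p nc"
    and "Y \<equiv> (\<lambda>w. grad_est opt p nc (\<lambda>y. h y (fst w)) d (snd w) x j)"
  shows "integrable P Y" and "integrable P (\<lambda>w. (Y w)\<^sup>2)"
    and "\<bar>(\<integral>w. Y w \<partial>P) - grad p mean_loss x j\<bar> \<le> Lf / 2 * d"
    and "(\<integral>w. (Y w)\<^sup>2 \<partial>P) \<le> real p / real nc * (3 * (grad p mean_loss x j)\<^sup>2 + 3 * \<zeta>\<^sup>2 + Lf\<^sup>2 * d\<^sup>2)"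
proof -
  note U = subset_measure_member[OF nc j]
  have fin: "finite (snd w)" if "w \<in> space P" for w
  proof -
    have "snd w \<subseteq> {..<p}"
      using that by (auto simp: P_def space_pair_measure subset_measure_def space_uniform_count_measure)
    then show ?thesis by (rule finite_subset) simp
  qed
  have Y1: "Y w = real p / real nc * (dq (fst w) * of_bool (j \<in> snd w))" if "w \<in> space P" for w
    unfolding Y_def by (rule grad_est_eq[OF fin[OF that] j])
  have Y2: "(Y w)\<^sup>2 = (real p / real nc)\<^sup>2 * ((dq (fst w))\<^sup>2 * of_bool (j \<in> snd w))" if "w \<in> space P" for w
    using Y1[OF that] by (simp add: power_mult_distrib power_divide)
  note pt = integrable_pair_times[OF prob_space_axioms U(1) _ U(2), folded P_def]
    integral_pair_times[OF prob_space_axioms U(1) _ U(2), folded P_def]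
  show "integrable P Y"
    by (subst Bochner_Integration.integrable_cong[OF refl Y1])
       (auto intro!: pt(1) diff_quotient_integrable)
  show "integrable P (\<lambda>w. (Y w)\<^sup>2)"
    by (subst Bochner_Integration.integrable_cong[OF refl Y2])
       (auto intro!: pt(1)[of "\<lambda>z. (dq z)\<^sup>2"] diff_quotient_sq_integrable)
  have "(\<integral>w. Y w \<partial>P) = expectation (\<lambda>z. dq z)"
    using nc pt(2)[OF diff_quotient_integrable] U(3)
    by (subst Bochner_Integration.integral_cong[OF refl Y1]) simp_all
  then show "\<bar>(\<integral>w. Y w \<partial>P) - grad p mean_loss x j\<bar> \<le> Lf / 2 * d"
    using diff_quotient_bias by simp
  have "(\<integral>w. (Y w)\<^sup>2 \<partial>P) = real p / real nc * expectation (\<lambda>z. (dq z)\<^sup>2)"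
    using nc pt(2)[OF diff_quotient_sq_integrable] U(3)
    by (subst Bochner_Integration.integral_cong[OF refl Y2]) (simp_all add: power2_eq_square)
  then show "(\<integral>w. (Y w)\<^sup>2 \<partial>P) \<le> real p / real nc * (3 * (grad p mean_loss x j)\<^sup>2 + 3 * \<zeta>\<^sup>2 + Lf\<^sup>2 * d\<^sup>2)"
    using mult_left_mono[OF diff_quotient_sq_bound, of "real p / real nc"] by simp
qed

end

end

section \<open>The Laplacian on vectors of sum zero\<close>

text \<open>Vectors indexed by agents are plain functions read only below \<open>n\<close>; one
  coordinate slice of the iterates is then such a vector as it stands.\<close>

definition ip :: "nat \<Rightarrow> (nat \<Rightarrow> real) \<Rightarrow> (nat \<Rightarrow> real) \<Rightarrow> real" where
  "ip n x y = (\<Sum>i<n. x i * y i)"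

definition mv :: "nat \<Rightarrow> (nat \<Rightarrow> nat \<Rightarrow> real) \<Rightarrow> (nat \<Rightarrow> real) \<Rightarrow> nat \<Rightarrow> real" where
  "mv n A x i = (\<Sum>j<n. A i j * x j)"

lemma ip_commute: "ip n x y = ip n y x"
  by (simp add: ip_def mult.commute)

lemma ip_add: "ip n (\<lambda>i. x i + y i) z = ip n x z + ip n y z"
  "ip n z (\<lambda>i. x i + y i) = ip n z x + ip n z y"
  by (simp_all add: ip_def distrib_left distrib_right sum.distrib)

lemma ip_diff: "ip n (\<lambda>i. x i - y i) z = ip n x z - ip n y z"
  "ip n z (\<lambda>i. x i - y i) = ip n z x - ip n z y"
  by (simp_all add: ip_def left_diff_distrib right_diff_distrib sum_subtractf)

lemma ip_scale: "ip n (\<lambda>i. c * x i) z = c * ip n x z" "ip n z (\<lambda>i. c * x i) = c * ip n z x"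
  by (simp_all add: ip_def sum_distrib_left mult.assoc mult.left_commute)

lemma mv_add: "mv n A (\<lambda>i. x i + y i) = (\<lambda>i. mv n A x i + mv n A y i)"
  by (simp add: mv_def distrib_left sum.distrib fun_eq_iff)

lemma mv_scale: "mv n A (\<lambda>i. c * x i) = (\<lambda>i. c * mv n A x i)"
  by (simp add: mv_def sum_distrib_left mult.left_commute fun_eq_iff)

lemma ip_mv_commute:
  assumes "\<And>i j. i < n \<Longrightarrow> j < n \<Longrightarrow> A i j = A j i"
  shows "ip n x (mv n A y) = ip n (mv n A x) y"
proof -
  have "ip n x (mv n A y) = (\<Sum>i<n. \<Sum>j<n. x i * (A i j * y j))"
    by (simp add: ip_def mv_def sum_distrib_left)
  also have "\<dots> = (\<Sum>j<n. \<Sum>i<n. x i * (A i j * y j))"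
    by (rule sum.swap)
  also have "\<dots> = (\<Sum>j<n. \<Sum>i<n. A j i * x i * y j)"
    by (intro sum.cong refl) (simp add: assms)
  finally show ?thesis by (simp add: ip_def mv_def sum_distrib_right)
qed

lemma ip_self_nonneg: "0 \<le> ip n x x"
  by (simp add: ip_def sum_nonneg)

lemma ip_cong: "(\<And>i. i < n \<Longrightarrow> x i = x' i) \<Longrightarrow> (\<And>i. i < n \<Longrightarrow> y i = y' i) \<Longrightarrow> ip n x y = ip n x' y'"
  by (simp add: ip_def)

lemma mv_cong: "(\<And>i. i < n \<Longrightarrow> x i = x' i) \<Longrightarrow> mv n A x = mv n A x'"
  by (simp add: mv_def fun_eq_iff)

text \<open>Pinning the entries at and beyond \<open>n\<close> to 0 makes the set compact in the
  product topology on all functions.\<close>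

definition sphere_perp :: "nat \<Rightarrow> (nat \<Rightarrow> real) \<Rightarrow> (nat \<Rightarrow> real) set" where
  "sphere_perp n e = {x. (\<forall>i\<ge>n. x i = 0) \<and> ip n x x = 1 \<and> ip n x e = 0}"

lemma continuous_on_ip [continuous_intros]:
  "continuous_on UNIV f \<Longrightarrow> continuous_on UNIV g \<Longrightarrow> continuous_on UNIV (\<lambda>x. ip n (f x) (g x))"
  unfolding ip_def by (intro continuous_intros) (auto intro: continuous_on_product_then_coordinatewise)

text \<open>A closed subset of a product of compact sets, hence compact by Tychonoff's
  theorem.\<close>

lemma compact_sphere_perp: "compact (sphere_perp n e)"
proof -
  define B where "B i = (if i < n then {-1..1} else {0::real})" for i
  have "compact (PiE UNIV B)"
    unfolding compactin_euclidean_iff[symmetric] euclidean_product_topology[symmetric] compactin_PiE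
    by (simp add: B_def)
  moreover have "closed {x. ip n x x = 1 \<and> ip n x e = 0}"
    by (intro closed_Collect_conj closed_Collect_eq continuous_intros continuous_on_id)
  moreover have "sphere_perp n e = PiE UNIV B \<inter> {x. ip n x x = 1 \<and> ip n x e = 0}"
  proof -
    have "\<bar>x i\<bar> \<le> 1" if "ip n x x = 1" "i < n" for x i
    proof -
      have "(x i)\<^sup>2 \<le> ip n x x"
        unfolding ip_def power2_eq_square by (rule member_le_sum) (use that in auto)
      then show ?thesis using that by (simp add: abs_square_le_1)
    qed
    then have "x i \<in> B i" if "ip n x x = 1" "\<forall>i\<ge>n. x i = 0" for x i
      using that by (auto simp: B_def abs_le_iff not_less)
    moreover have "x i = 0" if "\<forall>i. x i \<in> B i" "n \<le> i" for x i
      using that(1)[rule_format, of i] that(2) by (auto simp: B_def)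
    moreover have "x \<in> PiE UNIV B \<longleftrightarrow> (\<forall>i. x i \<in> B i)" for x
      by (simp add: PiE_iff)
    ultimately show ?thesis
      unfolding sphere_perp_def by blast
  qed
  ultimately show ?thesis by (simp add: compact_Int_closed)
qed

lemma rayleigh_min_unit:
  assumes "sphere_perp n e \<noteq> {}"
  obtains v where "v \<in> sphere_perp n e"
    "\<And>x. x \<in> sphere_perp n e \<Longrightarrow> ip n v (mv n A v) \<le> ip n x (mv n A x)"
proof -
  have "continuous_on UNIV (\<lambda>x. mv n A x)"
    unfolding mv_def by (intro continuous_on_coordinatewise_then_product continuous_intros)
      (auto intro: continuous_on_product_then_coordinatewise)
  then have "continuous_on (sphere_perp n e) (\<lambda>x. ip n x (mv n A x))"
    by (intro continuous_on_subset[OF continuous_on_ip]) auto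
  from continuous_attains_inf[OF compact_sphere_perp assms this] show ?thesis
    using that by blast
qed

text \<open>First-order optimality: for positive \<open>b\<close> and small negative
  \<open>t\<close> the linear term outweighs the quadratic one.\<close>

lemma nonneg_quadratic_imp_linear_coeff_zero:
  fixes b c :: real
  assumes "\<And>t. 0 \<le> 2 * t * b + t\<^sup>2 * c" and "0 \<le> b"
  shows "b = 0"
proof (rule ccontr)
  assume "b \<noteq> 0"
  then have b: "b > 0" using assms(2) by simp
  define t where "t = - b / (\<bar>c\<bar> + 1)"
  have t: "t * (\<bar>c\<bar> + 1) = - b" "t < 0" using b by (auto simp: t_def field_simps)
  have "t\<^sup>2 * c \<le> t\<^sup>2 * (\<bar>c\<bar> + 1)" by (intro mult_left_mono) auto
  also have "\<dots> = t * (t * (\<bar>c\<bar> + 1))" by (simp add: power2_eq_square)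
  also have "\<dots> = - t * b" using t(1) by simp
  finally have "2 * t * b + t\<^sup>2 * c \<le> t * b" by (simp add: algebra_simps)
  moreover have "t * b < 0" using t b by (simp add: mult_neg_pos)
  ultimately show False using assms(1)[of t] by linarith
qed

text \<open>A minimiser of the quadratic form on the unit sphere orthogonal to \<open>e\<close> is
  an eigenvector. Since \<open>e\<close> lies in the kernel of the symmetric matrix, the residual of
  the eigenvalue equation is again orthogonal to \<open>e\<close> and is thus an admissible
  variation. Taking \<open>e\<close> constant 1 gives the vectors of sum zero, \<open>e\<close>
  constant 0 the whole space.\<close>

lemma rayleigh_min:
  assumes sym: "\<And>i j. i < n \<Longrightarrow> j < n \<Longrightarrow> A i j = A j i"
    and e: "\<And>i. i < n \<Longrightarrow> mv n A e i = 0"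
    and y: "ip n y e = 0" "ip n y y \<noteq> 0"
  obtains v \<mu> where "ip n v v = 1" "ip n v e = 0" "\<And>i. i < n \<Longrightarrow> mv n A v i = \<mu> * v i"
    "\<And>x. ip n x e = 0 \<Longrightarrow> \<mu> * ip n x x \<le> ip n x (mv n A x)"
proof -
  define nrm where "nrm x = (\<lambda>i. if i < n then 1 / sqrt (ip n x x) * x i else 0)" for x
  have nrm: "nrm x \<in> sphere_perp n e \<and> ip n x (mv n A x) = ip n x x * ip n (nrm x) (mv n A (nrm x))"
    if "ip n x e = 0" "ip n x x \<noteq> 0" for x
  proof -
    let ?c = "1 / sqrt (ip n x x)"
    have c: "?c * (?c * ip n x x) = 1"
      using that(2) ip_self_nonneg[of n x] by (simp add: field_simps)
    have a: "ip n (nrm x) z = ?c * ip n x z" for z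
      by (subst ip_scale(1)[symmetric]) (auto intro!: ip_cong simp: nrm_def)
    have b: "mv n A (nrm x) = (\<lambda>i. ?c * mv n A x i)"
      by (subst mv_scale[symmetric]) (auto intro!: mv_cong simp: nrm_def)
    have "ip n (nrm x) (nrm x) = 1"
      unfolding a using c by (subst ip_commute) (simp add: a)
    moreover have "ip n x x * ip n (nrm x) (mv n A (nrm x)) = (?c * (?c * ip n x x)) * ip n x (mv n A x)"
      unfolding a b ip_scale by (simp only: mult_ac)
    ultimately show ?thesis
      using that(1) by (simp only: c) (simp add: sphere_perp_def a, simp add: nrm_def)
  qed
  have "sphere_perp n e \<noteq> {}" using nrm y by blast
  then obtain v where v: "v \<in> sphere_perp n e"
    and min: "\<And>x. x \<in> sphere_perp n e \<Longrightarrow> ip n v (mv n A v) \<le> ip n x (mv n A x)"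
    using rayleigh_min_unit[of n e A] by blast
  define \<mu> where "\<mu> = ip n v (mv n A v)"
  have v1: "ip n v v = 1" "ip n v e = 0" using v by (auto simp: sphere_perp_def)
  have low: "\<mu> * ip n x x \<le> ip n x (mv n A x)" if x: "ip n x e = 0" for x
  proof (cases "ip n x x = 0")
    case True
    then have "x i = 0" if "i < n" for i
      using that by (auto simp: ip_def sum_nonneg_eq_0_iff)
    then show ?thesis using True by (simp add: ip_def)
  next
    case False
    then show ?thesis
      using nrm[OF x False] min[of "nrm x"] ip_self_nonneg[of n x]
      by (simp add: \<mu>_def mult.commute mult_left_mono)
  qed
  \<comment> \<open>The residual of the eigenvalue equation; it is orthogonal both to
    \<open>v\<close> and to \<open>e\<close>.\<close>
  define u where "u = (\<lambda>i. mv n A v i - \<mu> * v i)"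
  have uv: "ip n u v = 0"
    unfolding u_def ip_diff ip_scale v1 using ip_commute[of n v] by (simp add: \<mu>_def)
  have "ip n (mv n A v) e = 0"
    using ip_mv_commute[of n A v e, OF sym] e by (simp add: ip_def)
  then have ue: "ip n u e = 0"
    unfolding u_def ip_diff ip_scale v1 by simp
  have uAv: "ip n u (mv n A v) = ip n u u"
  proof -
    have "ip n u u = ip n u (mv n A v) - \<mu> * ip n u v"
      by (subst (2) u_def) (simp add: ip_diff ip_scale)
    then show ?thesis using uv by simp
  qed
  \<comment> \<open>Perturbing the minimiser by \<open>t * u\<close> changes the form, to first
    order in \<open>t\<close>, by twice the squared norm of \<open>u\<close>, which must therefore
    vanish.\<close>
  have "0 \<le> 2 * t * ip n u u + t\<^sup>2 * (ip n u (mv n A u) - \<mu> * ip n u u)" for t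
  proof -
    define z where "z = (\<lambda>i. v i + t * u i)"
    have "ip n z e = 0" by (simp add: z_def ip_add ip_scale v1 ue)
    then have "\<mu> * ip n z z \<le> ip n z (mv n A z)" by (rule low)
    moreover have "ip n z z = 1 + t\<^sup>2 * ip n u u"
      using uv ip_commute[of n u v] by (simp add: z_def ip_add ip_scale v1 power2_eq_square)
    moreover have "ip n v (mv n A u) = ip n u (mv n A v)"
      by (subst ip_mv_commute[OF sym]) (auto intro: ip_commute)
    then have "ip n z (mv n A z) = \<mu> + 2 * t * ip n u u + t\<^sup>2 * ip n u (mv n A u)"
      using uAv by (simp add: z_def mv_add mv_scale ip_add ip_scale \<mu>_def power2_eq_square algebra_simps)
    ultimately show ?thesis by (simp add: algebra_simps)
  qed
  then have "ip n u u = 0"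
    by (rule nonneg_quadratic_imp_linear_coeff_zero) (simp_all add: ip_self_nonneg)
  then have "u i = 0" if "i < n" for i
    using that by (auto simp: ip_def sum_nonneg_eq_0_iff)
  then have "mv n A v i = \<mu> * v i" if "i < n" for i
    using that by (auto simp: u_def)
  then show ?thesis using that v1 low by blast
qed

lemma eigenvalue_of_mv:
  assumes "B \<in> carrier_mat n n" and "\<And>i j. i < n \<Longrightarrow> j < n \<Longrightarrow> B $$ (i, j) = A i j"
    and "ip n v v = 1" and ev: "\<And>i. i < n \<Longrightarrow> mv n A v i = l * v i"
  shows "eigenvalue B l"
  unfolding eigenvalue_def eigenvector_def
proof (intro exI conjI)
  have dim: "dim_row B = n" "dim_col B = n" using assms(1) by auto
  show "Matrix.vec n v \<in> carrier_vec (dim_row B)" by (simp add: dim)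
  show "Matrix.vec n v \<noteq> 0\<^sub>v (dim_row B)"
  proof
    assume eq: "Matrix.vec n v = 0\<^sub>v (dim_row B)"
    have "v i = 0" if "i < n" for i
      using arg_cong[OF eq, of "\<lambda>w. w $ i"] that by (simp add: dim)
    then show False using assms(3) by (simp add: ip_def)
  qed
  show "B *\<^sub>v Matrix.vec n v = l \<cdot>\<^sub>v Matrix.vec n v"
  proof (rule eq_vecI)
    fix i assume "i < dim_vec (l \<cdot>\<^sub>v Matrix.vec n v)"
    then have i: "i < n" by simp
    have "(B *\<^sub>v Matrix.vec n v) $ i = (\<Sum>j\<in>{0..<n}. B $$ (i, j) * v j)"
      using i by (simp add: dim scalar_prod_def)
    also have "\<dots> = mv n A v i"
      unfolding mv_def atLeast0LessThan by (rule sum.cong) (use i assms(2) in auto)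
    finally show "(B *\<^sub>v Matrix.vec n v) $ i = (l \<cdot>\<^sub>v Matrix.vec n v) $ i"
      using ev[OF i] i by simp
  qed (simp add: dim)
qed

text \<open>The spectral radius is taken over complex eigenvalues; a real eigenvalue remains one
  after the embedding.\<close>

lemma eigenvalue_le_rho:
  assumes "B \<in> carrier_mat n n" "0 < n" "eigenvalue B l"
  shows "\<bar>l\<bar> \<le> rho B"
proof -
  have "eigenvalue (map_mat complex_of_real B) (complex_of_real l)"
    by (rule of_real_hom.eigenvalue_hom[OF assms(1,3)])
  then have "complex_of_real l \<in> spectrum (map_mat complex_of_real B)"
    by (simp add: spectrum_def)
  then have "norm (complex_of_real l) \<in> norm ` spectrum (map_mat complex_of_real B)"
    by (rule imageI)
  then show ?thesis
    using spectral_radius_mem_max(2)[of "map_mat complex_of_real B" n, OF _ assms(2)] assms(1)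
    unfolding rho_def by (metis map_carrier_mat norm_of_real)
qed

lemma eigenvalue_ge_rho2:
  assumes "B \<in> carrier_mat n n" "eigenvalue B l" "0 < l"
  shows "rho2 B \<le> l"
proof -
  have "finite {l. 0 < l \<and> eigenvalue B l}"
    by (rule finite_subset[OF _ card_finite_spectrum(1)[OF assms(1)]]) (auto simp: spectrum_def)
  then show ?thesis unfolding rho2_def using assms by (intro Min_le) auto
qed

section \<open>The graph Laplacian\<close>

definition lap :: "nat \<Rightarrow> (nat \<Rightarrow> nat \<Rightarrow> real) \<Rightarrow> nat \<Rightarrow> nat \<Rightarrow> real" where
  "lap n a i j = (if i = j then (\<Sum>l<n. a i l) else 0) - a i j"

lemma laplacian_carrier: "laplacian n a \<in> carrier_mat n n"
  by (simp add: laplacian_def)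

lemma laplacian_index: "i < n \<Longrightarrow> j < n \<Longrightarrow> laplacian n a $$ (i, j) = lap n a i j"
  by (simp add: laplacian_def lap_def)

lemma mv_lap: "i < n \<Longrightarrow> mv n (lap n a) x i = (\<Sum>j<n. a i j * (x i - x j))"
  by (simp add: mv_def lap_def algebra_simps sum_subtractf if_distrib[of "\<lambda>u. _ * u"] sum_distrib_left
      cong: if_cong)

lemma lap_sym: "weighted_graph n E a \<Longrightarrow> i < n \<Longrightarrow> j < n \<Longrightarrow> lap n a i j = lap n a j i"
  by (auto simp: lap_def weighted_graph_def)

lemma mv_lap_const: "i < n \<Longrightarrow> mv n (lap n a) (\<lambda>_. c) i = 0"
  by (simp add: mv_lap)

lemma sum_mv_lap:
  assumes "weighted_graph n E a"
  shows "(\<Sum>i<n. mv n (lap n a) x i) = 0"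
proof -
  have "ip n (\<lambda>_. 1) (mv n (lap n a) x) = ip n (mv n (lap n a) (\<lambda>_. 1)) x"
    by (rule ip_mv_commute) (rule lap_sym[OF assms])
  also have "\<dots> = 0" by (simp add: ip_def mv_lap_const)
  finally show ?thesis by (simp add: ip_def)
qed

text \<open>Symmetrising in \<open>i\<close> and \<open>j\<close> gives the Dirichlet form; each
  unordered pair is counted twice, whence the division by 2.\<close>

lemma lap_quadratic_form:
  assumes "weighted_graph n E a"
  shows "ip n x (mv n (lap n a) x) = (\<Sum>i<n. \<Sum>j<n. a i j * (x i - x j)\<^sup>2) / 2"
proof -
  let ?s = "\<Sum>i<n. \<Sum>j<n. x i * (a i j * (x i - x j))"
  have s: "ip n x (mv n (lap n a) x) = ?s"
    unfolding ip_def by (rule sum.cong) (auto simp: mv_lap sum_distrib_left)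
  have "?s = (\<Sum>j<n. \<Sum>i<n. x i * (a i j * (x i - x j)))"
    by (rule sum.swap)
  also have "\<dots> = (\<Sum>j<n. \<Sum>i<n. x i * (a j i * (x i - x j)))"
    using assms by (intro sum.cong refl) (auto simp: weighted_graph_def)
  finally have "2 * ?s = ?s + (\<Sum>i<n. \<Sum>j<n. x j * (a i j * (x j - x i)))" by simp
  also have "\<dots> = (\<Sum>i<n. \<Sum>j<n. a i j * (x i - x j)\<^sup>2)"
    unfolding sum.distrib[symmetric]
    by (intro sum.cong refl) (simp add: power2_eq_square algebra_simps)
  finally show ?thesis using s by simp
qed

text \<open>Zero Dirichlet energy forces equal values across each edge, hence along every
  path.\<close>

lemma connected_const:
  assumes g: "weighted_graph n E a" and c: "graph_connected n E"
    and z: "(\<Sum>i<n. \<Sum>j<n. a i j * (x i - x j)\<^sup>2) = 0" and "i < n" "j < n"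
  shows "x i = x j"
proof -
  have a: "0 \<le> a i j" if "i < n" "j < n" for i j
    using g that unfolding weighted_graph_def by (metis less_eq_real_def)
  have edge: "x i = x j" if "(i, j) \<in> E" for i j
  proof -
    have ij: "i < n" "j < n" "a i j > 0"
      using g that unfolding weighted_graph_def by (auto split: if_splits)
    have "\<forall>i\<in>{..<n}. (\<Sum>j<n. a i j * (x i - x j)\<^sup>2) = 0"
      by (rule iffD1[OF sum_nonneg_eq_0_iff z]) (auto intro!: sum_nonneg a mult_nonneg_nonneg)
    then have "(\<Sum>j<n. a i j * (x i - x j)\<^sup>2) = 0" using ij by blast
    then have "\<forall>j\<in>{..<n}. a i j * (x i - x j)\<^sup>2 = 0"
      by (rule iffD1[OF sum_nonneg_eq_0_iff, rotated 2]) (auto intro!: a ij mult_nonneg_nonneg)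
    then have "a i j * (x i - x j)\<^sup>2 = 0" using ij by blast
    then show ?thesis using ij by simp
  qed
  have "(i, j) \<in> E\<^sup>*" using c assms by (auto simp: graph_connected_def)
  then show ?thesis by induction (auto simp: edge)
qed

text \<open>The least Rayleigh value on vectors of sum zero is a nonnegative eigenvalue. Were it 0,
  connectedness would make its eigenvector constant, contradicting sum zero and norm 1. So it is
  among the eigenvalues over which \<open>rho2\<close> takes the minimum.\<close>

lemma lap_lower:
  assumes g: "weighted_graph n E a" and c: "graph_connected n E" and x: "(\<Sum>i<n. x i) = 0"
  shows "rho2 (laplacian n a) * ip n x x \<le> ip n x (mv n (lap n a) x)"
proof (cases "ip n x x = 0")
  case True
  then have "x i = 0" if "i < n" for i
    using that by (auto simp: ip_def sum_nonneg_eq_0_iff)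
  then show ?thesis using True by (simp add: ip_def)
next
  case False
  \<comment> \<open>A nonzero vector of sum zero certifies that the sphere is not empty; for
    \<open>n\<close> equal to 1 there is none.\<close>
  have "ip n x (\<lambda>_. 1) = 0" using x by (simp add: ip_def)
  from rayleigh_min[of n "lap n a", OF lap_sym[OF g] _ this False]
  obtain v \<mu> where v: "ip n v v = 1" "ip n v (\<lambda>_. 1) = 0" "\<And>i. i < n \<Longrightarrow> mv n (lap n a) v i = \<mu> * v i"
    and low: "\<And>x. ip n x (\<lambda>_. 1) = 0 \<Longrightarrow> \<mu> * ip n x x \<le> ip n x (mv n (lap n a) x)"
    by (auto simp: mv_lap_const)
  have "ip n v (mv n (lap n a) v) = ip n v (\<lambda>i. \<mu> * v i)"
    by (rule ip_cong) (auto simp: v)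
  then have lam: "\<mu> = (\<Sum>i<n. \<Sum>j<n. a i j * (v i - v j)\<^sup>2) / 2"
    using lap_quadratic_form[OF g, of v] by (simp add: ip_scale v)
  have "0 \<le> a i j" if "i < n" "j < n" for i j
    using g that unfolding weighted_graph_def by (metis less_eq_real_def)
  then have "0 \<le> \<mu>" unfolding lam by (auto intro!: sum_nonneg divide_nonneg_pos mult_nonneg_nonneg)
  moreover have "\<mu> \<noteq> 0"
  proof
    assume "\<mu> = 0"
    then have const: "v i = v j" if "i < n" "j < n" for i j
      using connected_const[OF g c _ that, of v] lam by simp
    have "n > 0" using v(1) by (cases n) (auto simp: ip_def)
    have "ip n v v = v 0 * ip n v (\<lambda>_. 1)"
      unfolding ip_def sum_distrib_left using const[OF \<open>n > 0\<close>] by (intro sum.cong) auto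
    then show False using v by simp
  qed
  ultimately have "rho2 (laplacian n a) \<le> \<mu>"
    by (intro eigenvalue_ge_rho2[OF laplacian_carrier] eigenvalue_of_mv[OF laplacian_carrier laplacian_index v(1,3)]) auto
  then have "rho2 (laplacian n a) * ip n x x \<le> \<mu> * ip n x x"
    by (intro mult_right_mono ip_self_nonneg)
  also have "\<dots> \<le> ip n x (mv n (lap n a) x)" by (rule low) fact
  finally show ?thesis .
qed

text \<open>\<open>rayleigh_min\<close> yields minima only, so it is applied to the negated square
  of the Laplacian, whose least eigenvalue is minus the greatest eigenvalue of the square. Symmetry
  turns the form of the square into a squared norm.\<close>

lemma lap_sq_upper:
  assumes g: "weighted_graph n E a" and n: "0 < n"
  shows "ip n (mv n (lap n a) x) (mv n (lap n a) x) \<le> rho (laplacian n a * laplacian n a) * ip n x x"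
    and "0 \<le> rho (laplacian n a * laplacian n a)"
proof -
  define A where "A i j = - (\<Sum>k<n. lap n a i k * lap n a k j)" for i j
  have LL: "laplacian n a * laplacian n a \<in> carrier_mat n n"
    by (rule mult_carrier_mat[OF laplacian_carrier laplacian_carrier])
  have LLi: "(laplacian n a * laplacian n a) $$ (i, j) = - A i j" if "i < n" "j < n" for i j
  proof -
    have dim: "dim_row (laplacian n a) = n" "dim_col (laplacian n a) = n" by (auto simp: laplacian_def)
    have "(laplacian n a * laplacian n a) $$ (i, j)
        = (\<Sum>k\<in>{0..<n}. laplacian n a $$ (i, k) * laplacian n a $$ (k, j))"
      using that by (simp add: dim scalar_prod_def)
    also have "\<dots> = - A i j"
      unfolding A_def minus_minus atLeast0LessThan by (rule sum.cong) (use that in \<open>auto simp: laplacian_index\<close>)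
    finally show ?thesis .
  qed
  have symA: "A i j = A j i" if "i < n" "j < n" for i j
    unfolding A_def using that lap_sym[OF g] by (auto intro!: sum.cong simp: mult.commute)
  have mvA: "mv n A x i = - mv n (lap n a) (mv n (lap n a) x) i" if "i < n" for x i
  proof -
    have "mv n (lap n a) (mv n (lap n a) x) i = (\<Sum>k<n. \<Sum>j<n. lap n a i k * (lap n a k j * x j))"
      by (simp add: mv_def sum_distrib_left)
    also have "\<dots> = (\<Sum>j<n. \<Sum>k<n. lap n a i k * (lap n a k j * x j))" by (rule sum.swap)
    also have "\<dots> = - mv n A x i"
      by (simp add: mv_def A_def sum_distrib_right mult.assoc sum_negf)
    finally show ?thesis by simp
  qed
  have ipA: "ip n x (mv n A x) = - ip n (mv n (lap n a) x) (mv n (lap n a) x)" for x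
  proof -
    have "ip n x (mv n A x) = ip n x (\<lambda>i. - 1 * mv n (lap n a) (mv n (lap n a) x) i)"
      by (rule ip_cong) (auto simp: mvA)
    also have "\<dots> = - ip n x (mv n (lap n a) (mv n (lap n a) x))" unfolding ip_scale by simp
    also have "\<dots> = - ip n (mv n (lap n a) x) (mv n (lap n a) x)"
      using ip_mv_commute[of n "lap n a" x "mv n (lap n a) x", OF lap_sym[OF g]] by simp
    finally show ?thesis .
  qed
  have "\<exists>\<mu>. (\<forall>x. \<mu> * ip n x x \<le> ip n x (mv n A x)) \<and> \<bar>\<mu>\<bar> \<le> rho (laplacian n a * laplacian n a)"
  proof -
    have "ip n (\<lambda>i. of_bool (i = 0)) (\<lambda>i. of_bool (i = 0)) \<noteq> 0"
      using n by (simp add: ip_def sum_nonneg_eq_0_iff)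
    from rayleigh_min[where n = n and A = A and e = "\<lambda>_. 0", OF symA _ _ this]
    obtain v \<mu> where v: "ip n v v = 1" "\<And>i. i < n \<Longrightarrow> mv n A v i = \<mu> * v i"
      and low: "\<And>x. \<mu> * ip n x x \<le> ip n x (mv n A x)"
      by (auto simp: mv_def ip_def)
    have "mv n (\<lambda>i j. - A i j) v i = - \<mu> * v i" if "i < n" for i
      using v(2)[OF that] by (simp add: mv_def sum_negf)
    then have "eigenvalue (laplacian n a * laplacian n a) (- \<mu>)"
      by (intro eigenvalue_of_mv[OF LL LLi v(1)]) auto
    then show ?thesis using low eigenvalue_le_rho[OF LL n] by force
  qed
  then obtain \<mu> where low: "\<And>x. \<mu> * ip n x x \<le> ip n x (mv n A x)"
    and le: "\<bar>\<mu>\<bar> \<le> rho (laplacian n a * laplacian n a)" by blast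
  show "0 \<le> rho (laplacian n a * laplacian n a)" using le by linarith
  have "ip n (mv n (lap n a) x) (mv n (lap n a) x) \<le> - \<mu> * ip n x x"
    using low[of x] ipA[of x] by simp
  also have "\<dots> \<le> rho (laplacian n a * laplacian n a) * ip n x x"
    using le by (intro mult_right_mono ip_self_nonneg) auto
  finally show "ip n (mv n (lap n a) x) (mv n (lap n a) x) \<le> rho (laplacian n a * laplacian n a) * ip n x x" .
qed

text \<open>In the expanded square the middle term gains \<open>2 * \<alpha> * rho2\<close>, and the
  bound on \<alpha> limits the quadratic term to \<open>\<alpha> * rho2 / 2\<close>. The surplus of
  3/2 over 1 pays later for Young's inequality.\<close>

lemma mixing_contraction:
  assumes g: "weighted_graph n E a" and c: "graph_connected n E" and n: "0 < n"
    and \<alpha>: "0 < \<alpha>" "\<alpha> < rho2 (laplacian n a) / (2 * rho (laplacian n a * laplacian n a))"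
  shows "0 < rho2 (laplacian n a)"
    and "(\<Sum>i<n. x i) = 0 \<Longrightarrow>
      (\<Sum>i<n. (x i - \<alpha> * mv n (lap n a) x i)\<^sup>2)
        \<le> (1 - 3 / 2 * (\<alpha> * rho2 (laplacian n a))) * (\<Sum>i<n. (x i)\<^sup>2)"
proof -
  let ?r = "rho2 (laplacian n a)" and ?R = "rho (laplacian n a * laplacian n a)"
  \<comment> \<open>Division by zero yields 0, so \<open>?R = 0\<close> would leave no positive
    \<alpha>; this is what happens for a single agent.\<close>
  have R: "?R > 0"
    using lap_sq_upper(2)[OF g n] \<alpha> by (cases "?R = 0") auto
  then have ar: "\<alpha> * (2 * ?R) < ?r" using \<alpha> by (simp add: pos_less_divide_eq)
  show "0 < ?r" using ar R \<alpha>(1) by (smt (verit) mult_pos_pos)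
  assume x: "(\<Sum>i<n. x i) = 0"
  let ?y = "mv n (lap n a) x"
  have "(\<Sum>i<n. (x i - \<alpha> * ?y i)\<^sup>2) = ip n x x - 2 * \<alpha> * ip n x ?y + \<alpha>\<^sup>2 * ip n ?y ?y"
    by (simp add: ip_def sum_distrib_left power2_eq_square algebra_simps sum.distrib sum_subtractf)
  also have "\<dots> \<le> ip n x x - 2 * \<alpha> * (?r * ip n x x) + \<alpha>\<^sup>2 * (?R * ip n x x)"
    using \<alpha>(1) lap_lower[OF g c x] lap_sq_upper(1)[OF g n, of x]
    by (intro add_mono diff_mono mult_left_mono) auto
  also have "\<alpha>\<^sup>2 * (?R * ip n x x) = \<alpha> * (\<alpha> * ?R) * ip n x x" by (simp add: power2_eq_square)
  also have "\<dots> \<le> \<alpha> * (?r / 2) * ip n x x"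
    using ar \<alpha>(1) by (intro mult_right_mono mult_left_mono ip_self_nonneg) auto
  finally show "(\<Sum>i<n. (x i - \<alpha> * ?y i)\<^sup>2) \<le> (1 - 3 / 2 * (\<alpha> * ?r)) * (\<Sum>i<n. (x i)\<^sup>2)"
    by (simp add: ip_def power2_eq_square algebra_simps)
qed

section \<open>One iteration from a fixed state\<close>

lemma sq_sum_le:
  fixes u :: "'i \<Rightarrow> real"
  shows "(\<Sum>i\<in>I. u i)\<^sup>2 \<le> real (card I) * (\<Sum>i\<in>I. (u i)\<^sup>2)"
  using sum_squared_le_sum_of_squares[of u I] by (simp add: mult.commute)

text \<open>Young's inequality. A small weight on the contracted part keeps it a contraction; the
  price falls on the gradient part.\<close>

lemma weighted_sq_le:
  fixes u v \<beta> :: real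
  assumes "0 < \<beta>"
  shows "(u - v)\<^sup>2 \<le> (1 + \<beta>) * u\<^sup>2 + (1 + 1 / \<beta>) * v\<^sup>2"
proof -
  have "0 \<le> (\<beta> * u + v)\<^sup>2 / \<beta>" using assms by simp
  then show ?thesis using assms by (simp add: power2_eq_square field_simps)
qed

lemma sum_centered_sq_le:
  assumes "0 < n"
  shows "(\<Sum>i<n. (g i - (\<Sum>i<n. g i) / real n)\<^sup>2) \<le> (\<Sum>i<n. (g i)\<^sup>2)"
proof -
  define s where "s = (\<Sum>i<n. g i) / real n"
  have s: "(\<Sum>i<n. g i) = real n * s" using assms by (simp add: s_def)
  have "(\<Sum>i<n. (g i - s)\<^sup>2) = (\<Sum>i<n. (g i)\<^sup>2) - 2 * s * (\<Sum>i<n. g i) + real n * s\<^sup>2"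
    by (simp add: power2_eq_square algebra_simps sum.distrib sum_subtractf sum_distrib_left)
  also have "\<dots> = (\<Sum>i<n. (g i)\<^sup>2) - real n * s\<^sup>2" unfolding s by (simp add: power2_eq_square)
  finally show ?thesis by (simp add: s_def)
qed

text \<open>The Laplacian annihilates constants and its image has sum zero. Hence the deviations
  from the mean are mixed in the same way, and the mean itself is moved by the gradients
  only.\<close>

lemma consensus_step_scalar:
  fixes x g :: "nat \<Rightarrow> real" and \<alpha> \<eta> :: real
  assumes gr: "weighted_graph n E a" "graph_connected n E" and n: "0 < n"
    and \<alpha>: "0 < \<alpha>" "\<alpha> < rho2 (laplacian n a) / (2 * rho (laplacian n a * laplacian n a))"
  defines "r \<equiv> \<alpha> * rho2 (laplacian n a)"
    and "x' \<equiv> (\<lambda>i. x i - \<alpha> * mv n (lap n a) x i - \<eta> * g i)"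
  shows "(\<Sum>i<n. (x' i - (\<Sum>i<n. x' i) / real n)\<^sup>2)
    \<le> (1 - r) * (\<Sum>i<n. (x i - (\<Sum>i<n. x i) / real n)\<^sup>2) + (1 + 2 / r) * \<eta>\<^sup>2 * (\<Sum>i<n. (g i)\<^sup>2)"
proof -
  have r: "0 < r" unfolding r_def using \<alpha>(1) mixing_contraction(1)[OF gr n \<alpha>] by simp
  define m where "m u = (\<Sum>i<n. u i) / real n" for u :: "nat \<Rightarrow> real"
  define y where "y i = x i - m x" for i
  define u where "u i = y i - \<alpha> * mv n (lap n a) y i" for i
  have mv: "mv n (lap n a) x i = mv n (lap n a) y i" if "i < n" for i
    using that by (simp add: mv_lap y_def)
  have mx': "m x' = m x - \<eta> * m g"
  proof -
    have "(\<Sum>i<n. x' i) = (\<Sum>i<n. x i) - \<alpha> * (\<Sum>i<n. mv n (lap n a) x i) - \<eta> * (\<Sum>i<n. g i)"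
      by (simp add: x'_def sum_subtractf sum_distrib_left)
    then show ?thesis unfolding sum_mv_lap[OF gr(1)] by (simp add: m_def diff_divide_distrib)
  qed
  have "(\<Sum>i<n. (x' i - m x')\<^sup>2) = (\<Sum>i<n. (u i - \<eta> * (g i - m g))\<^sup>2)"
    unfolding mx' by (rule sum.cong) (auto simp: x'_def mv u_def y_def algebra_simps)
  also have "\<dots> \<le> (\<Sum>i<n. (1 + r / 2) * (u i)\<^sup>2 + (1 + 1 / (r / 2)) * (\<eta> * (g i - m g))\<^sup>2)"
    by (intro sum_mono weighted_sq_le) (use r in simp)
  also have "\<dots> = (1 + r / 2) * (\<Sum>i<n. (u i)\<^sup>2) + (1 + 2 / r) * \<eta>\<^sup>2 * (\<Sum>i<n. (g i - m g)\<^sup>2)"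
    by (simp add: sum.distrib sum_distrib_left power_mult_distrib mult.assoc)
  also have "\<dots> \<le> (1 + r / 2) * ((1 - 3 / 2 * r) * (\<Sum>i<n. (y i)\<^sup>2)) + (1 + 2 / r) * \<eta>\<^sup>2 * (\<Sum>i<n. (g i)\<^sup>2)"
  proof (intro add_mono mult_left_mono)
    have "(\<Sum>i<n. y i) = 0" using n by (simp add: y_def m_def sum_subtractf)
    from mixing_contraction(2)[OF gr n \<alpha> this]
    show "(\<Sum>i<n. (u i)\<^sup>2) \<le> (1 - 3 / 2 * r) * (\<Sum>i<n. (y i)\<^sup>2)" by (simp add: u_def r_def)
    show "(\<Sum>i<n. (g i - m g)\<^sup>2) \<le> (\<Sum>i<n. (g i)\<^sup>2)"
      unfolding m_def by (rule sum_centered_sq_le[OF n])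
  qed (use r in auto)
  \<comment> \<open>The product of the two factors is 1 - r - 3 r^2 / 4; the weight
    \<open>r / 2\<close> was chosen for this.\<close>
  also have "(1 + r / 2) * ((1 - 3 / 2 * r) * (\<Sum>i<n. (y i)\<^sup>2)) \<le> (1 - r) * (\<Sum>i<n. (y i)\<^sup>2)"
    unfolding mult.assoc[symmetric]
    by (intro mult_right_mono sum_nonneg) (use r in \<open>auto simp: algebra_simps\<close>)
  finally show ?thesis by (simp add: m_def y_def)
qed

lemma consensus_err_eq: 
  "consensus_err n p x = (\<Sum>l<p. \<Sum>i<n. (x i l - (\<Sum>i<n. x i l) / real n)\<^sup>2) / real n"
proof -
  have "(\<Sum>i<n. (vnorm p (vdiff p (x i) (avg n p x)))\<^sup>2) = (\<Sum>i<n. \<Sum>l<p. (x i l - (\<Sum>i<n. x i l) / real n)\<^sup>2)"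
    unfolding vnorm_vdiff_sq by (intro sum.cong refl) (simp add: avg_def)
  also have "\<dots> = (\<Sum>l<p. \<Sum>i<n. (x i l - (\<Sum>i<n. x i l) / real n)\<^sup>2)" by (rule sum.swap)
  finally show ?thesis by (simp add: consensus_err_def)
qed

lemma consensus_err_nonneg: "0 \<le> consensus_err n p x"
  unfolding consensus_err_def by (auto intro!: sum_nonneg divide_nonneg_nonneg)

text \<open>The estimators at one frozen state. Of the independence across agents only the vanishing
  of covariances in each coordinate is kept, which is all that the variance of an average
  sees.\<close>

locale gradient_samples = prob_space M for M :: "'w measure" +
  fixes n p :: nat and g :: "nat \<Rightarrow> nat \<Rightarrow> 'w \<Rightarrow> real"
  assumes n_pos: "0 < n"
    and g_integrable: "i < n \<Longrightarrow> l < p \<Longrightarrow> integrable M (g i l)"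
    and g_sq_integrable: "i < n \<Longrightarrow> l < p \<Longrightarrow> integrable M (\<lambda>\<omega>. (g i l \<omega>)\<^sup>2)"
    and uncorrelated: "i < n \<Longrightarrow> j < n \<Longrightarrow> i \<noteq> j \<Longrightarrow> l < p \<Longrightarrow>
      expectation (\<lambda>\<omega>. g i l \<omega> * g j l \<omega>) = expectation (g i l) * expectation (g j l)"
begin

definition mean :: "nat \<Rightarrow> 'w \<Rightarrow> real" where
  "mean l \<omega> = (\<Sum>i<n. g i l \<omega>) / real n"

definition second_moment :: real where
  "second_moment = (\<Sum>i<n. \<Sum>l<p. expectation (\<lambda>\<omega>. (g i l \<omega>)\<^sup>2)) / real n"

lemma prod_integrable:
  assumes "i < n" "j < n" "l < p"
  shows "integrable M (\<lambda>\<omega>. g i l \<omega> * g j l \<omega>)"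
proof (rule Bochner_Integration.integrable_bound)
  show "integrable M (\<lambda>\<omega>. (g i l \<omega>)\<^sup>2 + (g j l \<omega>)\<^sup>2)"
    using assms by (intro Bochner_Integration.integrable_add g_sq_integrable)
  show "(\<lambda>\<omega>. g i l \<omega> * g j l \<omega>) \<in> borel_measurable M"
    using assms by (intro borel_measurable_times borel_measurable_integrable g_integrable)
  have "\<bar>a * b\<bar> \<le> a\<^sup>2 + b\<^sup>2" for a b :: real
  proof -
    have "2 * (\<bar>a\<bar> * \<bar>b\<bar>) \<le> \<bar>a\<bar>\<^sup>2 + \<bar>b\<bar>\<^sup>2" using sum_squares_bound[of "\<bar>a\<bar>" "\<bar>b\<bar>"] by (simp only: mult.assoc)
    moreover have "0 \<le> \<bar>a\<bar> * \<bar>b\<bar>" by simp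
    ultimately show ?thesis unfolding abs_mult power2_abs by linarith
  qed
  then show "AE \<omega> in M. norm (g i l \<omega> * g j l \<omega>) \<le> norm ((g i l \<omega>)\<^sup>2 + (g j l \<omega>)\<^sup>2)" by simp
qed

lemma mean_integrable: "l < p \<Longrightarrow> integrable M (mean l)"
  unfolding mean_def by (intro integrable_divide Bochner_Integration.integrable_sum g_integrable) auto

lemma sum_sq_eq: "(\<Sum>i<n. g i l \<omega>)\<^sup>2 = (\<Sum>i<n. \<Sum>j<n. g i l \<omega> * g j l \<omega>)"
  by (simp add: power2_eq_square sum_product)

lemma mean_sq_integrable: "l < p \<Longrightarrow> integrable M (\<lambda>\<omega>. (mean l \<omega>)\<^sup>2)"
  unfolding mean_def power_divide sum_sq_eq
  by (intro integrable_divide Bochner_Integration.integrable_sum prod_integrable) auto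

text \<open>The linear speedup: the variance of the average is \<open>1 / n\<close> times the average variance.\<close>

lemma mean_sq_le:
  assumes l: "l < p"
  shows "expectation (\<lambda>\<omega>. (mean l \<omega>)\<^sup>2)
    \<le> (expectation (mean l))\<^sup>2 + (\<Sum>i<n. expectation (\<lambda>\<omega>. (g i l \<omega>)\<^sup>2)) / (real n)\<^sup>2"
proof -
  define m where "m i = expectation (g i l)" for i
  define q where "q i = expectation (\<lambda>\<omega>. (g i l \<omega>)\<^sup>2)" for i
  \<comment> \<open>On the diagonal the square \<open>m i * m i\<close> is added as slack, so that
    the double sum closes up to the square of a sum.\<close>
  have pair: "expectation (\<lambda>\<omega>. g i l \<omega> * g j l \<omega>) \<le> m i * m j + (if i = j then q i else 0)"
    if "i < n" "j < n" for i j
  proof (cases "i = j")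
    case True
    have "0 \<le> m j * m j" by simp
    then show ?thesis using True by (simp add: q_def power2_eq_square)
  next
    case False
    then show ?thesis using uncorrelated[OF that False l] by (simp add: m_def)
  qed
  have "integrable M (\<lambda>\<omega>. \<Sum>j<n. g i l \<omega> * g j l \<omega>)" if "i < n" for i
    using that l by (intro Bochner_Integration.integrable_sum prod_integrable) auto
  then have "expectation (\<lambda>\<omega>. (\<Sum>i<n. g i l \<omega>)\<^sup>2) = (\<Sum>i<n. \<Sum>j<n. expectation (\<lambda>\<omega>. g i l \<omega> * g j l \<omega>))"
    unfolding sum_sq_eq using l
    by (simp add: prod_integrable)
  also have "\<dots> \<le> (\<Sum>i<n. \<Sum>j<n. m i * m j + (if i = j then q i else 0))"
    by (intro sum_mono pair) auto
  also have "\<dots> = (\<Sum>i<n. m i)\<^sup>2 + (\<Sum>i<n. q i)"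
    by (simp add: sum.distrib power2_eq_square sum_product)
  finally have *: "expectation (\<lambda>\<omega>. (\<Sum>i<n. g i l \<omega>)\<^sup>2) \<le> (\<Sum>i<n. m i)\<^sup>2 + (\<Sum>i<n. q i)" .
  have "expectation (mean l) = (\<Sum>i<n. m i) / real n"
    unfolding mean_def m_def using l by (simp add: g_integrable)
  then have "(expectation (mean l))\<^sup>2 + (\<Sum>i<n. q i) / (real n)\<^sup>2 = ((\<Sum>i<n. m i)\<^sup>2 + (\<Sum>i<n. q i)) / (real n)\<^sup>2"
    by (simp add: power_divide add_divide_distrib)
  moreover have "expectation (\<lambda>\<omega>. (mean l \<omega>)\<^sup>2) = expectation (\<lambda>\<omega>. (\<Sum>i<n. g i l \<omega>)\<^sup>2) / (real n)\<^sup>2"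
    unfolding mean_def power_divide by simp
  ultimately show ?thesis using divide_right_mono[OF *, of "(real n)\<^sup>2"] by (simp add: q_def)
qed

lemma mean_sq_sum_le:
  "(\<Sum>l<p. expectation (\<lambda>\<omega>. (mean l \<omega>)\<^sup>2)) \<le> (\<Sum>l<p. (expectation (mean l))\<^sup>2) + second_moment / real n"
proof -
  have "(\<Sum>l<p. expectation (\<lambda>\<omega>. (mean l \<omega>)\<^sup>2))
      \<le> (\<Sum>l<p. (expectation (mean l))\<^sup>2 + (\<Sum>i<n. expectation (\<lambda>\<omega>. (g i l \<omega>)\<^sup>2)) / (real n)\<^sup>2)"
    by (intro sum_mono mean_sq_le) auto
  also have "\<dots> = (\<Sum>l<p. (expectation (mean l))\<^sup>2) + (\<Sum>l<p. \<Sum>i<n. expectation (\<lambda>\<omega>. (g i l \<omega>)\<^sup>2)) / (real n)\<^sup>2"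
    by (simp add: sum.distrib sum_divide_distrib)
  also have "(\<Sum>l<p. \<Sum>i<n. expectation (\<lambda>\<omega>. (g i l \<omega>)\<^sup>2)) = (\<Sum>i<n. \<Sum>l<p. expectation (\<lambda>\<omega>. (g i l \<omega>)\<^sup>2))"
    by (rule sum.swap)
  finally show ?thesis by (simp add: second_moment_def power2_eq_square)
qed

text \<open>Jensen's inequality gives no speedup in \<open>n\<close>, but no separate bias term
  either. It serves the one-step bound that holds for every step size.\<close>

lemma mean_sq_sum_crude: "(\<Sum>l<p. expectation (\<lambda>\<omega>. (mean l \<omega>)\<^sup>2)) \<le> second_moment"
proof -
  have "(mean l \<omega>)\<^sup>2 \<le> (\<Sum>i<n. (g i l \<omega>)\<^sup>2) / real n" for l \<omega>
  proof -
    have "(\<Sum>i<n. g i l \<omega>)\<^sup>2 / (real n)\<^sup>2 \<le> (real n * (\<Sum>i<n. (g i l \<omega>)\<^sup>2)) / (real n)\<^sup>2"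
      using sq_sum_le[of "\<lambda>i. g i l \<omega>" "{..<n}"] by (intro divide_right_mono) auto
    then show ?thesis using n_pos by (simp add: mean_def power_divide power2_eq_square[of "real n"])
  qed
  then have "(\<Sum>l<p. expectation (\<lambda>\<omega>. (mean l \<omega>)\<^sup>2))
      \<le> (\<Sum>l<p. expectation (\<lambda>\<omega>. (\<Sum>i<n. (g i l \<omega>)\<^sup>2) / real n))"
    by (intro sum_mono integral_mono mean_sq_integrable integrable_divide
        Bochner_Integration.integrable_sum g_sq_integrable) auto
  also have "\<dots> = (\<Sum>l<p. (\<Sum>i<n. expectation (\<lambda>\<omega>. (g i l \<omega>)\<^sup>2)) / real n)"
    by (intro sum.cong refl) (simp add: g_sq_integrable)
  also have "\<dots> = (\<Sum>l<p. \<Sum>i<n. expectation (\<lambda>\<omega>. (g i l \<omega>)\<^sup>2)) / real n" by (simp add: sum_divide_distrib)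
  also have "(\<Sum>l<p. \<Sum>i<n. expectation (\<lambda>\<omega>. (g i l \<omega>)\<^sup>2)) = (\<Sum>i<n. \<Sum>l<p. expectation (\<lambda>\<omega>. (g i l \<omega>)\<^sup>2))"
    by (rule sum.swap)
  finally show ?thesis by (simp add: second_moment_def)
qed

text \<open>The contraction holds for every outcome; only the squared estimators have to be
  averaged.\<close>

lemma consensus_step:
  fixes x :: "nat \<Rightarrow> nat \<Rightarrow> real" and x' :: "'w \<Rightarrow> nat \<Rightarrow> nat \<Rightarrow> real" and \<alpha> \<eta> :: real
  assumes gr: "weighted_graph n E a" "graph_connected n E"
    and \<alpha>: "0 < \<alpha>" "\<alpha> < rho2 (laplacian n a) / (2 * rho (laplacian n a * laplacian n a))"
    and x': "\<And>i l \<omega>. i < n \<Longrightarrow> l < p \<Longrightarrow> x' \<omega> i l = x i l - \<alpha> * mv n (lap n a) (\<lambda>j. x j l) i - \<eta> * g i l \<omega>"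
  defines "r \<equiv> \<alpha> * rho2 (laplacian n a)"
  shows "integrable M (\<lambda>\<omega>. consensus_err n p (x' \<omega>))"
    and "expectation (\<lambda>\<omega>. consensus_err n p (x' \<omega>))
      \<le> (1 - r) * consensus_err n p x + (1 + 2 / r) * \<eta>\<^sup>2 * second_moment"
proof -
  let ?b = "\<lambda>\<omega>. (1 - r) * consensus_err n p x + (1 + 2 / r) * \<eta>\<^sup>2 * ((\<Sum>i<n. \<Sum>l<p. (g i l \<omega>)\<^sup>2) / real n)"
  have le: "consensus_err n p (x' \<omega>) \<le> ?b \<omega>" for \<omega>
  proof -
    have "(\<Sum>i<n. (x' \<omega> i l - (\<Sum>i<n. x' \<omega> i l) / real n)\<^sup>2)
      \<le> (1 - r) * (\<Sum>i<n. (x i l - (\<Sum>i<n. x i l) / real n)\<^sup>2) + (1 + 2 / r) * \<eta>\<^sup>2 * (\<Sum>i<n. (g i l \<omega>)\<^sup>2)"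
      if "l < p" for l
      using consensus_step_scalar[OF gr n_pos \<alpha>, of "\<lambda>i. x i l" \<eta> "\<lambda>i. g i l \<omega>"] that
      by (simp add: x' r_def cong: sum.cong_simp)
    then have "consensus_err n p (x' \<omega>)
      \<le> (\<Sum>l<p. (1 - r) * (\<Sum>i<n. (x i l - (\<Sum>i<n. x i l) / real n)\<^sup>2) + (1 + 2 / r) * \<eta>\<^sup>2 * (\<Sum>i<n. (g i l \<omega>)\<^sup>2)) / real n"
      unfolding consensus_err_eq by (intro divide_right_mono sum_mono) auto
    also have "\<dots> = (1 - r) * consensus_err n p x + (1 + 2 / r) * \<eta>\<^sup>2 * ((\<Sum>l<p. \<Sum>i<n. (g i l \<omega>)\<^sup>2) / real n)"
      by (simp add: consensus_err_eq sum.distrib sum_distrib_left add_divide_distrib)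
    also have "(\<Sum>l<p. \<Sum>i<n. (g i l \<omega>)\<^sup>2) = (\<Sum>i<n. \<Sum>l<p. (g i l \<omega>)\<^sup>2)" by (rule sum.swap)
    finally show ?thesis .
  qed
  have intb: "integrable M ?b"
    by (intro Bochner_Integration.integrable_add integrable_const integrable_mult_right integrable_divide
        Bochner_Integration.integrable_sum g_sq_integrable) auto
  have meas: "(\<lambda>\<omega>. consensus_err n p (x' \<omega>)) \<in> borel_measurable M"
  proof -
    have "(\<lambda>\<omega>. x' \<omega> i l) \<in> borel_measurable M" if "i < n" "l < p" for i l
      unfolding x'[OF that]
      by (intro borel_measurable_diff borel_measurable_times borel_measurable_const
          borel_measurable_integrable g_integrable that)
    then show ?thesis unfolding consensus_err_eq
      by (intro borel_measurable_divide borel_measurable_sum borel_measurable_power borel_measurable_diff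
          borel_measurable_const) auto
  qed
  show int: "integrable M (\<lambda>\<omega>. consensus_err n p (x' \<omega>))"
    by (rule Bochner_Integration.integrable_bound[OF intb meas])
      (use le consensus_err_nonneg in \<open>auto intro!: AE_I2 intro: order.trans[OF le] order.trans[OF _ abs_ge_self]\<close>)
  have "expectation (\<lambda>\<omega>. consensus_err n p (x' \<omega>)) \<le> expectation ?b"
    by (rule integral_mono[OF int intb le])
  also have "\<dots> = (1 - r) * consensus_err n p x + (1 + 2 / r) * \<eta>\<^sup>2 * second_moment"
  proof -
    have 1: "integrable M (\<lambda>\<omega>. \<Sum>l<p. (g i l \<omega>)\<^sup>2)" if "i < n" for i
      using that by (intro Bochner_Integration.integrable_sum g_sq_integrable) auto
    have 2: "integrable M (\<lambda>\<omega>. \<Sum>i<n. \<Sum>l<p. (g i l \<omega>)\<^sup>2)"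
      by (intro Bochner_Integration.integrable_sum 1) auto
    have "expectation (\<lambda>\<omega>. \<Sum>i<n. \<Sum>l<p. (g i l \<omega>)\<^sup>2) = (\<Sum>i<n. \<Sum>l<p. expectation (\<lambda>\<omega>. (g i l \<omega>)\<^sup>2))"
      using 1 by (simp add: g_sq_integrable)
    then show ?thesis using 2 by (simp add: second_moment_def prob_space)
  qed
  finally show "expectation (\<lambda>\<omega>. consensus_err n p (x' \<omega>))
      \<le> (1 - r) * consensus_err n p x + (1 + 2 / r) * \<eta>\<^sup>2 * second_moment" .
qed

text \<open>The descent inequality bounds \<open>f (x' \<omega>)\<close> above by a quadratic in the
  mean estimator and \<open>f0\<close> bounds it below; this gives integrability before the
  expectation is taken.\<close>

lemma descent_step:
  fixes f :: "(nat \<Rightarrow> real) \<Rightarrow> real" and x :: "nat \<Rightarrow> real" and x' :: "'w \<Rightarrow> nat \<Rightarrow> real"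
  assumes S: "smooth_Rp p Lf f" and f: "f \<in> borel_measurable (eucl p)"
    and low: "\<And>y. y \<in> Rp p \<Longrightarrow> f0 \<le> f y"
    and x: "x \<in> Rp p" and x': "\<And>\<omega>. x' \<omega> \<in> Rp p" "\<And>l \<omega>. l < p \<Longrightarrow> x' \<omega> l = x l - \<eta> * mean l \<omega>"
    and Lf: "0 \<le> Lf"
  shows "integrable M (\<lambda>\<omega>. f (x' \<omega>))"
    and "expectation (\<lambda>\<omega>. f (x' \<omega>)) \<le> f x - \<eta> * (\<Sum>l<p. grad p f x l * expectation (mean l))
      + Lf / 2 * \<eta>\<^sup>2 * (\<Sum>l<p. expectation (\<lambda>\<omega>. (mean l \<omega>)\<^sup>2))"
proof -
  let ?b = "\<lambda>\<omega>. f x - \<eta> * (\<Sum>l<p. grad p f x l * mean l \<omega>) + Lf / 2 * \<eta>\<^sup>2 * (\<Sum>l<p. (mean l \<omega>)\<^sup>2)"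
  have le: "f (x' \<omega>) \<le> ?b \<omega>" for \<omega>
  proof -
    have 1: "(\<Sum>l<p. grad p f x l * (x' \<omega> l - x l)) = - \<eta> * (\<Sum>l<p. grad p f x l * mean l \<omega>)"
      unfolding sum_distrib_left by (rule sum.cong) (auto simp: x')
    have 2: "(\<Sum>l<p. (x' \<omega> l - x l)\<^sup>2) = \<eta>\<^sup>2 * (\<Sum>l<p. (mean l \<omega>)\<^sup>2)"
      unfolding sum_distrib_left by (rule sum.cong) (auto simp: x' power_mult_distrib)
    show ?thesis using smooth_Rp_descent[OF S x x'(1), of \<omega>] unfolding 1 2 by simp
  qed
  have i1: "integrable M (\<lambda>\<omega>. \<Sum>l<p. grad p f x l * mean l \<omega>)"
    by (intro Bochner_Integration.integrable_sum integrable_mult_right mean_integrable) auto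
  have i2: "integrable M (\<lambda>\<omega>. \<Sum>l<p. (mean l \<omega>)\<^sup>2)"
    by (intro Bochner_Integration.integrable_sum mean_sq_integrable) auto
  have intb: "integrable M ?b"
    by (intro Bochner_Integration.integrable_add Bochner_Integration.integrable_diff integrable_const
        integrable_mult_right i1 i2)
  have meas: "(\<lambda>\<omega>. f (x' \<omega>)) \<in> borel_measurable M"
  proof -
    have "(\<lambda>\<omega>. \<lambda>l\<in>{..<p}. x l - \<eta> * mean l \<omega>) \<in> M \<rightarrow>\<^sub>M eucl p"
      by (intro measurable_restrict borel_measurable_diff borel_measurable_times borel_measurable_const
          borel_measurable_integrable mean_integrable) auto
    moreover have "(\<lambda>\<omega>. \<lambda>l\<in>{..<p}. x l - \<eta> * mean l \<omega>) = x'"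
      using x' by (fastforce simp: Rp_iff extensional_def fun_eq_iff)
    ultimately show ?thesis using measurable_compose[OF _ f] by metis
  qed
  show int: "integrable M (\<lambda>\<omega>. f (x' \<omega>))"
  proof (rule Bochner_Integration.integrable_bound[OF _ meas])
    show "integrable M (\<lambda>\<omega>. \<bar>f0\<bar> + \<bar>?b \<omega>\<bar>)"
      by (rule Bochner_Integration.integrable_add[OF integrable_const integrable_abs[OF intb]])
    have "\<bar>f (x' \<omega>)\<bar> \<le> \<bar>\<bar>f0\<bar> + \<bar>?b \<omega>\<bar>\<bar>" for \<omega>
      using le[of \<omega>] low[OF x'(1), of \<omega>] by linarith
    then show "AE \<omega> in M. norm (f (x' \<omega>)) \<le> norm (\<bar>f0\<bar> + \<bar>?b \<omega>\<bar>)" by simp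
  qed
  have "expectation (\<lambda>\<omega>. f (x' \<omega>)) \<le> expectation ?b"
    by (rule integral_mono[OF int intb le])
  also have "\<dots> = f x - \<eta> * (\<Sum>l<p. grad p f x l * expectation (mean l))
      + Lf / 2 * \<eta>\<^sup>2 * (\<Sum>l<p. expectation (\<lambda>\<omega>. (mean l \<omega>)\<^sup>2))"
    using i1 i2 by (simp add: prob_space mean_integrable mean_sq_integrable)
  finally show "expectation (\<lambda>\<omega>. f (x' \<omega>)) \<le> f x - \<eta> * (\<Sum>l<p. grad p f x l * expectation (mean l))
      + Lf / 2 * \<eta>\<^sup>2 * (\<Sum>l<p. expectation (\<lambda>\<omega>. (mean l \<omega>)\<^sup>2))" .
qed

end

text \<open>Polarisation writes the inner product through the squares of \<open>v\<close>,
  \<open>m\<close> and \<open>m - v\<close>. The negative square of \<open>m\<close> that appears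
  swallows the quadratic term of the descent inequality as long as
  \<open>\<eta> * Lf \<le> 1\<close>.\<close>

lemma descent_polarization:
  fixes v m :: "nat \<Rightarrow> real"
  assumes "0 \<le> \<eta>" "\<eta> * Lf \<le> 1"
  shows "- \<eta> * (\<Sum>l<p. v l * m l) + Lf / 2 * \<eta>\<^sup>2 * (\<Sum>l<p. (m l)\<^sup>2)
    \<le> - \<eta> / 2 * (\<Sum>l<p. (v l)\<^sup>2) + \<eta> / 2 * (\<Sum>l<p. (m l - v l)\<^sup>2)"
proof -
  define V I K where "V = (\<Sum>l<p. (v l)\<^sup>2)" and "I = (\<Sum>l<p. v l * m l)" and "K = (\<Sum>l<p. (m l)\<^sup>2)"
  have e: "(\<Sum>l<p. (m l - v l)\<^sup>2) = K - 2 * I + V"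
    by (simp add: V_def I_def K_def power2_eq_square algebra_simps sum.distrib sum_subtractf sum_distrib_left)
  have "0 \<le> K" by (simp add: K_def sum_nonneg)
  then have "(\<eta> * Lf) * (\<eta> / 2 * K) \<le> 1 * (\<eta> / 2 * K)"
    using assms by (intro mult_right_mono mult_nonneg_nonneg) auto
  then show ?thesis unfolding e V_def[symmetric] I_def[symmetric] K_def[symmetric]
    by (simp add: power2_eq_square algebra_simps)
qed

section \<open>Summing the recursions\<close>

text \<open>Each term is at most an increment of \<open>2 * sqrt\<close>. The squared smoothing
  parameters are multiples of these terms, so their sum grows like the square root of
  \<open>T\<close>.\<close>

lemma sum_inverse_sqrt_le: "(\<Sum>k<T. 1 / sqrt (real (k + 1))) \<le> 2 * sqrt (real T)"
proof (induction T)
  case (Suc T)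
  have "1 / sqrt (real (T + 1)) \<le> 2 * (sqrt (real (T + 1)) - sqrt (real T))"
  proof -
    let ?a = "sqrt (real (T + 1))" and ?b = "sqrt (real T)"
    have a: "?a > 0" "?b \<le> ?a" "0 \<le> ?b" by auto
    have "1 = (?a - ?b) * (?a + ?b)" by (simp add: algebra_simps)
    also have "\<dots> \<le> (?a - ?b) * (2 * ?a)" using a by (intro mult_left_mono) auto
    finally show ?thesis using a(1) by (simp add: field_simps)
  qed
  then show ?case using Suc by simp
qed simp

lemma telescope_le:
  fixes u v :: "nat \<Rightarrow> real"
  assumes "\<And>k. k < T \<Longrightarrow> u (Suc k) \<le> u k + v k"
  shows "u T \<le> u 0 + (\<Sum>k<T. v k)"
  using assms
proof (induction T)
  case (Suc T)
  have "u (Suc T) \<le> u T + v T" "u T \<le> u 0 + (\<Sum>k<T. v k)" using Suc by auto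
  then show ?case by simp
qed simp

text \<open>The bound on the mean second moment of the gradient estimators, with \<open>N0 = 9 \<sigma>\<^sub>2\<^sup>2 + 3 \<sigma>\<^sub>1\<^sup>2\<close>.
  The nines arise as 3 * 3: a difference quotient is split into gradient, noise and bias, and the
  local gradient into consensus gap, heterogeneity and global gradient.\<close>

definition est_moment :: "real \<Rightarrow> real \<Rightarrow> nat \<Rightarrow> real \<Rightarrow> real \<Rightarrow> real \<Rightarrow> real" where
  "est_moment Lf N0 p d w \<Gamma> = real p * (9 * \<Gamma> + 9 * Lf\<^sup>2 * w + N0 + real p * Lf\<^sup>2 * d\<^sup>2)"

section \<open>Arithmetic of the step size\<close>

locale step_size =
  fixes n p T :: nat and \<eta> \<kappa> :: real and d :: "nat \<Rightarrow> real"
  assumes n: "1 \<le> n" and p: "1 \<le> p" and T_cubic: "real n ^ 3 / real p \<le> real T"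
    and \<eta>_def: "\<eta> = sqrt (real n) / sqrt (real p * real T)"
    and d_def: "\<And>k. d k = \<kappa> / (real p powr (1/4) * real n powr (1/4) * real (k + 1) powr (1/4))"
begin

lemma T: "1 \<le> T"
proof (rule ccontr)
  assume "\<not> 1 \<le> T"
  then have "T = 0" by simp
  then show False using T_cubic n p by (simp add: divide_le_0_iff power_le_zero_eq)
qed

lemma cubic: "real n ^ 3 \<le> real p * real T"
  using T_cubic p by (simp add: divide_le_eq mult.commute)

lemma \<eta>_pos: "0 < \<eta>"
  using n p T by (simp add: \<eta>_def)

lemma \<eta>_sq: "\<eta>\<^sup>2 = real n / (real p * real T)"
  by (simp add: \<eta>_def power_divide)

text \<open>Squared, this is the cubic lower bound on \<open>T\<close>.\<close>

lemma \<eta>_n: "\<eta> * real n \<le> 1"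
proof (rule power2_le_imp_le)
  have "(\<eta> * real n)\<^sup>2 = real n ^ 3 / (real p * real T)"
    unfolding power_mult_distrib \<eta>_sq by (simp add: power2_eq_square power3_eq_cube)
  also have "\<dots> \<le> 1" using cubic n p T by (simp add: divide_le_eq)
  finally show "(\<eta> * real n)\<^sup>2 \<le> 1\<^sup>2" by simp
qed simp

lemma d_sq: "(d k)\<^sup>2 = \<kappa>\<^sup>2 / (sqrt (real p) * sqrt (real n)) * (1 / sqrt (real (k + 1)))"
proof -
  have *: "(x powr (1/4))\<^sup>2 = sqrt x" if "0 < x" for x :: real
    using that by (simp add: powr_half_sqrt[symmetric] power2_eq_square flip: powr_add)
  show ?thesis
    unfolding d_def power_divide power_mult_distrib using n p by (simp add: * del: of_nat_add of_nat_Suc)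
qed

text \<open>The powers of \<open>p\<close>, \<open>n\<close> and \<open>k\<close> in the smoothing
  parameters are balanced so that the accumulated bias is bounded independently of \<open>n\<close>,
  \<open>p\<close> and \<open>T\<close>.\<close>

lemma \<eta>_p_d: "\<eta> * real p * (\<Sum>k<T. (d k)\<^sup>2) \<le> 2 * \<kappa>\<^sup>2"
proof -
  have "(\<Sum>k<T. (d k)\<^sup>2) = \<kappa>\<^sup>2 / (sqrt (real p) * sqrt (real n)) * (\<Sum>k<T. 1 / sqrt (real (k + 1)))"
    unfolding d_sq sum_distrib_left ..
  also have "\<dots> \<le> \<kappa>\<^sup>2 / (sqrt (real p) * sqrt (real n)) * (2 * sqrt (real T))"
    by (intro mult_left_mono sum_inverse_sqrt_le) auto
  finally have "\<eta> * real p * (\<Sum>k<T. (d k)\<^sup>2) \<le>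
      \<eta> * real p * (\<kappa>\<^sup>2 / (sqrt (real p) * sqrt (real n)) * (2 * sqrt (real T)))"
    using \<eta>_pos by (intro mult_left_mono) auto
  also have "real p = sqrt (real p) * sqrt (real p)" by simp
  finally show ?thesis using n p T by (simp add: \<eta>_def real_sqrt_mult)
qed

lemma d_sq_le: "(d k)\<^sup>2 \<le> \<kappa>\<^sup>2"
proof -
  have "1 \<le> sqrt (real p) * sqrt (real n) * sqrt (real (k + 1))"
    using n p by (intro mult_ge1_I) auto
  then show ?thesis unfolding d_sq by (simp add: divide_le_eq mult_le_cancel_left1)
qed

text \<open>Dividing a bound on \<eta> times the gradient sum by \<open>\<eta> * real T\<close> thus
  produces exactly the first rate.\<close>

lemma rate_eq: "\<eta> * real T * (sqrt (real p) / sqrt (real n * real T)) = 1"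
proof -
  have "real T = sqrt (real T) * sqrt (real T)" by simp
  then show ?thesis using n p T by (simp add: \<eta>_def real_sqrt_mult)
qed

end

text \<open>\<open>s\<close> is the margin by which cross terms are to be beaten. It enters squared
  because \<open>\<eta>_T\<close> recovers it through a square root.\<close>

locale large_step_size = step_size +
  fixes s :: real
  assumes s: "1 \<le> s" and T_large: "s\<^sup>2 * real p / real n \<le> real T"
begin

lemma linear: "s\<^sup>2 * real p \<le> real n * real T"
  using T_large n by (simp add: divide_le_eq mult.commute)

text \<open>Multiplying the two lower bounds on \<open>T\<close>, the linear and the cubic one,
  cancels \<open>p\<close> and leaves the square of the claim.\<close>

lemma ratio_le: "s * (real n / real T) \<le> 1"
proof -
  have "s * real n \<le> real T"
  proof (rule power2_le_imp_le)
    have "(s\<^sup>2 * real p) * (real n ^ 3) \<le> (real n * real T) * (real p * real T)"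
      by (intro mult_mono linear cubic) auto
    then have "(s * real n)\<^sup>2 * (real p * real n) \<le> (real T)\<^sup>2 * (real p * real n)"
      by (simp add: power2_eq_square power3_eq_cube algebra_simps)
    then show "(s * real n)\<^sup>2 \<le> (real T)\<^sup>2"
      by (rule mult_right_le_imp_le) (use n p in simp)
  qed simp
  then show ?thesis using T by (simp add: divide_le_eq)
qed

lemma \<eta>_T: "s \<le> \<eta> * real T"
proof (rule power2_le_imp_le)
  have "(\<eta> * real T)\<^sup>2 = real n * real T / real p"
    unfolding power_mult_distrib \<eta>_sq using T by (simp add: power2_eq_square)
  then show "s\<^sup>2 \<le> (\<eta> * real T)\<^sup>2" using linear p by (simp add: le_divide_eq)
qed (use \<eta>_pos in simp)

lemma \<eta>_p: "\<eta> * real p \<le> real n"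
proof (rule power2_le_imp_le)
  have "1 * real p \<le> s\<^sup>2 * real p" using s by (intro mult_right_mono) auto
  then have "real p \<le> real n * real T" using linear by linarith
  then have "real p * real n \<le> (real n)\<^sup>2 * real T" 
    using n by (simp add: power2_eq_square mult.commute mult_left_mono)
  moreover have "(\<eta> * real p)\<^sup>2 = real p * real n / real T"
    unfolding power_mult_distrib \<eta>_sq using p by (simp add: power2_eq_square)
  ultimately show "(\<eta> * real p)\<^sup>2 \<le> (real n)\<^sup>2" using T by (simp add: divide_le_eq)
qed simp

lemma \<eta>_le: "0 \<le> L \<Longrightarrow> L\<^sup>2 \<le> s \<Longrightarrow> \<eta> * L \<le> 1"
proof (rule power2_le_imp_le)
  assume L: "0 \<le> L" "L\<^sup>2 \<le> s"
  have "real n / (real p * real T) \<le> real n / real T"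
    using n p T by (intro divide_left_mono) auto
  then have "(\<eta> * L)\<^sup>2 \<le> real n / real T * s"
    unfolding power_mult_distrib \<eta>_sq using L by (intro mult_mono) auto
  then show "(\<eta> * L)\<^sup>2 \<le> 1\<^sup>2" using ratio_le by (simp add: mult.commute)
qed simp

text \<open>The contraction first gives a total consensus error of at most
  \<open>K1 * (n + \<theta> * G)\<close>, with \<open>G\<close> the gradient sum and \<theta> the
  ratio \<open>n / T\<close>. Inserted into the objective recursion, consensus and variance each
  consume an eighth of \<open>\<eta> * G\<close>; of the half available a quarter remains, whence
  the 4 in front of \<open>K2\<close>.\<close>

lemma recursion_bounds:
  fixes w \<phi> \<Gamma> :: "nat \<Rightarrow> real" and r Lf N0 W0 G0 :: real
  defines "c1 \<equiv> 1 + 2 / r"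
  defines "K1 \<equiv> 2 / r * (W0 + 9 * c1 + c1 * (N0 + 2 * Lf\<^sup>2 * \<kappa>\<^sup>2))"
  defines "K2 \<equiv> G0 + Lf\<^sup>2 * K1 + Lf\<^sup>2 * \<kappa>\<^sup>2 / 2 + Lf / 2 * (9 * Lf\<^sup>2 * K1 + N0 + 2 * Lf\<^sup>2 * \<kappa>\<^sup>2)"
  assumes r: "0 < r" and Lf: "0 < Lf" and N0: "0 \<le> N0"
    and s_bounds: "18 * c1 * Lf\<^sup>2 / r \<le> s" "8 * Lf\<^sup>2 * K1 \<le> s" "4 * Lf * (9 + 9 * Lf\<^sup>2 * K1) \<le> s"
    and init: "w 0 = W0" "\<phi> 0 = G0"
    and nonneg: "\<And>k. 0 \<le> w k" "\<And>k. 0 \<le> \<phi> k" "\<And>k. 0 \<le> \<Gamma> k"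
    and w_step: "\<And>k. k < T \<Longrightarrow>
      w (Suc k) \<le> (1 - r) * w k + c1 * \<eta>\<^sup>2 * est_moment Lf N0 p (d k) (w k) (\<Gamma> k)"
    and \<phi>_step: "\<And>k. k < T \<Longrightarrow> \<phi> (Suc k) \<le> \<phi> k - \<eta> / 2 * \<Gamma> k + \<eta> * Lf\<^sup>2 * w k
      + \<eta> * real p * Lf\<^sup>2 * (d k)\<^sup>2 / 4
      + Lf * \<eta>\<^sup>2 * est_moment Lf N0 p (d k) (w k) (\<Gamma> k) / (2 * real n)"
  shows "(\<Sum>k<T. \<Gamma> k) / real T \<le> 4 * K2 * (sqrt (real p) / sqrt (real n * real T))"
    and "\<phi> T \<le> K2"
    and "(\<Sum>k<T. w k) / real T \<le> K1 * (1 + 4 * K2) * (real n / real T)"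
    and "0 \<le> K1" "0 \<le> K2"
proof -
  define A where "A = (\<Sum>k<T. w k)"
  define G where "G = (\<Sum>k<T. \<Gamma> k)"
  define Q where "Q = (\<Sum>k<T. (d k)\<^sup>2)"
  define \<theta> where "\<theta> = real n / real T"
  define M where "M = N0 + 2 * Lf\<^sup>2 * \<kappa>\<^sup>2"
  define B where "B = \<eta>\<^sup>2 * (\<Sum>k<T. est_moment Lf N0 p (d k) (w k) (\<Gamma> k))"
  have nn: "0 \<le> A" "0 \<le> G" "0 \<le> Q" "0 \<le> M" "0 \<le> \<theta>"
    using nonneg N0 by (auto simp: A_def G_def Q_def M_def \<theta>_def intro!: sum_nonneg)
  have c1: "1 \<le> c1" using r by (simp add: c1_def)
  have W0: "0 \<le> W0" "0 \<le> G0" using nonneg(1,2)[of 0] init by auto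
  show K1: "0 \<le> K1" unfolding K1_def M_def[symmetric] using r W0 c1 nn by simp
  show K2: "0 \<le> K2" unfolding K2_def using Lf K1 W0 N0 by simp
  have s\<theta>: "s * \<theta> \<le> 1" using ratio_le by (simp add: \<theta>_def)
  have \<theta>1: "\<theta> \<le> 1" using s\<theta> s nn(5) mult_right_mono[of 1 s \<theta>] by simp
  have Q: "\<eta> * real p * Q \<le> 2 * \<kappa>\<^sup>2" unfolding Q_def by (rule \<eta>_p_d)
  have small: "u * \<theta> \<le> v" if "u \<le> s * v" "0 < v" for u v
  proof -
    have "u * \<theta> \<le> s * v * \<theta>" using that nn by (intro mult_right_mono) auto
    also have "\<dots> = v * (s * \<theta>)" by simp
    also have "\<dots> \<le> v * 1" using that s\<theta> by (intro mult_left_mono) auto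
    finally show ?thesis by simp
  qed

  \<comment> \<open>Here \<open>\<eta>\<^sup>2 * real p\<close> equals \<theta>. The bias part
    carries an extra \<open>p\<close>, which is shared between \<open>\<eta>_p\<close> and the
    summability of the squared smoothing parameters.\<close>
  have B: "B \<le> 9 * \<theta> * G + 9 * Lf\<^sup>2 * \<theta> * A + real n * M"
  proof -
    have "B = \<eta>\<^sup>2 * real p * (9 * G + 9 * Lf\<^sup>2 * A + real T * N0 + real p * Lf\<^sup>2 * Q)"
      unfolding B_def est_moment_def A_def G_def Q_def sum_distrib_left[symmetric] sum.distrib
      by simp
    also have "\<dots> = \<eta>\<^sup>2 * real p * (9 * G + 9 * Lf\<^sup>2 * A + real T * N0) + (\<eta> * real p) * (\<eta> * real p * Q) * Lf\<^sup>2"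
      by (simp add: power2_eq_square algebra_simps)
    also have "\<eta>\<^sup>2 * real p = \<theta>" using p by (simp add: \<eta>_sq \<theta>_def)
    also have "(\<eta> * real p) * (\<eta> * real p * Q) \<le> real n * (2 * \<kappa>\<^sup>2)"
      using nn \<eta>_pos by (intro mult_mono \<eta>_p Q) auto
    finally have "B \<le> \<theta> * (9 * G + 9 * Lf\<^sup>2 * A + real T * N0) + real n * (2 * \<kappa>\<^sup>2) * Lf\<^sup>2"
      by (simp add: mult_right_mono)
    also have "\<dots> = 9 * \<theta> * G + 9 * Lf\<^sup>2 * \<theta> * A + (\<theta> * real T) * N0 + real n * (2 * \<kappa>\<^sup>2) * Lf\<^sup>2"
      by (simp add: algebra_simps)
    also have "\<theta> * real T = real n" using T by (simp add: \<theta>_def)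
    finally show ?thesis by (simp add: M_def algebra_simps)
  qed

  have "w T \<le> w 0 + (\<Sum>k<T. c1 * \<eta>\<^sup>2 * est_moment Lf N0 p (d k) (w k) (\<Gamma> k) - r * w k)"
    by (rule telescope_le) (use w_step in \<open>force simp: algebra_simps\<close>)
  also have "(\<Sum>k<T. c1 * \<eta>\<^sup>2 * est_moment Lf N0 p (d k) (w k) (\<Gamma> k) - r * w k) = c1 * B - r * A"
    by (simp add: B_def A_def sum_subtractf sum_distrib_left mult.assoc)
  finally have "r * A \<le> W0 + c1 * B" using nonneg(1)[of T] init by simp
  also have "c1 * B \<le> c1 * (9 * \<theta> * G + 9 * Lf\<^sup>2 * \<theta> * A + real n * M)"
    using B c1 by (intro mult_left_mono) auto
  \<comment> \<open>Regrouped so that the consensus error fed back through the second moment is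
    visibly at most half of the contraction gain \<open>r * A\<close>.\<close>
  also have "\<dots> = 9 * c1 * (\<theta> * G) + (18 * c1 * Lf\<^sup>2 / r * \<theta>) * (r / 2 * A) + c1 * M * real n"
    using r by (simp add: field_simps)
  also have "(18 * c1 * Lf\<^sup>2 / r * \<theta>) * (r / 2 * A) \<le> 1 * (r / 2 * A)"
    using s_bounds(1) r nn by (intro mult_right_mono small) auto
  finally have "r / 2 * A \<le> W0 * 1 + 9 * c1 * (\<theta> * G) + c1 * M * real n" by simp
  also have "W0 * 1 \<le> W0 * real n" using W0 n by (intro mult_left_mono) auto
  finally have "r / 2 * A \<le> W0 * real n + 9 * c1 * (\<theta> * G) + c1 * M * real n" by simp
  \<comment> \<open>Both coefficients are enlarged to one constant so that the common factor
    \<open>K1\<close> comes out.\<close>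
  also have "\<dots> \<le> (W0 + 9 * c1 + c1 * M) * real n + (W0 + 9 * c1 + c1 * M) * (\<theta> * G)"
    using W0 c1 nn by (simp add: algebra_simps)
  also have "\<dots> = r / 2 * (K1 * (real n + \<theta> * G))"
    using r by (simp add: K1_def M_def field_simps)
  finally have A: "A \<le> K1 * (real n + \<theta> * G)" using r by simp

  have \<eta>A: "\<eta> * A \<le> K1 + K1 * \<theta> * (\<eta> * G)"
  proof -
    have "\<eta> * A \<le> \<eta> * (K1 * (real n + \<theta> * G))" using A \<eta>_pos by (intro mult_left_mono) auto
    also have "\<dots> = K1 * (\<eta> * real n) + K1 * \<theta> * (\<eta> * G)" by (simp add: algebra_simps)
    also have "K1 * (\<eta> * real n) \<le> K1 * 1" by (intro mult_left_mono \<eta>_n K1)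
    finally show ?thesis by simp
  qed
  have AT: "A / real T \<le> K1 + K1 * (G / real T)"
  proof -
    have "A / real T \<le> K1 * (real n + \<theta> * G) / real T" using A by (intro divide_right_mono) auto
    also have "\<dots> = K1 * \<theta> + K1 * \<theta> * (G / real T)" using T by (simp add: \<theta>_def field_simps)
    also have "\<dots> \<le> K1 * 1 + K1 * 1 * (G / real T)"
      using K1 nn \<theta>1 by (intro add_mono mult_mono) auto
    finally show ?thesis by simp
  qed
  have BT: "B / real n \<le> 9 * (G / real T) + 9 * Lf\<^sup>2 * (A / real T) + M"
  proof -
    have "B / real n \<le> (9 * \<theta> * G + 9 * Lf\<^sup>2 * \<theta> * A + real n * M) / real n"
      using B by (intro divide_right_mono) auto
    also have "\<dots> = 9 * (G / real T) + 9 * Lf\<^sup>2 * (A / real T) + M"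
      using n by (simp add: \<theta>_def field_simps)
    finally show ?thesis .
  qed
  \<comment> \<open>The variance terms carry \<open>G / real T\<close>, the descent gain is
    \<open>\<eta> * G\<close>; the margin \<open>s\<close> separates the two.\<close>
  have GT: "s * (G / real T) \<le> \<eta> * G"
    using mult_right_mono[OF \<eta>_T, of "G / real T"] nn T by simp

  have "\<phi> T \<le> \<phi> 0 + (\<Sum>k<T. \<eta> * Lf\<^sup>2 * w k + \<eta> * real p * Lf\<^sup>2 * (d k)\<^sup>2 / 4
      + Lf * \<eta>\<^sup>2 * est_moment Lf N0 p (d k) (w k) (\<Gamma> k) / (2 * real n) - \<eta> / 2 * \<Gamma> k)"
    by (rule telescope_le) (use \<phi>_step in force)
  also have "(\<Sum>k<T. \<eta> * Lf\<^sup>2 * w k + \<eta> * real p * Lf\<^sup>2 * (d k)\<^sup>2 / 4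
      + Lf * \<eta>\<^sup>2 * est_moment Lf N0 p (d k) (w k) (\<Gamma> k) / (2 * real n) - \<eta> / 2 * \<Gamma> k)
    = Lf\<^sup>2 * (\<eta> * A) + Lf\<^sup>2 / 4 * (\<eta> * real p * Q) + Lf / 2 * (B / real n) - \<eta> / 2 * G"
    by (simp add: A_def B_def Q_def G_def sum_subtractf sum.distrib sum_distrib_left sum_divide_distrib mult_ac)
  finally have "\<phi> T + \<eta> / 2 * G \<le> G0 + Lf\<^sup>2 * (\<eta> * A) + Lf\<^sup>2 / 4 * (\<eta> * real p * Q) + Lf / 2 * (B / real n)"
    using init by simp
  also have "\<dots> \<le> G0 + Lf\<^sup>2 * (K1 + K1 * \<theta> * (\<eta> * G)) + Lf\<^sup>2 / 4 * (2 * \<kappa>\<^sup>2)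
      + Lf / 2 * (9 * (G / real T) + 9 * Lf\<^sup>2 * (K1 + K1 * (G / real T)) + M)"
  proof (intro add_mono mult_left_mono \<eta>A Q order_refl)
    show "B / real n \<le> 9 * (G / real T) + 9 * Lf\<^sup>2 * (K1 + K1 * (G / real T)) + M"
      using BT mult_left_mono[OF AT, of "9 * Lf\<^sup>2"] by simp
  qed (use Lf in auto)
  also have "\<dots> = K2 + (Lf\<^sup>2 * K1 * \<theta>) * (\<eta> * G) + Lf / 2 * (9 + 9 * Lf\<^sup>2 * K1) * (G / real T)"
    by (simp add: K2_def M_def algebra_simps)
  also have "(Lf\<^sup>2 * K1 * \<theta>) * (\<eta> * G) \<le> 1 / 8 * (\<eta> * G)"
    using s_bounds(2) nn \<eta>_pos by (intro mult_right_mono small) auto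
  also have "Lf / 2 * (9 + 9 * Lf\<^sup>2 * K1) * (G / real T) \<le> s / 8 * (G / real T)"
    using s_bounds(3) nn by (intro mult_right_mono) auto
  also have "\<dots> \<le> 1 / 8 * (\<eta> * G)" using GT by simp
  finally have key: "\<phi> T + \<eta> * G / 4 \<le> K2" by (simp add: algebra_simps)
  then show "\<phi> T \<le> K2" using nn \<eta>_pos by (smt (verit) divide_nonneg_pos mult_nonneg_nonneg)
  have "\<eta> * G \<le> 4 * K2" using key nonneg(2)[of T] by simp
  then have "\<eta> * G * (sqrt (real p) / sqrt (real n * real T)) \<le> 4 * K2 * (sqrt (real p) / sqrt (real n * real T))"
    by (intro mult_right_mono) auto
  moreover have "\<eta> * G * (sqrt (real p) / sqrt (real n * real T))
      = (\<eta> * real T * (sqrt (real p) / sqrt (real n * real T))) * (G / real T)"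
    using T by simp
  ultimately show "(\<Sum>k<T. \<Gamma> k) / real T \<le> 4 * K2 * (sqrt (real p) / sqrt (real n * real T))"
    unfolding rate_eq G_def by simp
  \<comment> \<open>Once the average squared gradient is bounded by a constant, the earlier bound on
    \<open>A\<close> closes with the rate \<open>n / T\<close>.\<close>
  have "1 * (G / real T) \<le> s * (G / real T)" using s nn by (intro mult_right_mono) auto
  then have GT4: "G / real T \<le> 4 * K2" using GT \<open>\<eta> * G \<le> 4 * K2\<close> by linarith
  have "A / real T \<le> K1 * (real n + \<theta> * G) / real T" using A by (intro divide_right_mono) auto
  also have "\<dots> = K1 * \<theta> * (1 + G / real T)" using T by (simp add: \<theta>_def field_simps)
  also have "\<dots> \<le> K1 * \<theta> * (1 + 4 * K2)" using K1 nn GT4 by (intro mult_left_mono) auto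
  finally show "(\<Sum>k<T. w k) / real T \<le> K1 * (1 + 4 * K2) * (real n / real T)"
    by (simp add: A_def \<theta>_def mult_ac)
qed

end

context step_size
begin

text \<open>For \<open>T < c p / n\<close> the condition \<open>n\<^sup>3 / p \<le> T\<close> leaves finitely many pairs \<open>(n, T)\<close> for each
  \<open>p\<close>, so crude exponential growth in \<open>T\<close> is good enough.\<close>

lemma crude_recursion_bounds:
  fixes w \<phi> \<Gamma> :: "nat \<Rightarrow> real" and c c1 r Lf N0 W0 G0 :: real
  defines "R \<equiv> 1 + Lf + (c1 + 1 + Lf) * (c * (real p)\<^sup>2 * (real p * (18 * Lf + 9 * Lf\<^sup>2 + N0 + real p * Lf\<^sup>2 * \<kappa>\<^sup>2)))"
  defines "K \<equiv> (1 + 2 * Lf) * (R ^ nat \<lceil>c * real p\<rceil> * (1 + W0 + G0)) * (c * real p + 1)"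
  assumes c: "1 \<le> c" and small: "real T < c * real p / real n"
    and Lf: "0 < Lf" and N0: "0 \<le> N0" and c1: "0 \<le> c1" and r: "0 < r"
    and init: "w 0 = W0" "\<phi> 0 = G0"
    and nonneg: "\<And>k. 0 \<le> w k" "\<And>k. 0 \<le> \<phi> k"
    and \<Gamma>_le: "\<And>k. k \<le> T \<Longrightarrow> \<Gamma> k \<le> 2 * Lf * \<phi> k"
    and w_step: "\<And>k. k < T \<Longrightarrow>
      w (Suc k) \<le> (1 - r) * w k + c1 * \<eta>\<^sup>2 * est_moment Lf N0 p (d k) (w k) (\<Gamma> k)"
    and \<phi>_step: "\<And>k. k < T \<Longrightarrow> \<phi> (Suc k) \<le> \<phi> k + \<Gamma> k / 2
      + (1 + Lf) * \<eta>\<^sup>2 * est_moment Lf N0 p (d k) (w k) (\<Gamma> k) / 2"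
  shows "(\<Sum>k<T. \<Gamma> k) / real T \<le> K * (real n / real T)"
    and "\<phi> T \<le> K"
    and "(\<Sum>k<T. w k) / real T \<le> K * (real n / real T)"
    and "0 \<le> K"
proof -
  define A where "A = real p * (18 * Lf + 9 * Lf\<^sup>2 + N0 + real p * Lf\<^sup>2 * \<kappa>\<^sup>2)"
  have A: "0 \<le> A" using Lf N0 by (simp add: A_def)
  \<comment> \<open>The summand 1 lets the constant terms from \<open>N0\<close> and the bias be
    charged to \<psi>, so the coupled recursion becomes a single geometric one.\<close>
  define \<psi> where "\<psi> k = 1 + w k + \<phi> k" for k
  have R: "R = 1 + Lf + (c1 + 1 + Lf) * (c * (real p)\<^sup>2 * A)" by (simp add: R_def A_def)
  have R1: "1 \<le> R" unfolding R using A c c1 Lf by simp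
  have Tn: "real n * real T < c * real p" using small n by (simp add: less_divide_eq mult.commute)
  have "1 * real T \<le> real n * real T" using n by (intro mult_right_mono) auto
  then have Tp: "real T \<le> c * real p" using Tn by linarith
  \<comment> \<open>Since \<open>T\<close> is at least 1, the smallness of \<open>T\<close> bounds
    \<open>n\<close> as well.\<close>
  have \<eta>_sq_le: "\<eta>\<^sup>2 \<le> c * (real p)\<^sup>2"
  proof -
    have "1 * 1 \<le> real p * real T" using p T by (intro mult_mono) auto
    then have "\<eta>\<^sup>2 \<le> real n"
      unfolding \<eta>_sq using n p T by (simp add: divide_le_eq mult_le_cancel_left1)
    also have "real n * 1 \<le> real n * real T" using T by (intro mult_left_mono) auto
    then have "real n \<le> c * real p" using Tn by simp
    also have "c * real p \<le> c * (real p)\<^sup>2"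
      using c p by (intro mult_left_mono) (auto simp: power2_eq_square)
    finally show ?thesis .
  qed
  have moment: "\<eta>\<^sup>2 * est_moment Lf N0 p (d k) (w k) (\<Gamma> k) \<le> c * (real p)\<^sup>2 * A * \<psi> k" if "k < T" for k
  proof -
    have "9 * \<Gamma> k + 9 * Lf\<^sup>2 * w k + N0 + real p * Lf\<^sup>2 * (d k)\<^sup>2
        \<le> 18 * Lf * \<phi> k + 9 * Lf\<^sup>2 * w k + N0 * 1 + real p * Lf\<^sup>2 * \<kappa>\<^sup>2 * 1"
      using \<Gamma>_le[of k] that mult_left_mono[OF d_sq_le[of k], of "real p * Lf\<^sup>2"] by simp
    also have "\<dots> \<le> 18 * Lf * \<psi> k + 9 * Lf\<^sup>2 * \<psi> k + N0 * \<psi> k + real p * Lf\<^sup>2 * \<kappa>\<^sup>2 * \<psi> k"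
      using nonneg Lf N0 by (intro add_mono mult_left_mono) (auto simp: \<psi>_def)
    also have "\<dots> = (18 * Lf + 9 * Lf\<^sup>2 + N0 + real p * Lf\<^sup>2 * \<kappa>\<^sup>2) * \<psi> k" by (simp add: algebra_simps)
    finally have "est_moment Lf N0 p (d k) (w k) (\<Gamma> k) \<le> A * \<psi> k"
      unfolding est_moment_def A_def mult.assoc by (intro mult_left_mono) auto
    then have "\<eta>\<^sup>2 * est_moment Lf N0 p (d k) (w k) (\<Gamma> k) \<le> \<eta>\<^sup>2 * (A * \<psi> k)"
      by (intro mult_left_mono) auto
    also have "\<dots> \<le> c * (real p)\<^sup>2 * (A * \<psi> k)"
      using \<eta>_sq_le A nonneg by (intro mult_right_mono) (auto simp: \<psi>_def)
    finally show ?thesis by (simp add: mult_ac)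
  qed
  have step: "\<psi> (Suc k) \<le> R * \<psi> k" if "k < T" for k
  proof -
    let ?m = "\<eta>\<^sup>2 * est_moment Lf N0 p (d k) (w k) (\<Gamma> k)" and ?a = "c * (real p)\<^sup>2 * A * \<psi> k"
    have \<psi>: "0 \<le> \<psi> k" "\<phi> k \<le> \<psi> k" using nonneg by (auto simp: \<psi>_def)
    have a: "0 \<le> ?a" using c A \<psi> by simp
    have w: "w (Suc k) \<le> w k + c1 * ?a"
    proof -
      have "(1 - r) * w k \<le> 1 * w k" using r nonneg by (intro mult_right_mono) auto
      then show ?thesis using w_step[OF that] mult_left_mono[OF moment[OF that] c1] by (simp add: mult_ac)
    qed
    have \<phi>: "\<phi> (Suc k) \<le> \<phi> k + Lf * \<psi> k + (1 + Lf) * ?a"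
    proof -
      have "\<Gamma> k / 2 \<le> Lf * \<phi> k" using \<Gamma>_le[of k] that by simp
      also have "\<dots> \<le> Lf * \<psi> k" using Lf \<psi> by (intro mult_left_mono) auto
      finally have "\<Gamma> k / 2 \<le> Lf * \<psi> k" .
      moreover have "(1 + Lf) * ?m \<le> (1 + Lf) * ?a"
        using Lf by (intro mult_left_mono moment that) auto
      moreover have "0 \<le> (1 + Lf) * ?a" using Lf by (intro mult_nonneg_nonneg[OF _ a]) auto
      ultimately show ?thesis using \<phi>_step[OF that] by (simp only: mult.assoc)
    qed
    have "\<psi> (Suc k) \<le> \<psi> k + Lf * \<psi> k + (c1 + (1 + Lf)) * ?a"
      using w \<phi> unfolding \<psi>_def[of "Suc k"] \<psi>_def[of k] by (simp add: algebra_simps)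
    also have "\<dots> = R * \<psi> k" unfolding R by (simp add: algebra_simps)
    finally show ?thesis .
  qed
  have \<psi>_pow: "k \<le> T \<Longrightarrow> \<psi> k \<le> R ^ k * \<psi> 0" for k
  proof (induction k)
    case (Suc k)
    then have "\<psi> (Suc k) \<le> R * \<psi> k" by (intro step) auto
    also have "\<dots> \<le> R * (R ^ k * \<psi> 0)" using Suc R1 by (intro mult_left_mono) auto
    finally show ?case by simp
  qed simp
  define P where "P = R ^ nat \<lceil>c * real p\<rceil> * (1 + W0 + G0)"
  have \<psi>0: "\<psi> 0 = 1 + W0 + G0" "0 \<le> \<psi> 0" using init nonneg[of 0] by (auto simp: \<psi>_def)
  have P: "\<psi> k \<le> P" if "k \<le> T" for k
  proof -
    have "real T \<le> real (nat \<lceil>c * real p\<rceil>)" using Tp by linarith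
    then have "k \<le> nat \<lceil>c * real p\<rceil>" using that by linarith
    then have "R ^ k \<le> R ^ nat \<lceil>c * real p\<rceil>" using R1 by (rule power_increasing)
    then have "R ^ k * \<psi> 0 \<le> P" unfolding P_def \<psi>0(1)[symmetric] using \<psi>0(2) by (rule mult_right_mono)
    then show ?thesis using \<psi>_pow[OF that] by linarith
  qed
  have P0: "0 \<le> P" using P[of 0] \<psi>0 by linarith
  have cp: "0 \<le> c * real p" using c by simp
  \<comment> \<open>The factor \<open>1 + 2 * Lf\<close> covers \<open>w\<close> and the gradient
    bound \<open>2 * Lf * \<phi>\<close> at once; the last factor exceeds \<open>T\<close>, so a sum
    of \<open>T\<close> terms still fits under \<open>K * n\<close>.\<close>
  have Kdef: "K = (1 + 2 * Lf) * P * (c * real p + 1)" by (simp add: K_def P_def)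
  show K0: "0 \<le> K" unfolding Kdef using Lf P0 cp by simp
  have PK: "(1 + 2 * Lf) * P * real T \<le> K * real n"
  proof -
    have "(1 + 2 * Lf) * P * real T \<le> (1 + 2 * Lf) * P * (c * real p + 1)"
      using Tp Lf P0 by (intro mult_left_mono) auto
    also have "\<dots> = K * 1" by (simp add: Kdef)
    also have "\<dots> \<le> K * real n" using K0 n by (intro mult_left_mono) auto
    finally show ?thesis .
  qed
  have LP: "0 \<le> Lf * P" using Lf P0 by simp
  have avg: "(\<Sum>k<T. u k) / real T \<le> K * (real n / real T)"
    if u: "\<And>k. k < T \<Longrightarrow> u k \<le> (1 + 2 * Lf) * P" for u :: "nat \<Rightarrow> real"
  proof -
    have "(\<Sum>k<T. u k) \<le> (\<Sum>k<T. (1 + 2 * Lf) * P)" by (rule sum_mono) (use u in auto)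
    also have "\<dots> \<le> K * real n" using PK by (simp add: mult_ac)
    finally show ?thesis using T by (simp add: divide_right_mono)
  qed
  have \<phi>P: "\<phi> k \<le> P" "w k \<le> P" if "k \<le> T" for k
    using P[OF that] nonneg[of k] by (auto simp: \<psi>_def)
  show "\<phi> T \<le> K"
  proof -
    have "0 \<le> (1 + 2 * Lf) * P * (c * real p)" using Lf P0 cp by simp
    then have "P \<le> K" using LP by (simp add: Kdef algebra_simps)
    then show ?thesis using \<phi>P(1)[of T] by linarith
  qed
  show "(\<Sum>k<T. w k) / real T \<le> K * (real n / real T)"
  proof (rule avg)
    fix k assume "k < T"
    then show "w k \<le> (1 + 2 * Lf) * P" using \<phi>P(2)[of k] LP by (simp add: algebra_simps)
  qed
  show "(\<Sum>k<T. \<Gamma> k) / real T \<le> K * (real n / real T)"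
  proof (rule avg)
    fix k assume "k < T"
    then have "2 * Lf * \<phi> k \<le> 2 * Lf * P" using \<phi>P(1)[of k] Lf by (intro mult_left_mono) auto
    then show "\<Gamma> k \<le> (1 + 2 * Lf) * P" using \<Gamma>_le[of k] \<open>k < T\<close> P0 by (simp add: algebra_simps)
  qed
qed

end

section \<open>The random iteration\<close>

text \<open>Freezes the past \<open>Y\<close> and averages over the fresh \<open>Z\<close>.
  Nonnegativity of \<open>h\<close> makes integrability a consequence of the bound, as an induction
  over the iterations requires.\<close>

lemma (in prob_space) indep_expectation_le:
  fixes h :: "'x \<times> 'x \<Rightarrow> real" and b :: "'x \<Rightarrow> real"
  assumes ind: "indep_var N Y Q Z" and h: "h \<in> borel_measurable (N \<Otimes>\<^sub>M Q)"
    and nonneg: "\<And>y z. y \<in> space N \<Longrightarrow> z \<in> space Q \<Longrightarrow> 0 \<le> h (y, z)"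
    and cond: "\<And>y. y \<in> space N \<Longrightarrow> integrable M (\<lambda>\<omega>. h (y, Z \<omega>))"
      "\<And>y. y \<in> space N \<Longrightarrow> expectation (\<lambda>\<omega>. h (y, Z \<omega>)) \<le> b y"
    and b: "integrable M (\<lambda>\<omega>. b (Y \<omega>))"
  shows "integrable M (\<lambda>\<omega>. h (Y \<omega>, Z \<omega>))"
    and "expectation (\<lambda>\<omega>. h (Y \<omega>, Z \<omega>)) \<le> expectation (\<lambda>\<omega>. b (Y \<omega>))"
proof -
  note [measurable] = h indep_var_rv1[OF ind] indep_var_rv2[OF ind]
  have sp: "Y \<omega> \<in> space N" "Z \<omega> \<in> space Q" if "\<omega> \<in> space M" for \<omega>
    using measurable_space[OF indep_var_rv1[OF ind] that] measurable_space[OF indep_var_rv2[OF ind] that] by auto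
  \<comment> \<open>\<open>b\<close> dominates the expectation of a nonnegative function, so along
    \<open>Y\<close> it is nonnegative even if its formula contains negative terms.\<close>
  have b0: "0 \<le> b (Y \<omega>)" if "\<omega> \<in> space M" for \<omega>
  proof -
    have "0 \<le> expectation (\<lambda>\<omega>'. h (Y \<omega>, Z \<omega>'))"
      by (rule integral_nonneg_AE) (use nonneg sp that in \<open>auto intro!: AE_I2\<close>)
    then show ?thesis using cond(2)[OF sp(1)[OF that]] by linarith
  qed
  interpret Zd: prob_space "distr M Q Z" by (rule prob_space_distr) measurable
  have "(\<integral>\<^sup>+\<omega>. h (Y \<omega>, Z \<omega>) \<partial>M) = (\<integral>\<^sup>+w. h w \<partial>distr M (N \<Otimes>\<^sub>M Q) (\<lambda>\<omega>. (Y \<omega>, Z \<omega>)))"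
    by (subst nn_integral_distr) measurable
  also have "distr M (N \<Otimes>\<^sub>M Q) (\<lambda>\<omega>. (Y \<omega>, Z \<omega>)) = distr M N Y \<Otimes>\<^sub>M distr M Q Z"
    using ind[unfolded indep_var_distribution_eq] by simp
  also have "(\<integral>\<^sup>+w. h w \<partial>(distr M N Y \<Otimes>\<^sub>M distr M Q Z)) = (\<integral>\<^sup>+y. \<integral>\<^sup>+z. h (y, z) \<partial>distr M Q Z \<partial>distr M N Y)"
    by (rule Zd.nn_integral_fst[symmetric]) measurable
  also have "\<dots> = (\<integral>\<^sup>+\<omega>. \<integral>\<^sup>+z. h (Y \<omega>, z) \<partial>distr M Q Z \<partial>M)"
    by (subst nn_integral_distr) measurable
  also have "\<dots> = (\<integral>\<^sup>+\<omega>. \<integral>\<^sup>+\<omega>'. h (Y \<omega>, Z \<omega>') \<partial>M \<partial>M)"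
    by (rule nn_integral_cong, subst nn_integral_distr) (use sp in measurable)
  also have "\<dots> \<le> (\<integral>\<^sup>+\<omega>. ennreal (b (Y \<omega>)) \<partial>M)"
  proof (rule nn_integral_mono)
    fix \<omega> assume \<omega>: "\<omega> \<in> space M"
    have "(\<integral>\<^sup>+\<omega>'. h (Y \<omega>, Z \<omega>') \<partial>M) = ennreal (expectation (\<lambda>\<omega>'. h (Y \<omega>, Z \<omega>')))"
      by (rule nn_integral_eq_integral[OF cond(1)[OF sp(1)[OF \<omega>]]])
        (use nonneg sp \<omega> in \<open>auto intro!: AE_I2\<close>)
    also have "\<dots> \<le> ennreal (b (Y \<omega>))" by (intro ennreal_leI cond(2) sp \<omega>)
    finally show "(\<integral>\<^sup>+\<omega>'. h (Y \<omega>, Z \<omega>') \<partial>M) \<le> ennreal (b (Y \<omega>))" .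
  qed
  also have "\<dots> = ennreal (expectation (\<lambda>\<omega>. b (Y \<omega>)))"
    by (rule nn_integral_eq_integral[OF b]) (use b0 in \<open>auto intro!: AE_I2\<close>)
  finally have le: "(\<integral>\<^sup>+\<omega>. h (Y \<omega>, Z \<omega>) \<partial>M) \<le> ennreal (expectation (\<lambda>\<omega>. b (Y \<omega>)))" .
  have h0: "AE \<omega> in M. 0 \<le> h (Y \<omega>, Z \<omega>)" using nonneg sp by (auto intro!: AE_I2)
  show int: "integrable M (\<lambda>\<omega>. h (Y \<omega>, Z \<omega>))"
    by (rule integrableI_nonneg[OF _ h0]) (use le in \<open>auto intro: le_less_trans\<close>)
  have "ennreal (expectation (\<lambda>\<omega>. h (Y \<omega>, Z \<omega>))) \<le> ennreal (expectation (\<lambda>\<omega>. b (Y \<omega>)))"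
    using le by (subst nn_integral_eq_integral[OF int h0, symmetric])
  moreover have "0 \<le> expectation (\<lambda>\<omega>. b (Y \<omega>))"
    by (rule integral_nonneg_AE) (use b0 in \<open>auto intro!: AE_I2\<close>)
  ultimately show "expectation (\<lambda>\<omega>. h (Y \<omega>, Z \<omega>)) \<le> expectation (\<lambda>\<omega>. b (Y \<omega>))"
    by (simp add: ennreal_le_iff)
qed

lemma consensus_err_cong:
  assumes "\<And>i. i < n \<Longrightarrow> x i = y i"
  shows "consensus_err n p x = consensus_err n p y"
  unfolding consensus_err_eq using assms by (simp cong: sum.cong_simp)

lemma avg_cong:
  assumes "\<And>i. i < n \<Longrightarrow> x i = y i"
  shows "avg n p x = avg n p y"
  unfolding avg_def using assms by (simp cong: sum.cong_simp restrict_cong)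

lemma avg_in_Rp [simp]: "avg n p x \<in> Rp p"
  by (simp add: avg_def)

section \<open>The algorithm as a random process\<close>

locale zoom_setting = prob_space M for M :: "'w measure" +
  fixes n p nc T :: nat and E :: "(nat \<times> nat) set" and a :: "nat \<Rightarrow> nat \<Rightarrow> real"
    and D :: "nat \<Rightarrow> (nat \<Rightarrow> real) measure" and F :: "nat \<Rightarrow> (nat \<Rightarrow> real) \<Rightarrow> (nat \<Rightarrow> real) \<Rightarrow> real"
    and \<xi> :: "nat \<Rightarrow> nat \<Rightarrow> 'w \<Rightarrow> (nat \<Rightarrow> real)" and S :: "nat \<Rightarrow> nat \<Rightarrow> 'w \<Rightarrow> nat set"
    and opt :: estimator and x0 \<delta> :: "nat \<Rightarrow> nat \<Rightarrow> real"
    and \<alpha> \<eta> Lf \<zeta> \<sigma>1 \<sigma>2 :: real and d :: "nat \<Rightarrow> real"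
  assumes n: "1 \<le> n" and nc: "1 \<le> nc" "nc \<le> p"
    and graph: "weighted_graph n E a" "graph_connected n E"
    and losses: "stochastic_losses n p D F"
    and minimizer: "minimizers p (global_obj n D F) \<noteq> {}"
    and smooth: "\<And>i. i < n \<Longrightarrow> AE z in D i. smooth_Rp p Lf (\<lambda>x. F i x z)"
    and \<sigma>1: "\<sigma>1\<^sup>2 = real p * \<zeta>\<^sup>2"
    and noise_integrable: "\<And>i j x. i < n \<Longrightarrow> j < p \<Longrightarrow> x \<in> Rp p \<Longrightarrow>
      integrable (D i) (\<lambda>z. (grad p (\<lambda>y. F i y z) x j - grad p (local_obj D F i) x j)\<^sup>2)"
    and noise_bound: "\<And>i j x. i < n \<Longrightarrow> j < p \<Longrightarrow> x \<in> Rp p \<Longrightarrow>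
      (\<integral>z. (grad p (\<lambda>y. F i y z) x j - grad p (local_obj D F i) x j)\<^sup>2 \<partial>D i) \<le> \<zeta>\<^sup>2"
    and heterogeneity: "\<And>i x. i < n \<Longrightarrow> x \<in> Rp p \<Longrightarrow>
      (vnorm p (vdiff p (grad p (local_obj D F i) x) (grad p (global_obj n D F) x)))\<^sup>2 \<le> \<sigma>2\<^sup>2"
    and samples: "zoom_samples M n p nc D \<xi> S"
    and x0: "\<And>i. i < n \<Longrightarrow> x0 i \<in> Rp p"
    and \<alpha>: "0 < \<alpha>" "\<alpha> < rho2 (laplacian n a) / (2 * rho (laplacian n a * laplacian n a))"
    and \<eta>_pos: "0 < \<eta>" and Lf_pos: "0 < Lf"
    and \<delta>_pos: "\<And>i k. i < n \<Longrightarrow> k < T \<Longrightarrow> 0 < \<delta> i k"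
    and \<delta>_le: "\<And>i k. i < n \<Longrightarrow> k < T \<Longrightarrow> \<delta> i k \<le> d k"
begin

abbreviation "f \<equiv> global_obj n D F"
abbreviation "fs \<equiv> opt_value p f"
abbreviation "U \<equiv> subset_measure p nc"
abbreviation "state_space \<equiv> (\<Pi>\<^sub>M i\<in>{..<n}. eucl p)"
abbreviation "sample_space \<equiv> (\<Pi>\<^sub>M i\<in>{..<n}. D i \<Otimes>\<^sub>M U)"
abbreviation "sample_law \<equiv> (\<lambda>(i, k). D i \<Otimes>\<^sub>M U) :: nat \<times> nat \<Rightarrow> _"
abbreviation "N0 \<equiv> 9 * \<sigma>2\<^sup>2 + 3 * \<sigma>1\<^sup>2"

definition smp :: "nat \<times> nat \<Rightarrow> 'w \<Rightarrow> (nat \<Rightarrow> real) \<times> nat set" where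
  "smp = (\<lambda>(i, k) \<omega>. (\<xi> i k \<omega>, S i k \<omega>))"

lemma n_pos: "0 < n"
  using n by simp

lemma loss: "i < n \<Longrightarrow> stochastic_loss (D i) p Lf (F i)"
  using losses smooth Lf_pos
  unfolding stochastic_losses_def stochastic_loss_def stochastic_loss_axioms_def by auto

lemma mean_loss_eq: "i < n \<Longrightarrow> stochastic_loss.mean_loss (D i) (F i) = local_obj D F i"
  by (simp add: stochastic_loss.mean_loss_def[OF loss] local_obj_def fun_eq_iff)

lemma local_smooth: "i < n \<Longrightarrow> smooth_Rp p Lf (local_obj D F i)"
  using stochastic_loss.mean_loss_smooth[OF loss] by (simp add: mean_loss_eq)

lemma f_eq: "f = (\<lambda>x. (\<Sum>i<n. local_obj D F i x) / real n)"
  by (simp add: global_obj_def fun_eq_iff)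

lemma f_smooth: "smooth_Rp p Lf f"
  unfolding f_eq using Lf_pos by (intro smooth_Rp_average n_pos local_smooth) auto

lemma f_grad: "x \<in> Rp p \<Longrightarrow> l < p \<Longrightarrow> grad p f x l = (\<Sum>i<n. grad p (local_obj D F i) x l) / real n"
  unfolding f_eq by (rule grad_average[OF n_pos local_smooth]) (use Lf_pos in auto)

lemma f_measurable: "f \<in> borel_measurable (eucl p)"
  unfolding f_eq
  using stochastic_loss.mean_loss_measurable[OF loss] by (auto simp: mean_loss_eq)

lemma fs_le:
  assumes "x \<in> Rp p"
  shows "fs \<le> f x"
proof -
  obtain m where "m \<in> Rp p" "\<And>y. y \<in> Rp p \<Longrightarrow> f m \<le> f y"
    using minimizer unfolding minimizers_def by blast
  then have "bdd_below (f ` Rp p)" by (auto simp: bdd_below_def)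
  then show ?thesis unfolding opt_value_def using assms by (auto intro: cInf_lower)
qed

text \<open>One iteration as a map of a state and the fresh samples alone, so that a state can be
  frozen. The two restrictions place the value in \<open>state_space\<close>.\<close>

definition next_state :: "nat \<Rightarrow> (nat \<Rightarrow> nat \<Rightarrow> real) \<times> (nat \<Rightarrow> (nat \<Rightarrow> real) \<times> nat set) \<Rightarrow> nat \<Rightarrow> nat \<Rightarrow> real" where
  "next_state k = (\<lambda>(y, z). \<lambda>i\<in>{..<n}. \<lambda>l\<in>{..<p}. y i l - \<alpha> * (\<Sum>j<n. laplacian n a $$ (i, j) * y j l)
     - \<eta> * grad_est opt p nc (\<lambda>u. F i u (fst (z i))) (\<delta> i k) (snd (z i)) (y i) l)"

text \<open>The iterate as a function of a table of samples rather than of an outcome; restricting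
  the table to earlier times then exposes which samples are used.\<close>

definition iter :: "nat \<Rightarrow> (nat \<times> nat \<Rightarrow> (nat \<Rightarrow> real) \<times> nat set) \<Rightarrow> nat \<Rightarrow> nat \<Rightarrow> real" where
  "iter k w = restrict (zoom opt n p nc (laplacian n a) F \<alpha> \<eta> \<delta> x0
     (\<lambda>i k. fst (w (i, k))) (\<lambda>i k. snd (w (i, k))) k) {..<n}"

lemma iter_0: "iter 0 w = restrict x0 {..<n}"
  by (simp add: iter_def)

lemma iter_Suc: "iter (Suc k) w = next_state k (iter k w, \<lambda>i\<in>{..<n}. w (i, k))"
  by (simp add: iter_def next_state_def Let_def fun_eq_iff restrict_def)

lemma iter_cong:
  "(\<And>i j. i < n \<Longrightarrow> j < k \<Longrightarrow> w (i, j) = w' (i, j)) \<Longrightarrow> iter k w = iter k w'"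
proof (induction k)
  case (Suc k)
  have "(\<lambda>i\<in>{..<n}. w (i, k)) = (\<lambda>i\<in>{..<n}. w' (i, k))"
    using Suc.prems by (intro restrict_ext) auto
  moreover have "iter k w = iter k w'" using Suc by simp
  ultimately show ?case by (simp add: iter_Suc)
qed (simp add: iter_0)

lemma state_component: "i < n \<Longrightarrow> (\<lambda>y. y i) \<in> state_space \<rightarrow>\<^sub>M eucl p"
  by (rule measurable_component_singleton) simp

lemma sample_component: "i < n \<Longrightarrow> (\<lambda>z. z i) \<in> sample_space \<rightarrow>\<^sub>M D i \<Otimes>\<^sub>M U"
  by (rule measurable_component_singleton) simp

lemma sample_law_component: "(i, k) \<in> A \<Longrightarrow> (\<lambda>w. w (i, k)) \<in> PiM A sample_law \<rightarrow>\<^sub>M D i \<Otimes>\<^sub>M U"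
  using measurable_component_singleton[of "(i, k)" A sample_law] by simp

lemma diff_quotient_measurable:
  assumes i: "i < n" and l: "l < p"
  shows "(\<lambda>w. diff_quotient opt (\<lambda>u. F i u (fst (snd w i))) t (fst w i) l)
    \<in> borel_measurable (state_space \<Otimes>\<^sub>M sample_space)"
proof -
  have y: "(\<lambda>w. fst w i) \<in> state_space \<Otimes>\<^sub>M sample_space \<rightarrow>\<^sub>M eucl p"
    by (rule measurable_compose[OF measurable_fst state_component[OF i]])
  have z: "(\<lambda>w. fst (snd w i)) \<in> state_space \<Otimes>\<^sub>M sample_space \<rightarrow>\<^sub>M D i"
    by (rule measurable_compose[OF measurable_compose[OF measurable_snd sample_component[OF i]] measurable_fst])
  have joint: "(\<lambda>(x, z). F i x z) \<in> borel_measurable (eucl p \<Otimes>\<^sub>M D i)"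
    using losses i by (simp add: stochastic_losses_def)
  have F: "(\<lambda>w. F i (fst w i) (fst (snd w i))) \<in> borel_measurable (state_space \<Otimes>\<^sub>M sample_space)"
    using measurable_compose[OF measurable_Pair[OF y z] joint] by simp
  have Fs: "(\<lambda>w. F i ((fst w i)(l := fst w i l + c)) (fst (snd w i))) \<in> borel_measurable (state_space \<Otimes>\<^sub>M sample_space)" for c
    using measurable_compose[OF measurable_Pair[OF measurable_compose[OF y measurable_coord_shift[OF l]] z] joint]
    by simp
  show ?thesis
    using F Fs Fs[of "- t"] by (cases opt) (simp_all, measurable)
qed

lemma space_sample_finite: "z \<in> space (D i \<Otimes>\<^sub>M U) \<Longrightarrow> finite (snd z)"
proof -
  assume "z \<in> space (D i \<Otimes>\<^sub>M U)"
  then have "snd z \<subseteq> {..<p}"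
    by (auto simp: space_pair_measure subset_measure_def space_uniform_count_measure)
  then show ?thesis by (rule finite_subset) simp
qed

text \<open>A sum over a random index set is not visibly measurable. On the sample space the set is
  finite, and the estimator becomes a difference quotient times a membership indicator.\<close>

lemma next_state_measurable: "next_state k \<in> state_space \<Otimes>\<^sub>M sample_space \<rightarrow>\<^sub>M state_space"
proof -
  have coord: "(\<lambda>w. fst w j l) \<in> borel_measurable (state_space \<Otimes>\<^sub>M sample_space)" if "j < n" "l < p" for j l
    by (rule measurable_compose[OF measurable_compose[OF measurable_fst state_component[OF that(1)]]
          measurable_component_singleton]) (use that in auto)
  have mem: "(\<lambda>w. of_bool (l \<in> snd (snd w i)) :: real) \<in> borel_measurable (state_space \<Otimes>\<^sub>M sample_space)"
    if "i < n" for i l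
  proof -
    have "(\<lambda>s. of_bool (l \<in> s) :: real) \<in> borel_measurable U"
      unfolding subset_measure_def by (auto simp: measurable_def sets_uniform_count_measure space_uniform_count_measure)
    from measurable_compose[OF measurable_compose[OF measurable_compose[OF measurable_snd sample_component[OF that]]
        measurable_snd] this]
    show ?thesis .
  qed
  have est: "(\<lambda>w. grad_est opt p nc (\<lambda>u. F i u (fst (snd w i))) t (snd (snd w i)) (fst w i) l)
      \<in> borel_measurable (state_space \<Otimes>\<^sub>M sample_space)" if i: "i < n" and l: "l < p" for i l t
  proof (subst measurable_cong)
    fix w assume "w \<in> space (state_space \<Otimes>\<^sub>M sample_space)"
    then have "snd w \<in> space sample_space" by (simp add: space_pair_measure mem_Times_iff)
    then have "snd w i \<in> space (D i \<Otimes>\<^sub>M U)" by (rule measurable_space[OF sample_component[OF i]])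
    then show "grad_est opt p nc (\<lambda>u. F i u (fst (snd w i))) t (snd (snd w i)) (fst w i) l
      = real p / real nc * (diff_quotient opt (\<lambda>u. F i u (fst (snd w i))) t (fst w i) l * of_bool (l \<in> snd (snd w i)))"
      by (intro grad_est_eq[OF space_sample_finite l])
  next
    show "(\<lambda>w. real p / real nc * (diff_quotient opt (\<lambda>u. F i u (fst (snd w i))) t (fst w i) l * of_bool (l \<in> snd (snd w i))))
      \<in> borel_measurable (state_space \<Otimes>\<^sub>M sample_space)"
      by (intro borel_measurable_times borel_measurable_const diff_quotient_measurable mem i l)
  qed
  show ?thesis
    unfolding next_state_def case_prod_beta
    by (intro measurable_restrict borel_measurable_diff borel_measurable_times borel_measurable_const
        borel_measurable_sum coord est) auto
qed

lemma iter_measurable: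
  "{..<n} \<times> {..<k} \<subseteq> A \<Longrightarrow> iter k \<in> PiM A sample_law \<rightarrow>\<^sub>M state_space"
proof (induction k)
  case 0
  have "restrict x0 {..<n} \<in> space state_space"
    using x0 by (simp add: space_PiM[of "{..<n}"] flip: Rp_def)
  moreover have "iter 0 = (\<lambda>w. restrict x0 {..<n})" by (rule ext) (rule iter_0)
  ultimately show ?case by (simp only: measurable_const)
next
  case (Suc k)
  have "{..<n} \<times> {..<k} \<subseteq> A" using Suc.prems by force
  then have "iter k \<in> PiM A sample_law \<rightarrow>\<^sub>M state_space" by (rule Suc.IH)
  moreover have "(\<lambda>w. \<lambda>i\<in>{..<n}. w (i, k)) \<in> PiM A sample_law \<rightarrow>\<^sub>M sample_space"
  proof (rule measurable_restrict)
    fix i assume "i \<in> {..<n}"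
    then have "(i, k) \<in> A" using Suc.prems by auto
    then show "(\<lambda>w. w (i, k)) \<in> PiM A sample_law \<rightarrow>\<^sub>M D i \<Otimes>\<^sub>M U" by (rule sample_law_component)
  qed
  ultimately show ?case
    unfolding iter_Suc[abs_def] by (intro measurable_compose[OF measurable_Pair next_state_measurable])
qed

text \<open>The iterates of \<open>zoom\<close> cut down to agents below \<open>n\<close>, which
  makes them random elements of \<open>state_space\<close>.\<close>

definition Y :: "nat \<Rightarrow> 'w \<Rightarrow> nat \<Rightarrow> nat \<Rightarrow> real" where
  "Y k \<omega> = iter k (\<lambda>ik. smp ik \<omega>)"

definition fresh :: "nat \<Rightarrow> 'w \<Rightarrow> nat \<Rightarrow> (nat \<Rightarrow> real) \<times> nat set" where
  "fresh k \<omega> = (\<lambda>i\<in>{..<n}. smp (i, k) \<omega>)"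

lemma Y_Suc: "Y (Suc k) \<omega> = next_state k (Y k \<omega>, fresh k \<omega>)"
  by (simp add: Y_def iter_Suc fresh_def)

lemma Y_eq: "i < n \<Longrightarrow> Y k \<omega> i = zoom opt n p nc (laplacian n a) F \<alpha> \<eta> \<delta> x0 (\<lambda>i k. \<xi> i k \<omega>) (\<lambda>i k. S i k \<omega>) k i"
  by (simp add: Y_def iter_def smp_def)

lemma smp_indep: "indep_vars sample_law smp ({..<n} \<times> UNIV)"
  using samples unfolding zoom_samples_def smp_def by auto

lemma smp_distr: "i < n \<Longrightarrow> distr M (D i \<Otimes>\<^sub>M U) (smp (i, k)) = D i \<Otimes>\<^sub>M U"
  using samples unfolding zoom_samples_def smp_def by auto

lemma smp_measurable: "i < n \<Longrightarrow> smp (i, k) \<in> M \<rightarrow>\<^sub>M D i \<Otimes>\<^sub>M U"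
  using smp_indep unfolding indep_vars_def by auto

text \<open>The two blocks of samples have disjoint time indices; \<open>Y k\<close> is a function
  of the first and \<open>fresh k\<close> of the second.\<close>

lemma past_fresh_indep:
  "indep_var (PiM ({..<n} \<times> {..<k}) sample_law) (\<lambda>\<omega>. restrict (\<lambda>ik. smp ik \<omega>) ({..<n} \<times> {..<k}))
    (PiM ({..<n} \<times> {k}) sample_law) (\<lambda>\<omega>. restrict (\<lambda>ik. smp ik \<omega>) ({..<n} \<times> {k}))"
  by (rule indep_var_restrict[OF smp_indep]) auto

lemma Y_past: "Y k \<omega> = iter k (restrict (\<lambda>ik. smp ik \<omega>) ({..<n} \<times> {..<k}))"
  unfolding Y_def by (rule iter_cong) auto

lemma fresh_eq: "fresh k \<omega> = (\<lambda>i\<in>{..<n}. restrict (\<lambda>ik. smp ik \<omega>) ({..<n} \<times> {k}) (i, k))"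
  by (auto simp: fresh_def fun_eq_iff)

lemma Y_measurable: "Y k \<in> M \<rightarrow>\<^sub>M state_space"
  using measurable_compose[OF indep_var_rv1[OF past_fresh_indep] iter_measurable[OF order_refl]]
  by (simp add: Y_past[abs_def])

text \<open>The Markov property in the form used below: a bound that holds at every frozen state
  \<open>y\<close> may be averaged over the law of \<open>Y k\<close>.\<close>

lemma step_expectation_le:
  fixes H b :: "(nat \<Rightarrow> nat \<Rightarrow> real) \<Rightarrow> real"
  assumes H: "H \<in> borel_measurable state_space" and nonneg: "\<And>y. y \<in> space state_space \<Longrightarrow> 0 \<le> H y"
    and int: "\<And>y. y \<in> space state_space \<Longrightarrow> integrable M (\<lambda>\<omega>. H (next_state k (y, fresh k \<omega>)))"
    and le: "\<And>y. y \<in> space state_space \<Longrightarrow> expectation (\<lambda>\<omega>. H (next_state k (y, fresh k \<omega>))) \<le> b y"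
    and b: "integrable M (\<lambda>\<omega>. b (Y k \<omega>))"
  shows "integrable M (\<lambda>\<omega>. H (Y (Suc k) \<omega>))"
    and "expectation (\<lambda>\<omega>. H (Y (Suc k) \<omega>)) \<le> expectation (\<lambda>\<omega>. b (Y k \<omega>))"
proof -
  let ?P = "PiM ({..<n} \<times> {..<k}) sample_law" and ?Q = "PiM ({..<n} \<times> {k}) sample_law"
  define h where "h w = H (next_state k (iter k (fst w), \<lambda>i\<in>{..<n}. snd w (i, k)))" for w
  have v: "(\<lambda>v. \<lambda>i\<in>{..<n}. v (i, k)) \<in> ?Q \<rightarrow>\<^sub>M sample_space"
    by (intro measurable_restrict sample_law_component) auto
  note it = iter_measurable[OF order_refl, of k]
  have nx: "(\<lambda>w. next_state k (iter k (fst w), \<lambda>i\<in>{..<n}. snd w (i, k))) \<in> ?P \<Otimes>\<^sub>M ?Q \<rightarrow>\<^sub>M state_space"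
    by (intro measurable_compose[OF measurable_Pair next_state_measurable]
        measurable_compose[OF measurable_fst it] measurable_compose[OF measurable_snd v])
  have hm: "h \<in> borel_measurable (?P \<Otimes>\<^sub>M ?Q)"
    unfolding h_def by (rule measurable_compose[OF nx H])
  have h0: "0 \<le> h (w, v)" if "w \<in> space ?P" "v \<in> space ?Q" for w v
    using measurable_space[OF nx, of "(w, v)"] that nonneg by (simp add: h_def space_pair_measure)
  have hY: "h (w, restrict (\<lambda>ik. smp ik \<omega>) ({..<n} \<times> {k})) = H (next_state k (iter k w, fresh k \<omega>))" for w \<omega>
    by (simp only: h_def fst_conv snd_conv fresh_eq)
  note res = indep_expectation_le[OF past_fresh_indep hm h0, of "\<lambda>w. b (iter k w)", unfolded hY Y_past[symmetric] Y_Suc[symmetric]]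
  show "integrable M (\<lambda>\<omega>. H (Y (Suc k) \<omega>))"
    by (rule res(1)) (use int le b measurable_space[OF it] in auto)
  show "expectation (\<lambda>\<omega>. H (Y (Suc k) \<omega>)) \<le> expectation (\<lambda>\<omega>. b (Y k \<omega>))"
    by (rule res(2)) (use int le b measurable_space[OF it] in auto)
qed

section \<open>Estimators and one-step bounds at a frozen state\<close>

definition est :: "nat \<Rightarrow> (nat \<Rightarrow> nat \<Rightarrow> real) \<Rightarrow> nat \<Rightarrow> nat \<Rightarrow> 'w \<Rightarrow> real" where
  "est k y i l \<omega> = grad_est opt p nc (\<lambda>u. F i u (fst (smp (i, k) \<omega>))) (\<delta> i k) (snd (smp (i, k) \<omega>)) (y i) l"

lemma state_in_Rp: "y \<in> space state_space \<Longrightarrow> i < n \<Longrightarrow> y i \<in> Rp p"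
  by (auto simp: space_PiM[of "{..<n}"] Rp_def)

context
  fixes k :: nat and y :: "nat \<Rightarrow> nat \<Rightarrow> real"
  assumes k: "k < T" and y: "y \<in> space state_space"
begin

lemma est_moments:
  assumes i: "i < n" and l: "l < p"
  shows "integrable M (est k y i l)" and "integrable M (\<lambda>\<omega>. (est k y i l \<omega>)\<^sup>2)"
    and "\<bar>expectation (est k y i l) - grad p (local_obj D F i) (y i) l\<bar> \<le> Lf / 2 * d k"
    and "expectation (\<lambda>\<omega>. (est k y i l \<omega>)\<^sup>2)
      \<le> real p * (3 * (grad p (local_obj D F i) (y i) l)\<^sup>2 + 3 * \<zeta>\<^sup>2 + Lf\<^sup>2 * (d k)\<^sup>2)"
proof -
  define P where "P = D i \<Otimes>\<^sub>M U"
  define G where "G w = grad_est opt p nc (\<lambda>u. F i u (fst w)) (\<delta> i k) (snd w) (y i) l" for w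
  have est: "est k y i l = (\<lambda>\<omega>. G (smp (i, k) \<omega>))" by (simp add: est_def G_def fun_eq_iff)
  have sm: "smp (i, k) \<in> M \<rightarrow>\<^sub>M P" unfolding P_def by (rule smp_measurable[OF i])
  have sd: "distr M P (smp (i, k)) = P" unfolding P_def by (rule smp_distr[OF i])
  note mom = stochastic_loss.grad_est_moments[OF loss[OF i] state_in_Rp[OF y i] l \<delta>_pos[OF i k],
      unfolded mean_loss_eq[OF i], OF noise_integrable[OF i l state_in_Rp[OF y i]]
        noise_bound[OF i l state_in_Rp[OF y i]] nc, of opt, folded P_def G_def]
  have G: "integrable P G" "integrable P (\<lambda>w. (G w)\<^sup>2)"
    "\<bar>(\<integral>w. G w \<partial>P) - grad p (local_obj D F i) (y i) l\<bar> \<le> Lf / 2 * \<delta> i k"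
    "(\<integral>w. (G w)\<^sup>2 \<partial>P) \<le> real p / real nc * (3 * (grad p (local_obj D F i) (y i) l)\<^sup>2 + 3 * \<zeta>\<^sup>2 + Lf\<^sup>2 * (\<delta> i k)\<^sup>2)"
    using mom by auto
  show "integrable M (est k y i l)" unfolding est using G(1) sm by (intro integrable_distr[OF sm]) (simp add: sd)
  show "integrable M (\<lambda>\<omega>. (est k y i l \<omega>)\<^sup>2)" unfolding est
    using integrable_distr[OF sm, of "\<lambda>w. (G w)\<^sup>2"] G(2) by (simp add: sd)
  have "expectation (est k y i l) = (\<integral>w. G w \<partial>P)"
    unfolding est using integral_distr[OF sm, of G] G(1) by (simp add: sd)
  moreover have "Lf / 2 * \<delta> i k \<le> Lf / 2 * d k" using \<delta>_le[OF i k] Lf_pos by simp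
  ultimately show "\<bar>expectation (est k y i l) - grad p (local_obj D F i) (y i) l\<bar> \<le> Lf / 2 * d k"
    using G(3) by simp
  have "(\<delta> i k)\<^sup>2 \<le> (d k)\<^sup>2" using \<delta>_le[OF i k] \<delta>_pos[OF i k] by (intro power_mono) auto
  have "expectation (\<lambda>\<omega>. (est k y i l \<omega>)\<^sup>2) = (\<integral>w. (G w)\<^sup>2 \<partial>P)"
    unfolding est using integral_distr[OF sm, of "\<lambda>w. (G w)\<^sup>2"] G(2) by (simp add: sd)
  also have "\<dots> \<le> real p / real nc * (3 * (grad p (local_obj D F i) (y i) l)\<^sup>2 + 3 * \<zeta>\<^sup>2 + Lf\<^sup>2 * (\<delta> i k)\<^sup>2)"
    by (rule G(4))
  \<comment> \<open>\<open>p / nc\<close> is at most \<open>p\<close>, and the agents' smoothing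
    parameters are replaced by their common cap \<open>d k\<close>.\<close>
  also have "\<dots> \<le> real p * (3 * (grad p (local_obj D F i) (y i) l)\<^sup>2 + 3 * \<zeta>\<^sup>2 + Lf\<^sup>2 * (d k)\<^sup>2)"
    using nc \<open>(\<delta> i k)\<^sup>2 \<le> (d k)\<^sup>2\<close>
    by (intro mult_mono add_mono mult_left_mono) (auto simp: divide_le_eq mult_le_cancel_left1)
  finally show "expectation (\<lambda>\<omega>. (est k y i l \<omega>)\<^sup>2)
      \<le> real p * (3 * (grad p (local_obj D F i) (y i) l)\<^sup>2 + 3 * \<zeta>\<^sup>2 + Lf\<^sup>2 * (d k)\<^sup>2)" .
qed

lemma est_measurable_sample:
  assumes i: "i < n" and l: "l < p"
  shows "(\<lambda>w. grad_est opt p nc (\<lambda>u. F i u (fst w)) (\<delta> i k) (snd w) (y i) l) \<in> borel_measurable (D i \<Otimes>\<^sub>M U)"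
  using stochastic_loss.grad_est_moments(1)[OF loss[OF i] state_in_Rp[OF y i] l \<delta>_pos[OF i k],
      unfolded mean_loss_eq[OF i], OF noise_integrable[OF i l state_in_Rp[OF y i]]
        noise_bound[OF i l state_in_Rp[OF y i]] nc, of opt]
  by (rule borel_measurable_integrable)

text \<open>With the state fixed, the estimators of two agents read disjoint blocks of the
  independent samples.\<close>

lemma est_uncorrelated:
  assumes i: "i < n" and j: "j < n" and ij: "i \<noteq> j" and l: "l < p"
  shows "expectation (\<lambda>\<omega>. est k y i l \<omega> * est k y j l \<omega>) = expectation (est k y i l) * expectation (est k y j l)"
proof -
  have ind: "indep_var (PiM {(i, k)} sample_law) (\<lambda>\<omega>. restrict (\<lambda>i. smp i \<omega>) {(i, k)})
      (PiM {(j, k)} sample_law) (\<lambda>\<omega>. restrict (\<lambda>i. smp i \<omega>) {(j, k)})"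
    by (rule indep_var_restrict[OF smp_indep]) (use i j ij in auto)
  have comp: "(\<lambda>w. grad_est opt p nc (\<lambda>u. F i u (fst (w (i, k)))) (\<delta> i k) (snd (w (i, k))) (y i) l)
      \<in> borel_measurable (PiM {(i, k)} sample_law)" if "i < n" for i
    by (rule measurable_compose[OF sample_law_component est_measurable_sample[OF that l]]) simp
  have "indep_var borel (est k y i l) borel (est k y j l)"
    using indep_var_compose[OF ind comp[OF i] comp[OF j]] by (simp add: comp_def est_def[abs_def])
  then show ?thesis
    by (rule indep_var_lebesgue_integral) (use i j l est_moments(1) in auto)
qed

interpretation gs: gradient_samples M n p "est k y"
  by unfold_locales (use n_pos est_moments(1,2) est_uncorrelated in auto)

lemma local_grad_gap:
  assumes i: "i < n"
  shows "(\<Sum>l<p. (grad p (local_obj D F i) (y i) l - grad p (local_obj D F i) (avg n p y) l)\<^sup>2)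
    \<le> Lf\<^sup>2 * (vnorm p (vdiff p (y i) (avg n p y)))\<^sup>2"
  using smooth_Rp_lipschitz_sq[OF local_smooth[OF i] _ state_in_Rp[OF y i], of "avg n p y"] Lf_pos
  by (simp add: vnorm_vdiff_sq)

lemma sum_local_gap:
  "(\<Sum>i<n. (vnorm p (vdiff p (y i) (avg n p y)))\<^sup>2) = real n * consensus_err n p y"
  using n_pos by (simp add: consensus_err_def)

text \<open>Adding \<open>\<zeta>\<^sup>2\<close> over the \<open>p\<close> coordinates produces
  \<open>\<sigma>1\<^sup>2\<close>, so the noise enters \<open>N0\<close> without a further factor
  \<open>p\<close>; the bias keeps one.\<close>

lemma second_moment_le:
  "gs.second_moment \<le> est_moment Lf N0 p (d k) (consensus_err n p y) ((vnorm p (grad p f (avg n p y)))\<^sup>2)"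
proof -
  let ?x = "avg n p y"
  let ?\<Gamma> = "(vnorm p (grad p f ?x))\<^sup>2"
  let ?v = "\<lambda>i. (vnorm p (vdiff p (y i) ?x))\<^sup>2"
  have norm: "(\<Sum>l<p. (grad p (local_obj D F i) (y i) l)\<^sup>2) \<le> 3 * (Lf\<^sup>2 * ?v i) + 3 * \<sigma>2\<^sup>2 + 3 * ?\<Gamma>"
    if i: "i < n" for i
  proof -
    let ?a = "\<lambda>l. grad p (local_obj D F i) (y i) l - grad p (local_obj D F i) ?x l"
    let ?b = "\<lambda>l. grad p (local_obj D F i) ?x l - grad p f ?x l"
    let ?c = "\<lambda>l. grad p f ?x l"
    have three: "(a + b + c)\<^sup>2 \<le> 3 * a\<^sup>2 + 3 * b\<^sup>2 + 3 * c\<^sup>2" for a b c :: real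
      using sum_squares_ge_zero[of "a - b" "b - c"] zero_le_square[of "a - c"]
      by (simp add: power2_eq_square algebra_simps)
    have "(\<Sum>l<p. (grad p (local_obj D F i) (y i) l)\<^sup>2) = (\<Sum>l<p. (?a l + ?b l + ?c l)\<^sup>2)"
      by (intro sum.cong refl) simp
    also have "\<dots> \<le> (\<Sum>l<p. 3 * (?a l)\<^sup>2 + 3 * (?b l)\<^sup>2 + 3 * (?c l)\<^sup>2)" by (intro sum_mono three)
    also have "\<dots> = 3 * (\<Sum>l<p. (?a l)\<^sup>2) + 3 * (\<Sum>l<p. (?b l)\<^sup>2) + 3 * (\<Sum>l<p. (?c l)\<^sup>2)"
      by (simp add: sum.distrib sum_distrib_left)
    finally show ?thesis
      using local_grad_gap[OF i] heterogeneity[OF i, of ?x]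
      unfolding vnorm_vdiff_sq vnorm_sq[of p "grad p f ?x"] by simp
  qed
  have "(\<Sum>i<n. \<Sum>l<p. expectation (\<lambda>\<omega>. (est k y i l \<omega>)\<^sup>2))
      \<le> (\<Sum>i<n. real p * (3 * (3 * (Lf\<^sup>2 * ?v i) + 3 * \<sigma>2\<^sup>2 + 3 * ?\<Gamma>) + 3 * \<sigma>1\<^sup>2 + real p * (Lf\<^sup>2 * (d k)\<^sup>2)))"
  proof (rule sum_mono)
    fix i assume "i \<in> {..<n}"
    then have i: "i < n" by simp
    have "(\<Sum>l<p. expectation (\<lambda>\<omega>. (est k y i l \<omega>)\<^sup>2))
        \<le> (\<Sum>l<p. real p * (3 * (grad p (local_obj D F i) (y i) l)\<^sup>2 + 3 * \<zeta>\<^sup>2 + Lf\<^sup>2 * (d k)\<^sup>2))"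
      by (intro sum_mono est_moments(4) i) auto
    also have "\<dots> = real p * (3 * (\<Sum>l<p. (grad p (local_obj D F i) (y i) l)\<^sup>2) + 3 * \<sigma>1\<^sup>2 + real p * (Lf\<^sup>2 * (d k)\<^sup>2))"
      unfolding \<sigma>1 by (simp add: sum.distrib sum_distrib_left[symmetric])
    also have "\<dots> \<le> real p * (3 * (3 * (Lf\<^sup>2 * ?v i) + 3 * \<sigma>2\<^sup>2 + 3 * ?\<Gamma>) + 3 * \<sigma>1\<^sup>2 + real p * (Lf\<^sup>2 * (d k)\<^sup>2))"
      using norm[OF i] by (intro mult_left_mono add_mono) auto
    finally show "(\<Sum>l<p. expectation (\<lambda>\<omega>. (est k y i l \<omega>)\<^sup>2))
      \<le> real p * (3 * (3 * (Lf\<^sup>2 * ?v i) + 3 * \<sigma>2\<^sup>2 + 3 * ?\<Gamma>) + 3 * \<sigma>1\<^sup>2 + real p * (Lf\<^sup>2 * (d k)\<^sup>2))" .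
  qed
  also have "\<dots> = real p * (9 * Lf\<^sup>2 * (\<Sum>i<n. ?v i) + real n * (9 * \<sigma>2\<^sup>2 + 9 * ?\<Gamma> + 3 * \<sigma>1\<^sup>2 + real p * (Lf\<^sup>2 * (d k)\<^sup>2)))"
    unfolding sum_distrib_left[symmetric]
    by (simp add: sum.distrib sum_distrib_left[symmetric] algebra_simps)
  finally have "gs.second_moment \<le> real p * (9 * Lf\<^sup>2 * (\<Sum>i<n. ?v i)
      + real n * (9 * \<sigma>2\<^sup>2 + 9 * ?\<Gamma> + 3 * \<sigma>1\<^sup>2 + real p * (Lf\<^sup>2 * (d k)\<^sup>2))) / real n"
    unfolding gs.second_moment_def by (rule divide_right_mono) simp
  also have "\<dots> = est_moment Lf N0 p (d k) (consensus_err n p y) ?\<Gamma>"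
    unfolding sum_local_gap est_moment_def using n_pos by (simp add: field_simps)
  finally show ?thesis .
qed

text \<open>The local gradients at the common point average exactly to the gradient of
  \<open>f\<close>, so heterogeneity does not enter. What remains is the finite-difference bias and
  the disagreement between agents.\<close>

lemma bias_le:
  "(\<Sum>l<p. (expectation (gs.mean l) - grad p f (avg n p y) l)\<^sup>2)
    \<le> 2 * Lf\<^sup>2 * consensus_err n p y + real p * Lf\<^sup>2 * (d k)\<^sup>2 / 2"
proof -
  let ?x = "avg n p y"
  let ?v = "\<lambda>i. (vnorm p (vdiff p (y i) ?x))\<^sup>2"
  let ?b = "\<lambda>i l. expectation (est k y i l) - grad p (local_obj D F i) (y i) l"
  let ?c = "\<lambda>i l. grad p (local_obj D F i) (y i) l - grad p (local_obj D F i) ?x l"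
  have sq: "(expectation (gs.mean l) - grad p f ?x l)\<^sup>2 \<le> (\<Sum>i<n. 2 * (?b i l)\<^sup>2 + 2 * (?c i l)\<^sup>2) / real n"
    if l: "l < p" for l
  proof -
    have "expectation (gs.mean l) = (\<Sum>i<n. expectation (est k y i l)) / real n"
      unfolding gs.mean_def using l by (simp add: est_moments(1))
    then have "expectation (gs.mean l) - grad p f ?x l = (\<Sum>i<n. ?b i l + ?c i l) / real n"
      using l by (simp add: f_grad sum_subtractf sum.distrib diff_divide_distrib add_divide_distrib)
    then have "(expectation (gs.mean l) - grad p f ?x l)\<^sup>2 = (\<Sum>i<n. ?b i l + ?c i l)\<^sup>2 / (real n)\<^sup>2"
      by (simp add: power_divide)
    also have "\<dots> \<le> (real n * (\<Sum>i<n. (?b i l + ?c i l)\<^sup>2)) / (real n)\<^sup>2"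
      using sq_sum_le[of "\<lambda>i. ?b i l + ?c i l" "{..<n}"] by (intro divide_right_mono) auto
    also have "\<dots> = (\<Sum>i<n. (?b i l + ?c i l)\<^sup>2) / real n" using n_pos by (simp add: power2_eq_square[of "real n"])
    also have "\<dots> \<le> (\<Sum>i<n. 2 * (?b i l)\<^sup>2 + 2 * (?c i l)\<^sup>2) / real n"
    proof (intro divide_right_mono sum_mono)
      fix i
      have "(u + v)\<^sup>2 \<le> 2 * u\<^sup>2 + 2 * v\<^sup>2" for u v :: real
        using zero_le_square[of "u - v"] by (simp add: power2_eq_square algebra_simps)
      then show "(?b i l + ?c i l)\<^sup>2 \<le> 2 * (?b i l)\<^sup>2 + 2 * (?c i l)\<^sup>2" .
    qed simp
    finally show ?thesis .
  qed
  have b: "(?b i l)\<^sup>2 \<le> Lf\<^sup>2 * (d k)\<^sup>2 / 4" if "i < n" "l < p" for i l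
  proof -
    have "\<bar>?b i l\<bar>\<^sup>2 \<le> (Lf / 2 * d k)\<^sup>2" using est_moments(3)[OF that] by (intro power_mono) auto
    then show ?thesis by (simp add: power_mult_distrib power_divide)
  qed
  have "(\<Sum>l<p. (expectation (gs.mean l) - grad p f ?x l)\<^sup>2)
      \<le> (\<Sum>l<p. (\<Sum>i<n. 2 * (?b i l)\<^sup>2 + 2 * (?c i l)\<^sup>2) / real n)"
    by (intro sum_mono sq) auto
  also have "\<dots> = (\<Sum>l<p. \<Sum>i<n. 2 * (?b i l)\<^sup>2 + 2 * (?c i l)\<^sup>2) / real n"
    by (simp only: sum_divide_distrib)
  also have "(\<Sum>l<p. \<Sum>i<n. 2 * (?b i l)\<^sup>2 + 2 * (?c i l)\<^sup>2) = (\<Sum>i<n. \<Sum>l<p. 2 * (?b i l)\<^sup>2 + 2 * (?c i l)\<^sup>2)"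
    by (rule sum.swap)
  also have "\<dots> / real n \<le> (\<Sum>i<n. real p * (Lf\<^sup>2 * (d k)\<^sup>2 / 2) + 2 * (Lf\<^sup>2 * ?v i)) / real n"
  proof (intro divide_right_mono sum_mono)
    fix i assume "i \<in> {..<n}"
    then have i: "i < n" by simp
    have "(\<Sum>l<p. 2 * (?b i l)\<^sup>2) \<le> (\<Sum>l<p. Lf\<^sup>2 * (d k)\<^sup>2 / 2)"
      by (rule sum_mono) (use b[OF i] in force)
    then show "(\<Sum>l<p. 2 * (?b i l)\<^sup>2 + 2 * (?c i l)\<^sup>2) \<le> real p * (Lf\<^sup>2 * (d k)\<^sup>2 / 2) + 2 * (Lf\<^sup>2 * ?v i)"
      unfolding sum.distrib sum_distrib_left[symmetric] using local_grad_gap[OF i] by simp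
  qed simp
  also have "\<dots> = (real n * (real p * (Lf\<^sup>2 * (d k)\<^sup>2 / 2)) + 2 * (Lf\<^sup>2 * (\<Sum>i<n. ?v i))) / real n"
    by (simp add: sum.distrib sum_distrib_left)
  also have "\<dots> = 2 * Lf\<^sup>2 * consensus_err n p y + real p * Lf\<^sup>2 * (d k)\<^sup>2 / 2"
    unfolding sum_local_gap using n_pos by (simp add: field_simps)
  finally show ?thesis .
qed

lemma next_coord:
  assumes "i < n" "l < p"
  shows "next_state k (y, fresh k \<omega>) i l
    = y i l - \<alpha> * mv n (lap n a) (\<lambda>j. y j l) i - \<eta> * est k y i l \<omega>"
  using assms by (simp add: next_state_def fresh_def est_def mv_def laplacian_index)

text \<open>The column sums of the Laplacian are zero, so mixing leaves the average in
  place.\<close>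

lemma next_avg:
  assumes "l < p"
  shows "avg n p (next_state k (y, fresh k \<omega>)) l = avg n p y l - \<eta> * gs.mean l \<omega>"
proof -
  have "(\<Sum>i<n. next_state k (y, fresh k \<omega>) i l)
      = (\<Sum>i<n. y i l) - \<alpha> * (\<Sum>i<n. mv n (lap n a) (\<lambda>j. y j l) i) - \<eta> * (\<Sum>i<n. est k y i l \<omega>)"
    using assms by (simp add: next_coord sum_subtractf sum_distrib_left)
  then show ?thesis
    using assms unfolding sum_mv_lap[OF graph(1)] by (simp add: avg_def gs.mean_def diff_divide_distrib)
qed

abbreviation (input) "W \<equiv> consensus_err n p y"
abbreviation (input) "\<Gamma> \<equiv> (vnorm p (grad p f (avg n p y)))\<^sup>2"
abbreviation (input) "B \<equiv> est_moment Lf N0 p (d k) W \<Gamma>"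

lemma next_consensus:
  defines "r \<equiv> \<alpha> * rho2 (laplacian n a)"
  shows "integrable M (\<lambda>\<omega>. consensus_err n p (next_state k (y, fresh k \<omega>)))"
    and "expectation (\<lambda>\<omega>. consensus_err n p (next_state k (y, fresh k \<omega>)))
      \<le> (1 - r) * W + (1 + 2 / r) * \<eta>\<^sup>2 * B"
proof -
  have step1: "integrable M (\<lambda>\<omega>. consensus_err n p (next_state k (y, fresh k \<omega>)))"
    "expectation (\<lambda>\<omega>. consensus_err n p (next_state k (y, fresh k \<omega>)))
      \<le> (1 - r) * W + (1 + 2 / r) * \<eta>\<^sup>2 * gs.second_moment"
    using gs.consensus_step[OF graph \<alpha>, of "\<lambda>\<omega>. next_state k (y, fresh k \<omega>)" y \<eta>] next_coord
    unfolding r_def by auto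
  show "integrable M (\<lambda>\<omega>. consensus_err n p (next_state k (y, fresh k \<omega>)))" by (rule step1(1))
  have "0 < r" unfolding r_def using mixing_contraction(1)[OF graph n_pos \<alpha>] \<alpha>(1) by simp
  then have "(1 + 2 / r) * \<eta>\<^sup>2 * gs.second_moment \<le> (1 + 2 / r) * \<eta>\<^sup>2 * B"
    by (intro mult_left_mono second_moment_le) auto
  then show "expectation (\<lambda>\<omega>. consensus_err n p (next_state k (y, fresh k \<omega>)))
      \<le> (1 - r) * W + (1 + 2 / r) * \<eta>\<^sup>2 * B"
    using step1(2) by linarith
qed

text \<open>The second claim forgoes descent and holds for every step size, as small
  \<open>T\<close> requires. The third is descent with corrections for bias, consensus error and
  variance.\<close>

lemma next_objective:
  shows "integrable M (\<lambda>\<omega>. f (avg n p (next_state k (y, fresh k \<omega>))))"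
    and "expectation (\<lambda>\<omega>. f (avg n p (next_state k (y, fresh k \<omega>))))
      \<le> f (avg n p y) + \<Gamma> / 2 + (1 + Lf) * \<eta>\<^sup>2 * B / 2"
    and "\<eta> * Lf \<le> 1 \<Longrightarrow> expectation (\<lambda>\<omega>. f (avg n p (next_state k (y, fresh k \<omega>))))
      \<le> f (avg n p y) - \<eta> / 2 * \<Gamma> + \<eta> * Lf\<^sup>2 * W + \<eta> * real p * Lf\<^sup>2 * (d k)\<^sup>2 / 4
        + Lf * \<eta>\<^sup>2 * B / (2 * real n)"
proof -
  let ?x = "avg n p y"
  let ?v = "\<lambda>l. grad p f ?x l" and ?m = "\<lambda>l. expectation (gs.mean l)"
  have \<Gamma>: "\<Gamma> = (\<Sum>l<p. (?v l)\<^sup>2)" by (rule vnorm_sq)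
  have Lf0: "0 \<le> Lf" using Lf_pos by simp
  note step = gs.descent_step[where x = ?x and x' = "\<lambda>\<omega>. avg n p (next_state k (y, fresh k \<omega>))",
      OF f_smooth f_measurable fs_le avg_in_Rp avg_in_Rp next_avg Lf0]
  show "integrable M (\<lambda>\<omega>. f (avg n p (next_state k (y, fresh k \<omega>))))" by (rule step(1))
  let ?s = "\<Sum>l<p. expectation (\<lambda>\<omega>. (gs.mean l \<omega>)\<^sup>2)"
  have L\<eta>: "0 \<le> Lf / 2 * \<eta>\<^sup>2" using Lf_pos by simp
  show "expectation (\<lambda>\<omega>. f (avg n p (next_state k (y, fresh k \<omega>))))
      \<le> f ?x + \<Gamma> / 2 + (1 + Lf) * \<eta>\<^sup>2 * B / 2"
  proof -
    \<comment> \<open>Young's inequality with equal weights, followed by nonnegativity of the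
      variance.\<close>
    have "- \<eta> * (?v l * ?m l) \<le> (?v l)\<^sup>2 / 2 + \<eta>\<^sup>2 * expectation (\<lambda>\<omega>. (gs.mean l \<omega>)\<^sup>2) / 2" if "l < p" for l
    proof -
      have "0 \<le> variance (gs.mean l)" by (rule variance_positive)
      then have "(?m l)\<^sup>2 \<le> expectation (\<lambda>\<omega>. (gs.mean l \<omega>)\<^sup>2)"
        using variance_eq[OF gs.mean_integrable gs.mean_sq_integrable, OF that that] by simp
      then have "\<eta>\<^sup>2 * (?m l)\<^sup>2 \<le> \<eta>\<^sup>2 * expectation (\<lambda>\<omega>. (gs.mean l \<omega>)\<^sup>2)" by (intro mult_left_mono) auto
      moreover have "0 \<le> (?v l + \<eta> * ?m l)\<^sup>2" by simp
      ultimately show ?thesis by (simp add: power2_sum power_mult_distrib algebra_simps)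
    qed
    then have "(\<Sum>l<p. - \<eta> * (?v l * ?m l)) \<le> (\<Sum>l<p. (?v l)\<^sup>2 / 2 + \<eta>\<^sup>2 * expectation (\<lambda>\<omega>. (gs.mean l \<omega>)\<^sup>2) / 2)"
      by (intro sum_mono) auto
    then have 1: "- \<eta> * (\<Sum>l<p. ?v l * ?m l) \<le> \<Gamma> / 2 + \<eta>\<^sup>2 * ?s / 2"
      unfolding \<Gamma> by (simp only: sum_distrib_left sum_divide_distrib sum.distrib)
    have "(1 + Lf) * \<eta>\<^sup>2 / 2 * ?s \<le> (1 + Lf) * \<eta>\<^sup>2 / 2 * B"
      using gs.mean_sq_sum_crude second_moment_le Lf_pos by (intro mult_left_mono) auto
    then have "\<eta>\<^sup>2 * ?s / 2 + Lf / 2 * \<eta>\<^sup>2 * ?s \<le> (1 + Lf) * \<eta>\<^sup>2 * B / 2"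
      by (simp add: algebra_simps)
    then show ?thesis using step(2) 1 by linarith
  qed
  assume small: "\<eta> * Lf \<le> 1"
  have "?s \<le> (\<Sum>l<p. (?m l)\<^sup>2) + B / real n"
    using gs.mean_sq_sum_le divide_right_mono[OF second_moment_le, of "real n"] by simp
  then have "Lf / 2 * \<eta>\<^sup>2 * ?s \<le> Lf / 2 * \<eta>\<^sup>2 * ((\<Sum>l<p. (?m l)\<^sup>2) + B / real n)"
    by (intro mult_left_mono L\<eta>)
  also have "\<dots> = Lf / 2 * \<eta>\<^sup>2 * (\<Sum>l<p. (?m l)\<^sup>2) + Lf * \<eta>\<^sup>2 * B / (2 * real n)"
    by (simp add: distrib_left)
  finally have "expectation (\<lambda>\<omega>. f (avg n p (next_state k (y, fresh k \<omega>))))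
      \<le> f ?x + (- \<eta> * (\<Sum>l<p. ?v l * ?m l) + Lf / 2 * \<eta>\<^sup>2 * (\<Sum>l<p. (?m l)\<^sup>2)) + Lf * \<eta>\<^sup>2 * B / (2 * real n)"
    using step(2) by simp
  also have "\<dots> \<le> f ?x + (- \<eta> / 2 * \<Gamma> + \<eta> / 2 * (2 * Lf\<^sup>2 * W + real p * Lf\<^sup>2 * (d k)\<^sup>2 / 2))
      + Lf * \<eta>\<^sup>2 * B / (2 * real n)"
  proof -
    have "\<eta> / 2 * (\<Sum>l<p. (?m l - ?v l)\<^sup>2) \<le> \<eta> / 2 * (2 * Lf\<^sup>2 * W + real p * Lf\<^sup>2 * (d k)\<^sup>2 / 2)"
      using \<eta>_pos by (intro mult_left_mono bias_le) auto
    then show ?thesis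
      using descent_polarization[of \<eta> Lf ?v ?m p] \<eta>_pos small unfolding \<Gamma> by linarith
  qed
  finally show "expectation (\<lambda>\<omega>. f (avg n p (next_state k (y, fresh k \<omega>))))
      \<le> f ?x - \<eta> / 2 * \<Gamma> + \<eta> * Lf\<^sup>2 * W + \<eta> * real p * Lf\<^sup>2 * (d k)\<^sup>2 / 4 + Lf * \<eta>\<^sup>2 * B / (2 * real n)"
    by (simp add: algebra_simps)
qed

end

end

section \<open>The convergence theorem\<close>

context zoom_setting
begin

section \<open>Recursions for the expected errors\<close>

definition gap :: "(nat \<Rightarrow> nat \<Rightarrow> real) \<Rightarrow> real" where
  "gap y = f (avg n p y) - fs"

definition grad_sq :: "(nat \<Rightarrow> nat \<Rightarrow> real) \<Rightarrow> real" where
  "grad_sq y = (vnorm p (grad p f (avg n p y)))\<^sup>2"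

lemma gap_nonneg: "0 \<le> gap y"
  using fs_le[OF avg_in_Rp] by (simp add: gap_def)

lemma grad_sq_le_gap: "grad_sq y \<le> 2 * Lf * gap y"
  unfolding grad_sq_def gap_def
  by (rule smooth_Rp_grad_bound[OF f_smooth avg_in_Rp Lf_pos fs_le])

lemma state_coordinate: "i < n \<Longrightarrow> l < p \<Longrightarrow> (\<lambda>y. y i l) \<in> borel_measurable state_space"
  by (rule measurable_compose[OF state_component measurable_component_singleton]) auto

lemma avg_measurable: "avg n p \<in> state_space \<rightarrow>\<^sub>M eucl p"
  unfolding avg_def
  by (intro measurable_restrict borel_measurable_divide borel_measurable_sum borel_measurable_const
      state_coordinate) auto

lemma consensus_measurable: "consensus_err n p \<in> borel_measurable state_space"
  unfolding consensus_err_eq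
  by (intro borel_measurable_divide borel_measurable_sum borel_measurable_power borel_measurable_diff
      borel_measurable_const state_coordinate) auto

lemma gap_measurable: "gap \<in> borel_measurable state_space"
  unfolding gap_def
  by (intro borel_measurable_diff borel_measurable_const measurable_compose[OF avg_measurable f_measurable])

lemma grad_sq_measurable: "grad_sq \<in> borel_measurable state_space"
  unfolding grad_sq_def vnorm_sq
  by (intro borel_measurable_sum borel_measurable_power
      measurable_compose[OF avg_measurable smooth_Rp_grad_measurable[OF f_smooth f_measurable]]) auto

text \<open>The gap dominates the squared gradient, so only the gap has to be carried through the
  induction.\<close>

lemma grad_sq_integrable:
  assumes "integrable M (\<lambda>\<omega>. gap (Y k \<omega>))"
  shows "integrable M (\<lambda>\<omega>. grad_sq (Y k \<omega>))"
proof (rule Bochner_Integration.integrable_bound)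
  show "integrable M (\<lambda>\<omega>. 2 * Lf * gap (Y k \<omega>))" using assms by simp
  show "(\<lambda>\<omega>. grad_sq (Y k \<omega>)) \<in> borel_measurable M"
    by (rule measurable_compose[OF Y_measurable grad_sq_measurable])
  have "\<bar>grad_sq y\<bar> \<le> \<bar>2 * Lf * gap y\<bar>" for y
    using grad_sq_le_gap[of y] by (simp add: grad_sq_def)
  then show "AE \<omega> in M. norm (grad_sq (Y k \<omega>)) \<le> norm (2 * Lf * gap (Y k \<omega>))" by simp
qed

abbreviation "moment k y \<equiv> est_moment Lf N0 p (d k) (consensus_err n p y) (grad_sq y)"

definition w :: "nat \<Rightarrow> real" where "w k = expectation (\<lambda>\<omega>. consensus_err n p (Y k \<omega>))"
definition \<phi> :: "nat \<Rightarrow> real" where "\<phi> k = expectation (\<lambda>\<omega>. gap (Y k \<omega>))"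
definition \<gamma> :: "nat \<Rightarrow> real" where "\<gamma> k = expectation (\<lambda>\<omega>. grad_sq (Y k \<omega>))"

text \<open>\<open>est_moment\<close> is affine in the consensus error and the squared gradient, so
  the expectation passes inside without loss.\<close>

lemma
  assumes W: "integrable M (\<lambda>\<omega>. consensus_err n p (Y k \<omega>))" and \<Phi>: "integrable M (\<lambda>\<omega>. gap (Y k \<omega>))"
  shows moment_integrable: "integrable M (\<lambda>\<omega>. moment k (Y k \<omega>))"
    and expectation_moment: "expectation (\<lambda>\<omega>. moment k (Y k \<omega>)) = est_moment Lf N0 p (d k) (w k) (\<gamma> k)"
  unfolding est_moment_def w_def \<gamma>_def using W grad_sq_integrable[OF \<Phi>] by (simp_all add: prob_space)

lemma one_step:
  assumes k: "k < T" and W: "integrable M (\<lambda>\<omega>. consensus_err n p (Y k \<omega>))"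
    and \<Phi>: "integrable M (\<lambda>\<omega>. gap (Y k \<omega>))"
  defines "r \<equiv> \<alpha> * rho2 (laplacian n a)"
  shows "integrable M (\<lambda>\<omega>. consensus_err n p (Y (Suc k) \<omega>))"
    and "integrable M (\<lambda>\<omega>. gap (Y (Suc k) \<omega>))"
    and "w (Suc k) \<le> (1 - r) * w k + (1 + 2 / r) * \<eta>\<^sup>2 * est_moment Lf N0 p (d k) (w k) (\<gamma> k)"
    and "\<phi> (Suc k) \<le> \<phi> k + \<gamma> k / 2 + (1 + Lf) * \<eta>\<^sup>2 * est_moment Lf N0 p (d k) (w k) (\<gamma> k) / 2"
    and "\<eta> * Lf \<le> 1 \<Longrightarrow> \<phi> (Suc k) \<le> \<phi> k - \<eta> / 2 * \<gamma> k + \<eta> * Lf\<^sup>2 * w k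
      + \<eta> * real p * Lf\<^sup>2 * (d k)\<^sup>2 / 4
      + Lf * \<eta>\<^sup>2 * est_moment Lf N0 p (d k) (w k) (\<gamma> k) / (2 * real n)"
proof -
  note G = grad_sq_integrable[OF \<Phi>] and B = moment_integrable[OF W \<Phi>]
  note EB = expectation_moment[OF W \<Phi>]
  let ?bw = "\<lambda>y. (1 - r) * consensus_err n p y + (1 + 2 / r) * \<eta>\<^sup>2 * moment k y"
  have bw: "integrable M (\<lambda>\<omega>. ?bw (Y k \<omega>))"
    by (intro Bochner_Integration.integrable_add integrable_mult_right W B)
  note sw = step_expectation_le[OF consensus_measurable consensus_err_nonneg
      next_consensus(1)[OF k] next_consensus(2)[OF k, folded r_def grad_sq_def] bw]
  show "integrable M (\<lambda>\<omega>. consensus_err n p (Y (Suc k) \<omega>))" by (rule sw(1))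
  show "w (Suc k) \<le> (1 - r) * w k + (1 + 2 / r) * \<eta>\<^sup>2 * est_moment Lf N0 p (d k) (w k) (\<gamma> k)"
    using sw(2) W B by (simp add: w_def EB)
  have int: "integrable M (\<lambda>\<omega>. gap (next_state k (y, fresh k \<omega>)))" if "y \<in> space state_space" for y
    using next_objective(1)[OF k that] by (simp add: gap_def)
  have E: "expectation (\<lambda>\<omega>. gap (next_state k (y, fresh k \<omega>)))
      = expectation (\<lambda>\<omega>. f (avg n p (next_state k (y, fresh k \<omega>)))) - fs" if "y \<in> space state_space" for y
    using next_objective(1)[OF k that] by (simp add: gap_def prob_space)
  let ?bc = "\<lambda>y. gap y + grad_sq y / 2 + (1 + Lf) * \<eta>\<^sup>2 * moment k y / 2"
  have bc: "integrable M (\<lambda>\<omega>. ?bc (Y k \<omega>))"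
    by (intro Bochner_Integration.integrable_add integrable_divide integrable_mult_right \<Phi> G B)
  have lec: "expectation (\<lambda>\<omega>. gap (next_state k (y, fresh k \<omega>))) \<le> ?bc y" if "y \<in> space state_space" for y
    using next_objective(2)[OF k that, folded grad_sq_def] unfolding E[OF that] gap_def[of y] by linarith
  note sc = step_expectation_le[OF gap_measurable gap_nonneg int lec bc]
  show "integrable M (\<lambda>\<omega>. gap (Y (Suc k) \<omega>))" by (rule sc(1))
  show "\<phi> (Suc k) \<le> \<phi> k + \<gamma> k / 2 + (1 + Lf) * \<eta>\<^sup>2 * est_moment Lf N0 p (d k) (w k) (\<gamma> k) / 2"
    using sc(2) \<Phi> G B by (simp add: \<phi>_def \<gamma>_def EB)
  assume small: "\<eta> * Lf \<le> 1"
  let ?bf = "\<lambda>y. gap y - \<eta> / 2 * grad_sq y + \<eta> * Lf\<^sup>2 * consensus_err n p y + \<eta> * real p * Lf\<^sup>2 * (d k)\<^sup>2 / 4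
      + Lf * \<eta>\<^sup>2 * moment k y / (2 * real n)"
  have bf: "integrable M (\<lambda>\<omega>. ?bf (Y k \<omega>))"
    by (intro Bochner_Integration.integrable_add Bochner_Integration.integrable_diff integrable_divide
        integrable_mult_right integrable_const \<Phi> G B W)
  have lef: "expectation (\<lambda>\<omega>. gap (next_state k (y, fresh k \<omega>))) \<le> ?bf y" if "y \<in> space state_space" for y
    using next_objective(3)[OF k that small, folded grad_sq_def] unfolding E[OF that] gap_def[of y] by linarith
  have "expectation (\<lambda>\<omega>. ?bf (Y k \<omega>)) = \<phi> k - \<eta> / 2 * \<gamma> k + \<eta> * Lf\<^sup>2 * w k
      + \<eta> * real p * Lf\<^sup>2 * (d k)\<^sup>2 / 4
      + Lf * \<eta>\<^sup>2 * est_moment Lf N0 p (d k) (w k) (\<gamma> k) / (2 * real n)"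
    using \<Phi> G B W by (simp add: \<phi>_def \<gamma>_def w_def EB prob_space)
  then show "\<phi> (Suc k) \<le> \<phi> k - \<eta> / 2 * \<gamma> k + \<eta> * Lf\<^sup>2 * w k
      + \<eta> * real p * Lf\<^sup>2 * (d k)\<^sup>2 / 4
      + Lf * \<eta>\<^sup>2 * est_moment Lf N0 p (d k) (w k) (\<gamma> k) / (2 * real n)"
    using step_expectation_le(2)[OF gap_measurable gap_nonneg int lef bf] by (simp add: \<phi>_def)
qed

lemma Y_0: "Y 0 \<omega> = restrict x0 {..<n}"
  by (simp add: Y_def iter_0)

text \<open>The two integrability claims must travel together, since each one-step bound involves
  both quantities.\<close>

lemma iterates_integrable:
  "k \<le> T \<Longrightarrow> integrable M (\<lambda>\<omega>. consensus_err n p (Y k \<omega>)) \<and> integrable M (\<lambda>\<omega>. gap (Y k \<omega>))"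
proof (induction k)
  case 0 then show ?case by (simp add: Y_0)
next
  case (Suc k) then show ?case using one_step(1,2)[of k] by auto
qed

lemma initial_values: "w 0 = consensus_err n p x0" "\<phi> 0 = f (avg n p x0) - fs"
proof -
  have "consensus_err n p (restrict x0 {..<n}) = consensus_err n p x0" by (rule consensus_err_cong) simp
  then show "w 0 = consensus_err n p x0" by (simp add: w_def Y_0 prob_space)
  have "avg n p (restrict x0 {..<n}) = avg n p x0" by (rule avg_cong) simp
  then show "\<phi> 0 = f (avg n p x0) - fs" by (simp add: \<phi>_def Y_0 gap_def prob_space)
qed

lemma w_nonneg: "0 \<le> w k"
  unfolding w_def by (rule integral_nonneg_AE) (auto intro: consensus_err_nonneg)

lemma \<phi>_nonneg: "0 \<le> \<phi> k"
  unfolding \<phi>_def by (rule integral_nonneg_AE) (auto intro: gap_nonneg)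

lemma \<gamma>_nonneg: "0 \<le> \<gamma> k"
  unfolding \<gamma>_def by (rule integral_nonneg_AE) (auto simp: grad_sq_def)

lemma \<gamma>_le_\<phi>:
  assumes "k \<le> T"
  shows "\<gamma> k \<le> 2 * Lf * \<phi> k"
proof -
  have \<Phi>: "integrable M (\<lambda>\<omega>. gap (Y k \<omega>))" using iterates_integrable[OF assms] by simp
  have "\<gamma> k \<le> expectation (\<lambda>\<omega>. 2 * Lf * gap (Y k \<omega>))"
    unfolding \<gamma>_def by (rule integral_mono[OF grad_sq_integrable[OF \<Phi>] _ grad_sq_le_gap]) (use \<Phi> in simp)
  then show ?thesis by (simp add: \<phi>_def)
qed

abbreviation "X k \<omega> \<equiv> zoom opt n p nc (laplacian n a) F \<alpha> \<eta> \<delta> x0 (\<lambda>i k. \<xi> i k \<omega>) (\<lambda>i k. S i k \<omega>) k"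

lemma consensus_X: "consensus_err n p (X k \<omega>) = consensus_err n p (Y k \<omega>)"
  by (rule consensus_err_cong) (simp add: Y_eq)

lemma avg_X: "avg n p (X k \<omega>) = avg n p (Y k \<omega>)"
  by (rule avg_cong) (simp add: Y_eq)

text \<open>\<open>zoom\<close> and \<open>Y\<close> agree on every agent that the average and the
  consensus error read, so bounds for the three scalar sequences transfer.\<close>

lemma conclusion:
  assumes \<gamma>_bound: "(\<Sum>k<T. \<gamma> k) / real T \<le> b1"
    and \<phi>_bound: "\<phi> T \<le> b2" and w_bound: "(\<Sum>k<T. w k) / real T \<le> b3"
  shows "(\<forall>k<T. integrable M (\<lambda>\<omega>. (vnorm p (grad p f (avg n p (X k \<omega>))))\<^sup>2)) \<and>
      (\<Sum>k<T. \<integral>\<omega>. (vnorm p (grad p f (avg n p (X k \<omega>))))\<^sup>2 \<partial>M) / real T \<le> b1 \<and>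
      integrable M (\<lambda>\<omega>. f (avg n p (X T \<omega>))) \<and>
      (\<integral>\<omega>. f (avg n p (X T \<omega>)) \<partial>M) - fs \<le> b2 \<and>
      (\<forall>k<T. integrable M (\<lambda>\<omega>. consensus_err n p (X k \<omega>))) \<and>
      (\<Sum>k<T. \<integral>\<omega>. consensus_err n p (X k \<omega>) \<partial>M) / real T \<le> b3"
proof -
  have \<Phi>: "integrable M (\<lambda>\<omega>. gap (Y k \<omega>))" if "k \<le> T" for k using iterates_integrable[OF that] by simp
  have "integrable M (\<lambda>\<omega>. gap (Y T \<omega>) + fs)" using \<Phi>[of T] by simp
  then have fT: "integrable M (\<lambda>\<omega>. f (avg n p (Y T \<omega>)))" by (simp add: gap_def)
  then have "\<phi> T = expectation (\<lambda>\<omega>. f (avg n p (Y T \<omega>))) - fs" by (simp add: \<phi>_def gap_def prob_space)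
  then show ?thesis
    using fT \<phi>_bound \<gamma>_bound w_bound grad_sq_integrable[OF \<Phi>] iterates_integrable
    unfolding avg_X consensus_X \<gamma>_def w_def grad_sq_def by auto
qed

end

text \<open>The quantities on which the constants may depend are fixed first; \<open>n\<close>,
  \<open>p\<close>, \<open>T\<close>, the graph, the losses and the probability space come after
  \<open>C\<close>, \<open>c\<close> and \<open>Cp\<close>. From the threshold c p / n on the
  constant is uniform, below it it may depend on \<open>p\<close>. Integrability is part of the
  claim because the integral of a non-integrable function is 0, which would make the bounds
  empty.\<close>

theorem theorem1:
  fixes Lf \<sigma>1 \<sigma>2 \<kappa> \<alpha> \<rho>L \<rho>2L \<rho>LL W0 G0 :: real and nc :: nat
  assumes "Lf > 0" and "\<kappa> > 0"
  shows
   "\<exists>(C::real) (c::real) (Cp :: nat \<Rightarrow> real).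
    \<forall>(n::nat) (p::nat) (T::nat) (\<zeta>::real) (E :: (nat \<times> nat) set) (a :: nat \<Rightarrow> nat \<Rightarrow> real)
      (D :: nat \<Rightarrow> (nat \<Rightarrow> real) measure)
      (F :: nat \<Rightarrow> (nat \<Rightarrow> real) \<Rightarrow> (nat \<Rightarrow> real) \<Rightarrow> real)
      (M :: 'w measure)
      (\<xi> :: nat \<Rightarrow> nat \<Rightarrow> 'w \<Rightarrow> (nat \<Rightarrow> real)) (S :: nat \<Rightarrow> nat \<Rightarrow> 'w \<Rightarrow> nat set)
      (opt :: estimator) (x0 :: nat \<Rightarrow> nat \<Rightarrow> real) (\<delta> :: nat \<Rightarrow> nat \<Rightarrow> real) (\<eta>::real).
      let L = laplacian n a;
          f = global_obj n D F;
          fs = opt_value p f;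
          X = (\<lambda>k \<omega>. zoom opt n p nc L F \<alpha> \<eta> \<delta> x0
                 (\<lambda>i k. \<xi> i k \<omega>) (\<lambda>i k. S i k \<omega>) k);
          K = (if real T \<ge> c * real p / real n then C else Cp p)
      in
      1 \<le> n \<longrightarrow> 1 \<le> nc \<longrightarrow> nc \<le> p \<longrightarrow>
      weighted_graph n E a \<longrightarrow> graph_connected n E \<longrightarrow>
      rho L = \<rho>L \<longrightarrow> rho2 L = \<rho>2L \<longrightarrow> rho (L * L) = \<rho>LL \<longrightarrow>
      stochastic_losses n p D F \<longrightarrow>
      minimizers p f \<noteq> {} \<longrightarrow>
      (\<forall>i<n. AE z in D i. smooth_Rp p Lf (\<lambda>x. F i x z)) \<longrightarrow>
      \<sigma>1\<^sup>2 = real p * \<zeta>\<^sup>2 \<longrightarrow>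
      (\<forall>i<n. \<forall>j<p. \<forall>x\<in>Rp p.
         integrable (D i) (\<lambda>z. (grad p (\<lambda>y. F i y z) x j - grad p (local_obj D F i) x j)\<^sup>2) \<and>
         (\<integral>z. (grad p (\<lambda>y. F i y z) x j - grad p (local_obj D F i) x j)\<^sup>2 \<partial>D i) \<le> \<zeta>\<^sup>2) \<longrightarrow>
      (\<forall>i<n. \<forall>x\<in>Rp p.
         (vnorm p (vdiff p (grad p (local_obj D F i) x) (grad p f x)))\<^sup>2 \<le> \<sigma>2\<^sup>2) \<longrightarrow>
      prob_space M \<longrightarrow> zoom_samples M n p nc D \<xi> S \<longrightarrow>
      (\<forall>i<n. x0 i \<in> Rp p) \<longrightarrow>
      consensus_err n p x0 = W0 \<longrightarrow> f (avg n p x0) - fs = G0 \<longrightarrow>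
      real T \<ge> real n ^ 3 / real p \<longrightarrow>
      0 < \<alpha> \<longrightarrow> \<alpha> < \<rho>2L / (2 * \<rho>LL) \<longrightarrow>
      \<eta> = sqrt (real n) / sqrt (real p * real T) \<longrightarrow>
      (\<forall>i<n. \<forall>k\<le>T. 0 < \<delta> i k \<and>
         \<delta> i k \<le> \<kappa> / (real p powr (1/4) * real n powr (1/4) * real (k + 1) powr (1/4))) \<longrightarrow>
      (\<forall>k<T. integrable M (\<lambda>\<omega>. (vnorm p (grad p f (avg n p (X k \<omega>))))\<^sup>2)) \<and>
      (\<Sum>k<T. \<integral>\<omega>. (vnorm p (grad p f (avg n p (X k \<omega>))))\<^sup>2 \<partial>M) / real T
        \<le> K * (sqrt (real p) / sqrt (real n * real T)) + K * (real n / real T) \<and>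
      integrable M (\<lambda>\<omega>. f (avg n p (X T \<omega>))) \<and>
      (\<integral>\<omega>. f (avg n p (X T \<omega>)) \<partial>M) - fs \<le> K \<and>
      (\<forall>k<T. integrable M (\<lambda>\<omega>. consensus_err n p (X k \<omega>))) \<and>
      (\<Sum>k<T. \<integral>\<omega>. consensus_err n p (X k \<omega>) \<partial>M) / real T \<le> K * (real n / real T)"
proof -
  define r where "r = \<alpha> * \<rho>2L"
  define c1 where "c1 = 1 + 2 / r"
  define N0 where "N0 = 9 * \<sigma>2\<^sup>2 + 3 * \<sigma>1\<^sup>2"
  define K1 where "K1 = 2 / r * (W0 + 9 * c1 + c1 * (N0 + 2 * Lf\<^sup>2 * \<kappa>\<^sup>2))"
  define K2 where "K2 = G0 + Lf\<^sup>2 * K1 + Lf\<^sup>2 * \<kappa>\<^sup>2 / 2 + Lf / 2 * (9 * Lf\<^sup>2 * K1 + N0 + 2 * Lf\<^sup>2 * \<kappa>\<^sup>2)"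
  \<comment> \<open>The sum of all lower bounds that the recursions ask of the margin; the last
    summand secures \<open>\<eta> * Lf \<le> 1\<close>.\<close>
  define s where "s = 1 + 18 * c1 * Lf\<^sup>2 / r + 8 * Lf\<^sup>2 * K1 + 4 * Lf * (9 + 9 * Lf\<^sup>2 * K1) + Lf\<^sup>2"
  \<comment> \<open>Large enough for the gradient factor \<open>4 * K2\<close>, the consensus factor
    and the objective bound \<open>K2\<close> simultaneously.\<close>
  define C where "C = 4 * K2 + K1 * (1 + 4 * K2)"
  \<comment> \<open>The growth factor of the crude recursion with \<open>c\<close> equal to the
    squared margin; \<open>p\<close> is the only size left in it.\<close>
  define R where "R p = 1 + Lf + (c1 + 1 + Lf) * (s\<^sup>2 * (real p)\<^sup>2 * (real p * (18 * Lf + 9 * Lf\<^sup>2 + N0 + real p * Lf\<^sup>2 * \<kappa>\<^sup>2)))" for p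
  define Cp where "Cp p = (1 + 2 * Lf) * (R p ^ nat \<lceil>s\<^sup>2 * real p\<rceil> * (1 + W0 + G0)) * (s\<^sup>2 * real p + 1)" for p
  show ?thesis
    unfolding Let_def
  proof (rule exI[of _ C], rule exI[of _ "s\<^sup>2"], rule exI[of _ Cp], intro allI impI)
    fix n p T :: nat and \<zeta> :: real and E :: "(nat \<times> nat) set" and a :: "nat \<Rightarrow> nat \<Rightarrow> real"
      and D :: "nat \<Rightarrow> (nat \<Rightarrow> real) measure"
      and F :: "nat \<Rightarrow> (nat \<Rightarrow> real) \<Rightarrow> (nat \<Rightarrow> real) \<Rightarrow> real" and M :: "'w measure"
      and \<xi> :: "nat \<Rightarrow> nat \<Rightarrow> 'w \<Rightarrow> (nat \<Rightarrow> real)" and S :: "nat \<Rightarrow> nat \<Rightarrow> 'w \<Rightarrow> nat set"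
      and opt :: estimator and x0 \<delta> :: "nat \<Rightarrow> nat \<Rightarrow> real" and \<eta> :: real
    let ?f = "global_obj n D F"
    assume n: "1 \<le> n" and nc: "1 \<le> nc" "nc \<le> p"
      and graph: "weighted_graph n E a" "graph_connected n E"
      and "rho (laplacian n a) = \<rho>L" and \<rho>2: "rho2 (laplacian n a) = \<rho>2L"
      and \<rho>LL: "rho (laplacian n a * laplacian n a) = \<rho>LL"
      and losses: "stochastic_losses n p D F" and minimizer: "minimizers p ?f \<noteq> {}"
      and smooth: "\<forall>i<n. AE z in D i. smooth_Rp p Lf (\<lambda>x. F i x z)"
      and \<sigma>1: "\<sigma>1\<^sup>2 = real p * \<zeta>\<^sup>2"
      and noise: "\<forall>i<n. \<forall>j<p. \<forall>x\<in>Rp p.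
         integrable (D i) (\<lambda>z. (grad p (\<lambda>y. F i y z) x j - grad p (local_obj D F i) x j)\<^sup>2) \<and>
         (\<integral>z. (grad p (\<lambda>y. F i y z) x j - grad p (local_obj D F i) x j)\<^sup>2 \<partial>D i) \<le> \<zeta>\<^sup>2"
      and heterogeneity: "\<forall>i<n. \<forall>x\<in>Rp p.
         (vnorm p (vdiff p (grad p (local_obj D F i) x) (grad p ?f x)))\<^sup>2 \<le> \<sigma>2\<^sup>2"
      and M: "prob_space M" and samples: "zoom_samples M n p nc D \<xi> S"
      and x0: "\<forall>i<n. x0 i \<in> Rp p"
      and W0: "consensus_err n p x0 = W0" and G0: "?f (avg n p x0) - opt_value p ?f = G0"
      and T_cubic: "real n ^ 3 / real p \<le> real T"
      and \<alpha>: "0 < \<alpha>" "\<alpha> < \<rho>2L / (2 * \<rho>LL)"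
      and \<eta>: "\<eta> = sqrt (real n) / sqrt (real p * real T)"
      and \<delta>: "\<forall>i<n. \<forall>k\<le>T. 0 < \<delta> i k \<and>
         \<delta> i k \<le> \<kappa> / (real p powr (1/4) * real n powr (1/4) * real (k + 1) powr (1/4))"
    define d where "d k = \<kappa> / (real p powr (1/4) * real n powr (1/4) * real (k + 1) powr (1/4))" for k
    interpret step_size n p T \<eta> \<kappa> d
      by unfold_locales (use n nc T_cubic \<eta> in \<open>auto simp: d_def\<close>)
    interpret prob_space M by (rule M)
    interpret zoom_setting M n p nc T E a D F \<xi> S opt x0 \<delta> \<alpha> \<eta> Lf \<zeta> \<sigma>1 \<sigma>2 d
      by unfold_locales
        (use n nc graph losses minimizer smooth \<sigma>1 noise heterogeneity samples x0 \<alpha> \<eta>_pos assms \<delta> \<rho>2 \<rho>LL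
          in \<open>auto simp: d_def\<close>)
    have r_eq: "\<alpha> * rho2 (laplacian n a) = r" by (simp add: r_def \<rho>2)
    have r: "0 < r"
      unfolding r_def using mixing_contraction(1)[OF graph n_pos, of \<alpha>] \<alpha> by (simp add: \<rho>2 \<rho>LL)
    have N0: "0 \<le> N0" "9 * \<sigma>2\<^sup>2 + 3 * \<sigma>1\<^sup>2 = N0" by (simp_all add: N0_def)
    have c1: "1 \<le> c1" using r by (simp add: c1_def)
    have init: "w 0 = W0" "\<phi> 0 = G0" using initial_values W0 G0 by auto
    have W0_nonneg: "0 \<le> W0" using init w_nonneg[of 0] by simp
    have "0 \<le> K1" unfolding K1_def using r c1 W0_nonneg N0(1) by simp
    then have s_ge: "1 \<le> s" "18 * c1 * Lf\<^sup>2 / r \<le> s" "8 * Lf\<^sup>2 * K1 \<le> s"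
      "4 * Lf * (9 + 9 * Lf\<^sup>2 * K1) \<le> s" "Lf\<^sup>2 \<le> s"
    proof -
      have "0 \<le> 18 * c1 * Lf\<^sup>2 / r" "0 \<le> 8 * Lf\<^sup>2 * K1" "0 \<le> 4 * Lf * (9 + 9 * Lf\<^sup>2 * K1)" "0 \<le> Lf\<^sup>2"
        using r c1 assms \<open>0 \<le> K1\<close> by simp_all
      then show "1 \<le> s" "18 * c1 * Lf\<^sup>2 / r \<le> s" "8 * Lf\<^sup>2 * K1 \<le> s"
        "4 * Lf * (9 + 9 * Lf\<^sup>2 * K1) \<le> s" "Lf\<^sup>2 \<le> s" unfolding s_def by linarith+
    qed
    have w_step: "w (Suc k) \<le> (1 - r) * w k + c1 * \<eta>\<^sup>2 * est_moment Lf N0 p (d k) (w k) (\<gamma> k)" if "k < T" for k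
      using one_step(3)[OF that] iterates_integrable[of k] that by (simp add: r_eq N0 c1_def)
    let ?K = "if s\<^sup>2 * real p / real n \<le> real T then C else Cp p"
    have main: "(\<Sum>k<T. \<gamma> k) / real T \<le> ?K * (sqrt (real p) / sqrt (real n * real T)) + ?K * (real n / real T) \<and>
      \<phi> T \<le> ?K \<and> (\<Sum>k<T. w k) / real T \<le> ?K * (real n / real T)"
    proof (cases "s\<^sup>2 * real p / real n \<le> real T")
      case True
      interpret large_step_size n p T \<eta> \<kappa> d s
        by unfold_locales (use s_ge(1) True in auto)
      have \<eta>Lf: "\<eta> * Lf \<le> 1" by (rule \<eta>_le) (use assms s_ge(5) in auto)
      have \<phi>_step: "\<phi> (Suc k) \<le> \<phi> k - \<eta> / 2 * \<gamma> k + \<eta> * Lf\<^sup>2 * w k + \<eta> * real p * Lf\<^sup>2 * (d k)\<^sup>2 / 4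
          + Lf * \<eta>\<^sup>2 * est_moment Lf N0 p (d k) (w k) (\<gamma> k) / (2 * real n)" if "k < T" for k
        using one_step(5)[OF that _ _ \<eta>Lf] iterates_integrable[of k] that by (simp add: N0)
      note bounds = recursion_bounds[where w = w and \<phi> = \<phi> and \<Gamma> = \<gamma> and r = r and Lf = Lf and ?N0.0 = N0
          and ?W0.0 = W0 and ?G0.0 = G0, folded c1_def, folded K1_def, folded K2_def,
          OF r assms(1) N0(1) s_ge(2-4) init w_nonneg \<phi>_nonneg \<gamma>_nonneg w_step \<phi>_step]
      have b1: "(\<Sum>k<T. \<gamma> k) / real T \<le> 4 * K2 * (sqrt (real p) / sqrt (real n * real T))" by (rule bounds(1))
      have b2: "\<phi> T \<le> K2" by (rule bounds(2))
      have b3: "(\<Sum>k<T. w k) / real T \<le> K1 * (1 + 4 * K2) * (real n / real T)" by (rule bounds(3))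
      have b4: "0 \<le> K1" by (rule bounds(4))
      have b5: "0 \<le> K2" by (rule bounds(5))
      note b = b1 b2 b3 b4 b5
      from b have C: "4 * K2 \<le> C" "K1 * (1 + 4 * K2) \<le> C" "0 \<le> C" by (auto simp: C_def)
      have "4 * K2 * (sqrt (real p) / sqrt (real n * real T)) \<le> C * (sqrt (real p) / sqrt (real n * real T))"
        "K1 * (1 + 4 * K2) * (real n / real T) \<le> C * (real n / real T)" "0 \<le> C * (real n / real T)"
        by (intro mult_right_mono mult_nonneg_nonneg C; simp)+
      moreover have "K2 \<le> C" using b(5) C(1) by linarith
      ultimately show ?thesis using b unfolding if_P[OF True] by (intro conjI; linarith)
    next
      case False
      have \<phi>_step: "\<phi> (Suc k) \<le> \<phi> k + \<gamma> k / 2 + (1 + Lf) * \<eta>\<^sup>2 * est_moment Lf N0 p (d k) (w k) (\<gamma> k) / 2"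
        if "k < T" for k
        using one_step(4)[OF that] iterates_integrable[of k] that by (simp add: N0)
      have "1 \<le> s\<^sup>2" using s_ge(1) by simp
      note bounds = crude_recursion_bounds[where w = w and \<phi> = \<phi> and \<Gamma> = \<gamma> and c = "s\<^sup>2" and ?c1.0 = c1 and r = r
          and Lf = Lf and ?N0.0 = N0 and ?W0.0 = W0 and ?G0.0 = G0, folded R_def, folded Cp_def,
          OF this _ assms(1) N0(1) _ r init w_nonneg \<phi>_nonneg \<gamma>_le_\<phi> w_step \<phi>_step]
      have small: "real T < s\<^sup>2 * real p / real n" and c1': "0 \<le> c1" using False c1 by auto
      have b1: "(\<Sum>k<T. \<gamma> k) / real T \<le> Cp p * (real n / real T)" by (rule bounds(1)[OF small c1'])
      have b2: "\<phi> T \<le> Cp p" by (rule bounds(2)[OF small c1'])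
      have b3: "(\<Sum>k<T. w k) / real T \<le> Cp p * (real n / real T)" by (rule bounds(3)[OF small c1'])
      have b4: "0 \<le> Cp p" by (rule bounds(4)[OF small c1'])
      note b = b1 b2 b3 b4
      \<comment> \<open>The crude bound achieves the rate \<open>n / T\<close> alone; the other rate
        is added as a nonnegative term.\<close>
      have "0 \<le> Cp p * (sqrt (real p) / sqrt (real n * real T))"
        by (intro mult_nonneg_nonneg b(4)) simp
      then show ?thesis using b unfolding if_not_P[OF False] by (intro conjI; linarith)
    qed
    show "(\<forall>k<T. integrable M (\<lambda>\<omega>. (vnorm p (grad p ?f (avg n p (X k \<omega>))))\<^sup>2)) \<and>
      (\<Sum>k<T. \<integral>\<omega>. (vnorm p (grad p ?f (avg n p (X k \<omega>))))\<^sup>2 \<partial>M) / real T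
        \<le> ?K * (sqrt (real p) / sqrt (real n * real T)) + ?K * (real n / real T) \<and>
      integrable M (\<lambda>\<omega>. ?f (avg n p (X T \<omega>))) \<and>
      (\<integral>\<omega>. ?f (avg n p (X T \<omega>)) \<partial>M) - opt_value p ?f \<le> ?K \<and>
      (\<forall>k<T. integrable M (\<lambda>\<omega>. consensus_err n p (X k \<omega>))) \<and>
      (\<Sum>k<T. \<integral>\<omega>. consensus_err n p (X k \<omega>) \<partial>M) / real T \<le> ?K * (real n / real T)"
      by (rule conclusion) (use main in auto)
  qed
qed

end
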